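(* Let $G$ be a closed subgroup of $S_\infty$ with a non-trivial central involution (that is, an element $s\neq 1$ of the center of $G$ with $s^2=1$). Then $G$ is displayable on each of the real Banach spaces $c_0$, $C([0,1])$, $\ell_p$ and $L_p$, for $1\leqslant p<\infty$.
   Context: $S_\infty$ is the group of all permutations of $\mathbb{N}$ with the permutation group topology, i.e. the topology whose basic open sets are $\{g\in S_\infty : g(x_i)=f(x_i),\ i=1,\dots,n\}$ for $f\in S_\infty$ and $x_1,\dots,x_n\in\mathbb{N}$. $L_p$ means $L_p([0,1])$. For a Banach space $X$ with norm $|\!|\!|\cdot|\!|\!|$, $\mathrm{Isom}(X,|\!|\!|\cdot|\!|\!|)$ is the group of surjective linear isometries, equipped with the strong operator topology (pointwise convergence on $X$), and $GL(X)$ is the group of linear automorphisms (bounded with bounded inverse), also with the strong operator topology. A display of a topological group $G$ on $X$ is a group homomorphism $\rho\colon G\to GL(X)$ which is a topological isomorphism onto its image $\rho(G)$ (with the strong operator topology) and such that $\rho(G)=\mathrm{Isom}(X,|\!|\!|\cdot|\!|\!|)$ for some equivalent norm $|\!|\!|\cdot|\!|\!|$ on $X$. $G$ is displayable on $X$ if there exists a display of $G$ on $X$. *)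

theory Defs
  imports "HOL-Analysis.Analysis" "HOL-Algebra.Bij" "HOL-Library.Function_Algebras"
begin

text \<open>The group is \<open>BijGroup UNIV\<close>. The basic open sets prescribe a permutation
  \<open>f\<close> on a finite set \<open>A\<close>; they are closed under finite intersections up to the empty set.\<close>

abbreviation Sinf :: "(nat \<Rightarrow> nat) monoid" where
  "Sinf \<equiv> BijGroup UNIV"

definition Sinf_topology :: "(nat \<Rightarrow> nat) topology" where
  "Sinf_topology = topology_generated_by
     {U. \<exists>f\<in>carrier Sinf. \<exists>A. finite A \<and> U = {g \<in> carrier Sinf. \<forall>x\<in>A. g x = f x}}"

text \<open>A real normed space is given by a linear subspace \<open>V\<close> of a real vector space type together
  with a norm \<open>N\<close>, of which only the values on \<open>V\<close> are relevant. A map on \<open>V\<close> is represented by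
  a function that is \<open>extensional\<close> on \<open>V\<close>, so that equality of maps is equality of functions.\<close>

definition norm_on :: "'a::real_vector set \<Rightarrow> ('a \<Rightarrow> real) \<Rightarrow> bool" where
  "norm_on V N \<longleftrightarrow>
     (\<forall>x\<in>V. 0 \<le> N x \<and> (N x = 0 \<longleftrightarrow> x = 0)) \<and>
     (\<forall>x\<in>V. \<forall>c. N (c *\<^sub>R x) = \<bar>c\<bar> * N x) \<and>
     (\<forall>x\<in>V. \<forall>y\<in>V. N (x + y) \<le> N x + N y)"

definition equivalent_norm :: "'a::real_vector set \<Rightarrow> ('a \<Rightarrow> real) \<Rightarrow> ('a \<Rightarrow> real) \<Rightarrow> bool" where
  "equivalent_norm V N M \<longleftrightarrow>
     norm_on V M \<and> (\<exists>a>0. \<exists>b>0. \<forall>x\<in>V. a * N x \<le> M x \<and> M x \<le> b * N x)"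

text \<open>The locale \<open>Metric_space\<close> requires nonnegativity and symmetry also outside the carrier,
  where \<open>N\<close> is arbitrary; hence the case distinction.\<close>

definition norm_dist :: "'a::real_vector set \<Rightarrow> ('a \<Rightarrow> real) \<Rightarrow> 'a \<Rightarrow> 'a \<Rightarrow> real" where
  "norm_dist V N x y = (if x \<in> V \<and> y \<in> V then N (x - y) else 0)"

definition norm_topology :: "'a::real_vector set \<Rightarrow> ('a \<Rightarrow> real) \<Rightarrow> 'a topology" where
  "norm_topology V N = Metric_space.mtopology V (norm_dist V N)"

lemma Metric_space_norm_dist:
  assumes "subspace V" "norm_on V N"
  shows "Metric_space V (norm_dist V N)"
proof -
  have V: "x - y \<in> V" if "x \<in> V" "y \<in> V" for x y
    using assms(1) that by (rule subspace_diff)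
  have minus: "N (- x) = N x" if "x \<in> V" for x
  proof -
    have "N ((-1) *\<^sub>R x) = \<bar>-1\<bar> * N x"
      using assms(2) that unfolding norm_on_def by blast
    then show ?thesis by simp
  qed
  have commute: "N (x - y) = N (y - x)" if "x \<in> V" "y \<in> V" for x y
    using minus[OF V[OF that]] by simp
  have triangle: "N (x - z) \<le> N (x - y) + N (y - z)" if "x \<in> V" "y \<in> V" "z \<in> V" for x y z
  proof -
    have "N (u + v) \<le> N u + N v" if "u \<in> V" "v \<in> V" for u v
      using assms(2) that unfolding norm_on_def by simp
    from this[OF V[OF that(1,2)] V[OF that(2,3)]]
    show ?thesis by simp
  qed
  show ?thesis
  proof
    show "0 \<le> norm_dist V N x y" for x y
      using assms(2) V unfolding norm_dist_def norm_on_def by simp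
    show "norm_dist V N x y = norm_dist V N y x" for x y
      using commute[of x y] unfolding norm_dist_def by simp
    show "norm_dist V N x y = 0 \<longleftrightarrow> x = y" if "x \<in> V" "y \<in> V" for x y
      using assms(2) V[OF that] that unfolding norm_dist_def norm_on_def by simp
    show "norm_dist V N x z \<le> norm_dist V N x y + norm_dist V N y z"
      if "x \<in> V" "y \<in> V" "z \<in> V" for x y z
      using triangle[OF that] that unfolding norm_dist_def by simp
  qed
qed

definition linear_on :: "'a::real_vector set \<Rightarrow> ('a \<Rightarrow> 'a) \<Rightarrow> bool" where
  "linear_on V T \<longleftrightarrow>
     (\<forall>x\<in>V. \<forall>y\<in>V. T (x + y) = T x + T y) \<and> (\<forall>x\<in>V. \<forall>c. T (c *\<^sub>R x) = c *\<^sub>R T x)"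

definition bounded_linear_on :: "'a::real_vector set \<Rightarrow> ('a \<Rightarrow> real) \<Rightarrow> ('a \<Rightarrow> 'a) \<Rightarrow> bool" where
  "bounded_linear_on V N T \<longleftrightarrow> linear_on V T \<and> (\<exists>B. \<forall>x\<in>V. N (T x) \<le> B * N x)"

definition GL_set :: "'a::real_vector set \<Rightarrow> ('a \<Rightarrow> real) \<Rightarrow> ('a \<Rightarrow> 'a) set" where
  "GL_set V N = {T \<in> Bij V. bounded_linear_on V N T \<and> bounded_linear_on V N (inv_into V T)}"

definition GL :: "'a::real_vector set \<Rightarrow> ('a \<Rightarrow> real) \<Rightarrow> ('a \<Rightarrow> 'a) monoid" where
  "GL V N = (BijGroup V)\<lparr>carrier := GL_set V N\<rparr>"

text \<open>The strong operator topology is the topology of pointwise convergence, that is, the trace of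
  the product topology.\<close>

definition strong_operator_topology ::
    "'a::real_vector set \<Rightarrow> ('a \<Rightarrow> real) \<Rightarrow> ('a \<Rightarrow> 'a) topology" where
  "strong_operator_topology V N =
     subtopology (product_topology (\<lambda>_. norm_topology V N) V) (GL_set V N)"

definition Isom :: "'a::real_vector set \<Rightarrow> ('a \<Rightarrow> real) \<Rightarrow> ('a \<Rightarrow> 'a) set" where
  "Isom V M = {T \<in> extensional V. linear_on V T \<and> T ` V = V \<and> (\<forall>x\<in>V. M (T x) = M x)}"

definition is_display :: "('g, 'b) monoid_scheme \<Rightarrow> 'g topology \<Rightarrow>
    'a::real_vector set \<Rightarrow> ('a \<Rightarrow> real) \<Rightarrow> ('g \<Rightarrow> 'a \<Rightarrow> 'a) \<Rightarrow> bool" where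
  "is_display G \<tau> V N \<rho> \<longleftrightarrow>
     \<rho> \<in> hom G (GL V N) \<and>
     homeomorphic_map \<tau> (subtopology (strong_operator_topology V N) (\<rho> ` carrier G)) \<rho> \<and>
     (\<exists>M. equivalent_norm V N M \<and> \<rho> ` carrier G = Isom V M)"

definition displayable :: "('g, 'b) monoid_scheme \<Rightarrow> 'g topology \<Rightarrow>
    'a::real_vector set \<Rightarrow> ('a \<Rightarrow> real) \<Rightarrow> bool" where
  "displayable G \<tau> V N \<longleftrightarrow> (\<exists>\<rho>. is_display G \<tau> V N \<rho>)"

instantiation "fun" :: (type, real_vector) real_vector
begin

definition scaleR_fun_def: "c *\<^sub>R f = (\<lambda>x. c *\<^sub>R f x)"

instance
  by standard (simp_all add: scaleR_fun_def fun_eq_iff scaleR_add_right scaleR_add_left)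

end

definition c0_space :: "(nat \<Rightarrow> real) set" where
  "c0_space = {x. x \<longlonglongrightarrow> 0}"

definition c0_norm :: "(nat \<Rightarrow> real) \<Rightarrow> real" where
  "c0_norm x = (SUP n. \<bar>x n\<bar>)"

definition lp_space :: "real \<Rightarrow> (nat \<Rightarrow> real) set" where
  "lp_space p = {x. summable (\<lambda>n. \<bar>x n\<bar> powr p)}"

definition lp_norm :: "real \<Rightarrow> (nat \<Rightarrow> real) \<Rightarrow> real" where
  "lp_norm p x = (\<Sum>n. \<bar>x n\<bar> powr p) powr (1 / p)"

text \<open>A function on the unit interval is represented by its extension by zero, which keeps the
  pointwise operations of the function type.\<close>

definition C01_space :: "(real \<Rightarrow> real) set" where
  "C01_space = {f. continuous_on {0..1} f \<and> (\<forall>t. t \<notin> {0..1} \<longrightarrow> f t = 0)}"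

definition C01_norm :: "(real \<Rightarrow> real) \<Rightarrow> real" where
  "C01_norm f = (SUP t\<in>{0..1}. \<bar>f t\<bar>)"

abbreviation lebesgue01 :: "real measure" where
  "lebesgue01 \<equiv> lebesgue_on {0..1}"

text \<open>Measurable functions on the unit interval modulo equality almost everywhere. The measure
  space of \<open>lebesgue01\<close> is \<open>{0..1}\<close>, so the values of a representative outside of it play no role.\<close>

definition ae_eq01 :: "(real \<Rightarrow> real) \<Rightarrow> (real \<Rightarrow> real) \<Rightarrow> bool" where
  "ae_eq01 f g \<longleftrightarrow> f \<in> borel_measurable lebesgue01 \<and> g \<in> borel_measurable lebesgue01 \<and>
     (AE t in lebesgue01. f t = g t)"

quotient_type L0 = "real \<Rightarrow> real" / partial: ae_eq01
proof (rule part_equivpI)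
  show "\<exists>f. ae_eq01 f f"
    by (rule exI[of _ "\<lambda>_. 0"]) (simp add: ae_eq01_def)
  show "symp ae_eq01"
    by (auto simp: symp_def ae_eq01_def)
  show "transp ae_eq01"
    unfolding transp_def ae_eq01_def by (auto elim: eventually_elim2)
qed

instantiation L0 :: real_vector
begin

lift_definition zero_L0 :: L0 is "\<lambda>_. 0"
  by (simp add: ae_eq01_def)

lift_definition plus_L0 :: "L0 \<Rightarrow> L0 \<Rightarrow> L0" is "\<lambda>f g t. f t + g t"
  unfolding ae_eq01_def by (auto elim: eventually_mono eventually_elim2)

lift_definition minus_L0 :: "L0 \<Rightarrow> L0 \<Rightarrow> L0" is "\<lambda>f g t. f t - g t"
  unfolding ae_eq01_def by (auto elim: eventually_mono eventually_elim2)

lift_definition uminus_L0 :: "L0 \<Rightarrow> L0" is "\<lambda>f t. - f t"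
  unfolding ae_eq01_def by (auto elim: eventually_mono eventually_elim2)

lift_definition scaleR_L0 :: "real \<Rightarrow> L0 \<Rightarrow> L0" is "\<lambda>c f t. c * f t"
  unfolding ae_eq01_def by (auto elim: eventually_mono eventually_elim2)

instance
  by standard (transfer, auto simp: ae_eq01_def algebra_simps)+

end

lift_definition Lp_member :: "real \<Rightarrow> L0 \<Rightarrow> bool" is
  "\<lambda>p f. integrable lebesgue01 (\<lambda>t. \<bar>f t\<bar> powr p)"
  unfolding ae_eq01_def by (intro integrable_cong_AE) (auto elim: eventually_mono eventually_elim2)

lift_definition Lp_norm :: "real \<Rightarrow> L0 \<Rightarrow> real" is
  "\<lambda>p f. (integral\<^sup>L lebesgue01 (\<lambda>t. \<bar>f t\<bar> powr p)) powr (1 / p)"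
  unfolding ae_eq01_def
  by (intro arg_cong[where f = "\<lambda>x. x powr _"] integral_cong_AE) (auto elim: eventually_mono eventually_elim2)

definition Lp_space :: "real \<Rightarrow> L0 set" where
  "Lp_space p = {f. Lp_member p f}"

end

theory Submission
  imports Defs
begin

text \<open>
  Let \<open>W\<close> be the set of finite lists of natural numbers that contain a point moved by \<open>s\<close>. The group acts
  on \<open>W\<close>, the involution acts freely, and, the group being closed, it consists of all permutations of
  \<open>W\<close> that preserve the orbits of those pairs in which the second list is longer and contains all
  entries of the first. Each of the given spaces is isomorphic to a \<open>c\<^sub>0\<close>- or \<open>\<ell>\<^sub>p\<close>-sum of countably
  many copies of some space. If the summands are indexed by \<open>W\<close> modulo \<open>s\<close>, the group acts by signed
  permutations of the summands and \<open>s\<close> acts as \<open>-1\<close>.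

  On such a sum with invariant norm \<open>N\<close> we use the norm \<open>M = max (N + q) (C * S)\<close>. Here \<open>S\<close> is the supremum
  of functionals that are sums of a coordinate at \<open>a\<close> and a small multiple of a coordinate at \<open>b\<close>, where
  the multiple encodes the orbit of \<open>(a, b)\<close>. Since \<open>N + q\<close> is nowhere locally linear, these
  functionals are, up to the factor \<open>C\<close>, the linear functionals that agree with \<open>M\<close> on some nonempty
  open set. Hence an isometry permutes them. Their limits are the first coordinates at the points
  \<open>a\<close> (and zero), so the isometry also permutes these; it therefore induces a permutation of
  \<open>W\<close> that preserves orbits of pairs, that is, an element of the group.
\<close>

section \<open>An invariant norm and its isometries\<close>

text \<open>An isometry of a new norm need not respect coordinates; what it must respect are the
  flat pieces of the norm, that is, the linear functionals that agree with it on an open set.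
  Colours, signs and levels therefore all have to be coded in coefficients of such functionals, and
  each point \<open>a\<close> needs infinitely many partners \<open>b\<close>, so that its
  coordinate becomes visible as a limit. Since -1 is an isometry for every norm, the group must
  contain a central element that acts as -1, and this is where the involution enters. Inside a
  summand, the coordinates of level \<open>i > 0\<close> must be pinned down too, in order to
  exclude isometries that act within the summands. For \<open>c0\<close> and \<open>l_p\<close> the
  summands are lines. For \<open>C([0,1])\<close> and \<open>L_p\<close> they are
  infinite-dimensional: countably many separating coordinates are required, with biorthogonal
  vectors and with values that tend to zero. They come from a triangular system of bumps at a dense
  sequence of points, after unmixing and weighting.\<close>

definition seminorm_le :: "'a::real_vector set \<Rightarrow> ('a \<Rightarrow> real) \<Rightarrow> ('a \<Rightarrow> real) \<Rightarrow> bool" where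
  "seminorm_le V N p \<longleftrightarrow>
     (\<forall>x\<in>V. 0 \<le> p x \<and> p x \<le> N x) \<and>
     (\<forall>x\<in>V. \<forall>c. p (c *\<^sub>R x) = \<bar>c\<bar> * p x) \<and>
     (\<forall>x\<in>V. \<forall>y\<in>V. p (x + y) \<le> p x + p y)"

lemma seminorm_le_SUP:
  assumes V: "subspace V" and ne: "A \<noteq> {}" and p: "\<And>r. r \<in> A \<Longrightarrow> seminorm_le V N (p r)"
  shows "seminorm_le V N (\<lambda>x. SUP r\<in>A. p r x)"
proof -
  have le: "p r x \<le> N x" and nn: "0 \<le> p r x" if "r \<in> A" "x \<in> V" for r x
    using p that unfolding seminorm_le_def by blast+
  have bdd: "bdd_above ((\<lambda>r. p r x) ` A)" if "x \<in> V" for x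
    using le that by (intro bdd_aboveI2) auto
  have upper: "p r x \<le> (SUP r\<in>A. p r x)" if "r \<in> A" "x \<in> V" for r x
    using cSUP_upper[OF that(1) bdd[OF that(2)]] .
  have sc: "c *\<^sub>R x \<in> V" if "x \<in> V" for c x
    using V that by (rule subspace_scale)
  have hle: "(SUP r\<in>A. p r (c *\<^sub>R x)) \<le> \<bar>c\<bar> * (SUP r\<in>A. p r x)" if "x \<in> V" for x c
  proof (rule cSUP_least[OF ne])
    fix r assume r: "r \<in> A"
    have "p r (c *\<^sub>R x) = \<bar>c\<bar> * p r x"
      using p[OF r] that unfolding seminorm_le_def by blast
    then show "p r (c *\<^sub>R x) \<le> \<bar>c\<bar> * (SUP r\<in>A. p r x)"
      using upper[OF r that] by (simp add: mult_left_mono)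
  qed
  show ?thesis
    unfolding seminorm_le_def
  proof (intro conjI ballI allI)
    fix x assume x: "x \<in> V"
    obtain r where r: "r \<in> A" using ne by blast
    show n: "0 \<le> (SUP r\<in>A. p r x)"
      using upper[OF r x] nn[OF r x] by linarith
    show "(SUP r\<in>A. p r x) \<le> N x"
      using le x by (intro cSUP_least[OF ne]) auto
    fix c
    show "(SUP r\<in>A. p r (c *\<^sub>R x)) = \<bar>c\<bar> * (SUP r\<in>A. p r x)"
    proof (cases "c = 0")
      case True
      then show ?thesis using hle[OF x, of 0] upper[OF r sc[OF x, of 0]] nn[OF r sc[OF x, of 0]] by auto
    next
      case False
      \<comment> \<open>The reverse inequality is \<open>hle\<close> for the factor
        \<open>inverse c\<close> at the vector \<open>c *\<^sub>R x\<close>.\<close>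
      have "(SUP r\<in>A. p r x) \<le> \<bar>inverse c\<bar> * (SUP r\<in>A. p r (c *\<^sub>R x))"
        using hle[OF sc[OF x], of "inverse c" c] False by simp
      then have "\<bar>c\<bar> * (SUP r\<in>A. p r x) \<le> \<bar>c\<bar> * (\<bar>inverse c\<bar> * (SUP r\<in>A. p r (c *\<^sub>R x)))"
        by (rule mult_left_mono) simp
      also have "\<dots> = (SUP r\<in>A. p r (c *\<^sub>R x))"
        using False by (simp add: abs_mult[symmetric] mult.assoc[symmetric])
      finally show ?thesis using hle[OF x, of c] by linarith
    qed
  next
    fix x y assume x: "x \<in> V" and y: "y \<in> V"
    show "(SUP r\<in>A. p r (x + y)) \<le> (SUP r\<in>A. p r x) + (SUP r\<in>A. p r y)"
    proof (rule cSUP_least[OF ne])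
      fix r assume r: "r \<in> A"
      have "p r (x + y) \<le> p r x + p r y"
        using p[OF r] x y unfolding seminorm_le_def by blast
      also have "\<dots> \<le> (SUP r\<in>A. p r x) + (SUP r\<in>A. p r y)"
        using upper r x y by (intro add_mono) auto
      finally show "p r (x + y) \<le> \<dots>" .
    qed
  qed
qed

text \<open>Serves the sup norms on \<open>c0_space\<close> and \<open>C01_space\<close> and the
  coordinate norm \<open>NC\<close>. The bound \<open>B\<close> makes the suprema finite;
  definiteness comes from \<open>sep\<close>.\<close>

lemma norm_on_SUP:
  assumes V: "subspace V" and ne: "A \<noteq> {}"
    and add: "\<And>r x y. r \<in> A \<Longrightarrow> x \<in> V \<Longrightarrow> y \<in> V \<Longrightarrow> l r (x + y) = l r x + l r y"
    and scale: "\<And>r x c. r \<in> A \<Longrightarrow> x \<in> V \<Longrightarrow> l r (c *\<^sub>R x) = c * l r x"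
    and le: "\<And>r x. r \<in> A \<Longrightarrow> x \<in> V \<Longrightarrow> \<bar>l r x\<bar> \<le> B x"
    and sep: "\<And>x. x \<in> V \<Longrightarrow> (\<And>r. r \<in> A \<Longrightarrow> l r x = 0) \<Longrightarrow> x = 0"
  shows "norm_on V (\<lambda>x. SUP r\<in>A. \<bar>l r x\<bar>)"
proof -
  let ?N = "\<lambda>x. SUP r\<in>A. \<bar>l r x\<bar>"
  have N: "seminorm_le V B ?N"
  proof (rule seminorm_le_SUP[OF V ne])
    show "seminorm_le V B (\<lambda>x. \<bar>l r x\<bar>)" if "r \<in> A" for r
      unfolding seminorm_le_def using that le by (auto simp: add scale abs_mult intro: abs_triangle_ineq)
  qed
  have "?N x = 0 \<longleftrightarrow> x = 0" if x: "x \<in> V" for x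
  proof
    assume 0: "?N x = 0"
    have "bdd_above ((\<lambda>r. \<bar>l r x\<bar>) ` A)" using le x by (intro bdd_aboveI2) auto
    then have "\<bar>l r x\<bar> \<le> 0" if "r \<in> A" for r
      using cSUP_upper[OF that, of "\<lambda>r. \<bar>l r x\<bar>"] 0 by simp
    then show "x = 0" using sep[OF x] by simp
  next
    assume "x = 0"
    then have "l r x = 0" if "r \<in> A" for r using scale[OF that x, of 0] by simp
    then show "?N x = 0" using ne by simp
  qed
  then show ?thesis using N unfolding norm_on_def seminorm_le_def by simp
qed

text \<open>Finitely many values exceed \<open>m\<close> and at least one does, so the largest of
  them is the supremum. Families that vanish at infinity satisfy this at every positive
  level.\<close>

lemma SUP_attained:
  fixes h :: "'b \<Rightarrow> real"
  assumes fin: "finite {b \<in> A. m < h b}" and b: "b \<in> A" "m < h b"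
  shows "\<exists>b\<in>A. h b = (SUP b\<in>A. h b) \<and> m < h b"
proof -
  let ?F = "{b \<in> A. m < h b}"
  obtain b0 where b0: "b0 \<in> ?F" "\<And>c. c \<in> ?F \<Longrightarrow> h c \<le> h b0"
  proof -
    have "Max (h ` ?F) \<in> h ` ?F" using fin b by (intro Max_in) auto
    then obtain b0 where "b0 \<in> ?F" "Max (h ` ?F) = h b0" by auto
    moreover have "h c \<le> Max (h ` ?F)" if "c \<in> ?F" for c
      using that fin by (intro Max_ge) auto
    ultimately show ?thesis using that[of b0] by force
  qed
  have "h c \<le> h b0" if "c \<in> A" for c
    using b0 that by (cases "m < h c") auto
  then have "(SUP b\<in>A. h b) = h b0"
    using b0(1) by (intro cSup_eq_maximum) auto
  then show ?thesis using b0(1) by auto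
qed

text \<open>An injective code for colours and levels with values in (1/4, 1/2]. Being below 1, the
  coefficient of the second coordinate cannot be mistaken for that of the first. Only
  \<open>lam 0\<close> equals 1/2; on positive arguments the values are at most
  \<open>lam 1 = 3 / 8\<close>, which leaves 1/2 free as a marker of the sign.\<close>

definition lam :: "nat \<Rightarrow> real" where
  "lam k = 1 / 4 + 1 / (4 * (real k + 1))"

lemma lam_gt: "1 / 4 < lam k"
  by (simp add: lam_def)

lemma lam_le: "lam k \<le> 1 / 2"
  by (simp add: lam_def field_simps)

lemma lam_le': "0 < k \<Longrightarrow> lam k \<le> 3 / 8"
  by (simp add: lam_def field_simps)

lemma lam_inj: "lam k = lam l \<longleftrightarrow> k = l"
  by (auto simp: lam_def field_simps)

text \<open>\<open>V\<close> is a space of functions on \<open>W \<times> I\<close> that are odd in the first argument, in disguise;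
  \<open>kap\<close> colours the pairs in \<open>P\<close>. The map \<open>nx\<close> is only used for \<open>q\<close> below.\<close>

locale rigid_frame =
  fixes V :: "'v::real_vector set" and N :: "'v \<Rightarrow> real"
    and W :: "'w set" and sw :: "'w \<Rightarrow> 'w" and I :: "nat set"
    and crd :: "'w \<Rightarrow> nat \<Rightarrow> 'v \<Rightarrow> real" and e :: "'w \<Rightarrow> nat \<Rightarrow> 'v" and K :: real
    and P :: "'w \<Rightarrow> 'w \<Rightarrow> bool" and kap :: "'w \<Rightarrow> 'w \<Rightarrow> nat" and nx :: "'w \<Rightarrow> 'w"
  assumes V: "subspace V" and N: "norm_on V N" and I0: "0 \<in> I" and W_ne: "W \<noteq> {}"
    and sw: "\<And>a. a \<in> W \<Longrightarrow> sw a \<in> W" "\<And>a. a \<in> W \<Longrightarrow> sw (sw a) = a" "\<And>a. a \<in> W \<Longrightarrow> sw a \<noteq> a"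
    and crd_add: "\<And>a i x y. a \<in> W \<Longrightarrow> i \<in> I \<Longrightarrow> x \<in> V \<Longrightarrow> y \<in> V \<Longrightarrow> crd a i (x + y) = crd a i x + crd a i y"
    and crd_scale: "\<And>a i x c. a \<in> W \<Longrightarrow> i \<in> I \<Longrightarrow> x \<in> V \<Longrightarrow> crd a i (c *\<^sub>R x) = c * crd a i x"
    and crd_le: "\<And>a i x. a \<in> W \<Longrightarrow> i \<in> I \<Longrightarrow> x \<in> V \<Longrightarrow> \<bar>crd a i x\<bar> \<le> N x"
    and crd_sw: "\<And>a i x. a \<in> W \<Longrightarrow> i \<in> I \<Longrightarrow> x \<in> V \<Longrightarrow> crd (sw a) i x = - crd a i x"
    and crd_sep: "\<And>x y. x \<in> V \<Longrightarrow> y \<in> V \<Longrightarrow> (\<And>a i. a \<in> W \<Longrightarrow> i \<in> I \<Longrightarrow> crd a i x = crd a i y) \<Longrightarrow> x = y"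
    and crd_c0: "\<And>x \<epsilon>. x \<in> V \<Longrightarrow> 0 < \<epsilon> \<Longrightarrow> finite {(a, i). a \<in> W \<and> i \<in> I \<and> \<epsilon> \<le> \<bar>crd a i x\<bar>}"
    and e_in: "\<And>a i. a \<in> W \<Longrightarrow> i \<in> I \<Longrightarrow> e a i \<in> V"
    and crd_e: "\<And>a i b j. a \<in> W \<Longrightarrow> i \<in> I \<Longrightarrow> b \<in> W \<Longrightarrow> j \<in> I \<Longrightarrow>
       crd b j (e a i) = (if j = i then if b = a then 1 else if b = sw a then - 1 else 0 else 0)"
    and N_e: "\<And>a. a \<in> W \<Longrightarrow> N (e a 0) \<le> K"
    and P_irr: "\<And>a b. a \<in> W \<Longrightarrow> b \<in> W \<Longrightarrow> P a b \<Longrightarrow> a \<noteq> b \<and> a \<noteq> sw b"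
    and P_fin: "\<And>b. b \<in> W \<Longrightarrow> finite {a \<in> W. P a b}"
    and P_inf: "\<And>a. a \<in> W \<Longrightarrow> infinite {b \<in> W. P a b}"
    and P_sw: "\<And>a b. a \<in> W \<Longrightarrow> b \<in> W \<Longrightarrow> P a b \<Longrightarrow> P (sw a) (sw b)"
    and kap_sw: "\<And>a b. a \<in> W \<Longrightarrow> b \<in> W \<Longrightarrow> kap (sw a) (sw b) = kap a b"
    and nx: "\<And>a. a \<in> W \<Longrightarrow> nx a \<in> W" "\<And>a. a \<in> W \<Longrightarrow> nx a \<noteq> a" "\<And>a. a \<in> W \<Longrightarrow> nx a \<noteq> sw a"
      "inj_on nx W"
begin

lemmas V_add = subspace_add[OF V] and V_scale = subspace_scale[OF V] and V_diff = subspace_diff[OF V]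

lemma N_nonneg: "x \<in> V \<Longrightarrow> 0 \<le> N x"
  and N_zero: "x \<in> V \<Longrightarrow> N x = 0 \<longleftrightarrow> x = 0"
  and N_scale: "x \<in> V \<Longrightarrow> N (c *\<^sub>R x) = \<bar>c\<bar> * N x"
  and N_add: "x \<in> V \<Longrightarrow> y \<in> V \<Longrightarrow> N (x + y) \<le> N x + N y"
  using N unfolding norm_on_def by auto

lemma crd_diff: "a \<in> W \<Longrightarrow> i \<in> I \<Longrightarrow> x \<in> V \<Longrightarrow> y \<in> V \<Longrightarrow> crd a i (x - y) = crd a i x - crd a i y"
  using crd_add[of a i x "(-1) *\<^sub>R y"] crd_scale[of a i y "-1"] V_scale[of y "-1"] by simp

text \<open>The functional \<open>fn (a, b, 0)\<close> encodes the colour of the pair \<open>(a, b)\<close> by its second coefficient. For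
  \<open>i > 0\<close> the functionals \<open>fn (a, a, i)\<close> and \<open>fn (a, sw a, i)\<close> pin down the coordinate \<open>i\<close> with its
  sign, because the ratio of their coefficients 1/2 and \<open>lam i\<close> determines \<open>i\<close>.\<close>

definition cf :: "'w \<Rightarrow> 'w \<Rightarrow> nat \<Rightarrow> real" where
  "cf a b i = (if i = 0 then lam (kap a b) else if b = a then 1 / 2 else lam i)"

definition Rl :: "('w \<times> 'w \<times> nat) set" where
  "Rl = {(a, b, i). a \<in> W \<and> b \<in> W \<and> i \<in> I \<and> (if i = 0 then P a b else b = a \<or> b = sw a)}"

definition fn :: "'w \<times> 'w \<times> nat \<Rightarrow> 'v \<Rightarrow> real" where
  "fn = (\<lambda>(a, b, i) x. crd a 0 x + cf a b i * crd b i x)"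

definition S :: "'v \<Rightarrow> real" where
  "S x = (SUP r\<in>Rl. \<bar>fn r x\<bar>)"

text \<open>The Euclidean terms \<open>g\<close> make \<open>N + q\<close> nowhere locally linear, so that the locally linear pieces of
  \<open>M\<close> all come from \<open>S\<close>.\<close>

definition g :: "'w \<Rightarrow> 'v \<Rightarrow> real" where
  "g b x = sqrt ((crd b 0 x)\<^sup>2 + (crd (nx b) 0 x)\<^sup>2)"

definition q :: "'v \<Rightarrow> real" where
  "q x = (SUP b\<in>W. g b x)"

text \<open>Near the test points of \<open>locally_linear_fn\<close> the norm \<open>N\<close> is at
  most K + 1 + 1/3 and \<open>N + q\<close> is at most three times \<open>N\<close>, whereas
  \<open>S\<close> is at least 1. Hence 3 * (K + 4/3).\<close>

definition C :: real where "C = 3 * K + 4"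

definition M :: "'v \<Rightarrow> real" where
  "M x = max (N x + q x) (C * S x)"

lemma K_nonneg: "0 \<le> K"
  using W_ne N_e N_nonneg e_in I0 by (meson ex_in_conv order_trans)

lemma C_pos: "0 < C"
  using K_nonneg by (simp add: C_def)

lemma cf_bounds: "1 / 4 < cf a b i" "cf a b i \<le> 1 / 2"
  using lam_gt lam_le by (auto simp: cf_def)

lemma Rl_ne: "Rl \<noteq> {}"
proof -
  obtain a where a: "a \<in> W" using W_ne by blast
  then obtain b where "b \<in> W" "P a b"
    using P_inf[OF a] by (metis (mono_tags, lifting) empty_Collect_eq finite.emptyI)
  then have "(a, b, 0) \<in> Rl" using a I0 by (simp add: Rl_def)
  then show ?thesis by blast
qed

lemma RlD: "(a, b, i) \<in> Rl \<Longrightarrow> a \<in> W \<and> b \<in> W \<and> i \<in> I"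
  by (simp add: Rl_def)

lemma Rl_sw: "(a, b, i) \<in> Rl \<Longrightarrow> (sw a, sw b, i) \<in> Rl"
  using sw P_sw by (auto simp: Rl_def split: if_splits)

lemma cf_sw: "(a, b, i) \<in> Rl \<Longrightarrow> cf (sw a) (sw b) i = cf a b i"
  using sw kap_sw by (auto simp: Rl_def cf_def)

lemma fn_sw: "(a, b, i) \<in> Rl \<Longrightarrow> x \<in> V \<Longrightarrow> fn (sw a, sw b, i) x = - fn (a, b, i) x"
  using RlD[of a b i] by (simp add: fn_def cf_sw crd_sw I0)

lemma fn_add: "r \<in> Rl \<Longrightarrow> x \<in> V \<Longrightarrow> y \<in> V \<Longrightarrow> fn r (x + y) = fn r x + fn r y"
  using RlD by (cases r) (simp add: fn_def crd_add I0 algebra_simps)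

lemma fn_scale: "r \<in> Rl \<Longrightarrow> x \<in> V \<Longrightarrow> fn r (c *\<^sub>R x) = c * fn r x"
  using RlD by (cases r) (simp add: fn_def crd_scale I0 algebra_simps)

lemma fn_diff: "r \<in> Rl \<Longrightarrow> x \<in> V \<Longrightarrow> y \<in> V \<Longrightarrow> fn r (x - y) = fn r x - fn r y"
  using RlD by (cases r) (simp add: fn_def crd_diff I0 algebra_simps)

lemma fn_le: assumes "r \<in> Rl" "x \<in> V" shows "\<bar>fn r x\<bar> \<le> 2 * N x"
proof -
  obtain a b i where r: "r = (a, b, i)" by (cases r)
  have m: "a \<in> W" "b \<in> W" "i \<in> I" using RlD assms r by auto
  have "\<bar>cf a b i * crd b i x\<bar> \<le> 1 * N x"
    unfolding abs_mult using cf_bounds[of a b i] crd_le[OF m(2,3) assms(2)] by (intro mult_mono) auto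
  then show ?thesis using crd_le[OF m(1) I0 assms(2)] unfolding r fn_def by simp
qed

lemma seminorm_fn: "r \<in> Rl \<Longrightarrow> seminorm_le V (\<lambda>x. 2 * N x) (\<lambda>x. \<bar>fn r x\<bar>)"
  unfolding seminorm_le_def using fn_le by (auto simp: fn_add fn_scale abs_mult)

lemma S_seminorm: "seminorm_le V (\<lambda>x. 2 * N x) S"
  unfolding S_def[abs_def] by (rule seminorm_le_SUP[OF V Rl_ne seminorm_fn])

lemma seminorm_g: assumes "b \<in> W" shows "seminorm_le V (\<lambda>x. 2 * N x) (g b)"
  unfolding seminorm_le_def
proof (intro conjI ballI allI)
  note m = assms nx(1)[OF assms]
  fix x assume x: "x \<in> V"
  show "0 \<le> g b x" by (simp add: g_def)
  have "g b x \<le> \<bar>crd b 0 x\<bar> + \<bar>crd (nx b) 0 x\<bar>"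
    unfolding g_def by (rule sqrt_sum_squares_le_sum_abs)
  then show "g b x \<le> 2 * N x"
    using crd_le[OF m(1) I0 x] crd_le[OF m(2) I0 x] by linarith
  fix c
  have "(c * crd b 0 x)\<^sup>2 + (c * crd (nx b) 0 x)\<^sup>2 = c\<^sup>2 * ((crd b 0 x)\<^sup>2 + (crd (nx b) 0 x)\<^sup>2)"
    by (simp add: power2_eq_square algebra_simps)
  then show "g b (c *\<^sub>R x) = \<bar>c\<bar> * g b x"
    using m x by (simp add: g_def crd_scale I0 real_sqrt_mult)
next
  note m = assms nx(1)[OF assms]
  fix x y assume x: "x \<in> V" and y: "y \<in> V"
  show "g b (x + y) \<le> g b x + g b y"
    using m x y unfolding g_def by (simp add: crd_add I0 real_sqrt_sum_squares_triangle_ineq)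
qed

lemma q_seminorm: "seminorm_le V (\<lambda>x. 2 * N x) q"
  unfolding q_def[abs_def] by (rule seminorm_le_SUP[OF V W_ne seminorm_g])

lemma seminorm_leD:
  assumes "seminorm_le V B p"
  shows "x \<in> V \<Longrightarrow> 0 \<le> p x" "x \<in> V \<Longrightarrow> p x \<le> B x" "x \<in> V \<Longrightarrow> p (c *\<^sub>R x) = \<bar>c\<bar> * p x"
    "x \<in> V \<Longrightarrow> y \<in> V \<Longrightarrow> p (x + y) \<le> p x + p y"
  using assms unfolding seminorm_le_def by auto

lemmas S_props = seminorm_leD[OF S_seminorm] and q_props = seminorm_leD[OF q_seminorm]

lemma bdd_fn: "x \<in> V \<Longrightarrow> bdd_above ((\<lambda>r. \<bar>fn r x\<bar>) ` Rl)"
  using fn_le by (intro bdd_aboveI2) auto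

lemma bdd_g: "x \<in> V \<Longrightarrow> bdd_above ((\<lambda>b. g b x) ` W)"
  using seminorm_leD(2)[OF seminorm_g] by (intro bdd_aboveI2) auto

lemma fn_le_S: "r \<in> Rl \<Longrightarrow> x \<in> V \<Longrightarrow> fn r x \<le> S x"
  using cSUP_upper[OF _ bdd_fn, of r x] by (simp add: S_def)

lemma g_le_q: "b \<in> W \<Longrightarrow> x \<in> V \<Longrightarrow> g b x \<le> q x"
  using cSUP_upper[OF _ bdd_g, of b x] by (simp add: q_def)

lemma M_norm: "norm_on V M"
  unfolding norm_on_def
proof (intro conjI ballI allI)
  fix x assume x: "x \<in> V"
  show "0 \<le> M x" using N_nonneg[OF x] q_props(1)[OF x] by (simp add: M_def)
  show "M x = 0 \<longleftrightarrow> x = 0"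
  proof
    assume "M x = 0"
    then have "N x + q x \<le> 0" unfolding M_def by (metis max.cobounded1)
    then show "x = 0" using N_nonneg[OF x] q_props(1)[OF x] N_zero[OF x] by simp
  next
    assume "x = 0"
    then have "N x = 0" using N_zero[OF x] by simp
    then show "M x = 0" using S_props(1,2)[OF x] q_props(1,2)[OF x] by (simp add: M_def)
  qed
  fix c
  have "max (\<bar>c\<bar> * (N x + q x)) (\<bar>c\<bar> * (C * S x)) = \<bar>c\<bar> * max (N x + q x) (C * S x)"
    by (auto simp: max_def mult_le_cancel_left)
  moreover have "N (c *\<^sub>R x) + q (c *\<^sub>R x) = \<bar>c\<bar> * (N x + q x)" "C * S (c *\<^sub>R x) = \<bar>c\<bar> * (C * S x)"
    using N_scale[OF x, of c] S_props(3)[OF x, of c] q_props(3)[OF x, of c] by (simp_all add: distrib_left)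
  ultimately show "M (c *\<^sub>R x) = \<bar>c\<bar> * M x"
    unfolding M_def by metis
next
  fix x y assume x: "x \<in> V" and y: "y \<in> V"
  have "C * S (x + y) \<le> C * S x + C * S y"
    using S_props(4)[OF x y] C_pos by (metis distrib_left less_imp_le mult_left_mono)
  then show "M (x + y) \<le> M x + M y"
    using N_add[OF x y] q_props(4)[OF x y] unfolding M_def by linarith
qed

lemma M_ge: "x \<in> V \<Longrightarrow> N x \<le> M x"
  using q_props(1)[of x] by (simp add: M_def)

lemma M_le: assumes "x \<in> V" shows "M x \<le> (3 + 2 * C) * N x"
proof -
  have "C * S x \<le> C * (2 * N x)" using S_props(2)[OF assms] C_pos by (intro mult_left_mono) auto
  moreover have "0 \<le> C * (2 * N x)" "0 \<le> N x"
    using N_nonneg[OF assms] C_pos by auto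
  ultimately show ?thesis
    using q_props(2)[OF assms] by (simp add: M_def algebra_simps)
qed

section \<open>Where the suprema \<open>S\<close> and \<open>q\<close> are attained\<close>

lemma e_Rl: "(a, b, i) \<in> Rl \<Longrightarrow> b = a \<or> b = sw a \<Longrightarrow> i \<noteq> 0"
  using P_irr[of a b] sw(2)[of a] by (auto simp: Rl_def split: if_splits)

text \<open>\<open>Rl\<close> is invariant under the involution, which negates the functionals, so
  one-sided bounds suffice.\<close>

lemma fn_bounded_above:
  assumes x: "x \<in> V" and le: "\<And>r. r \<in> Rl \<Longrightarrow> fn r x \<le> c"
  shows "S x \<le> c"
  unfolding S_def
proof (rule cSUP_least[OF Rl_ne])
  fix r assume r: "r \<in> Rl"
  obtain a b i where abi: "r = (a, b, i)" by (cases r)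
  have "- fn r x \<le> c" using le[OF Rl_sw] fn_sw r x unfolding abi by metis
  then show "\<bar>fn r x\<bar> \<le> c" using le[OF r] by linarith
qed

text \<open>Finitely many pairs (b, i) have a large coordinate, and each of them occurs with
  finitely many first indices: by \<open>P_fin\<close> on level 0, and because \<open>a\<close> is
  \<open>b\<close> or \<open>sw b\<close> on the others.\<close>

lemma finite_Rl_large:
  assumes x: "x \<in> V" and \<epsilon>: "0 < \<epsilon>"
  shows "finite {(a, b, i). (a, b, i) \<in> Rl \<and> \<epsilon> \<le> \<bar>crd b i x\<bar>}"
proof -
  let ?L = "{(b, i). b \<in> W \<and> i \<in> I \<and> \<epsilon> \<le> \<bar>crd b i x\<bar>}"
  let ?A = "\<lambda>b. {a \<in> W. P a b} \<union> {b, sw b}"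
  have "finite (SIGMA l : ?L. ?A (fst l))"
    using crd_c0[OF x \<epsilon>] P_fin by (intro finite_SigmaI) auto
  then have "finite ((\<lambda>((b, i), a). (a, b, i)) ` (SIGMA l : ?L. ?A (fst l)))" by simp
  moreover have "{(a, b, i). (a, b, i) \<in> Rl \<and> \<epsilon> \<le> \<bar>crd b i x\<bar>} \<subseteq>
      (\<lambda>((b, i), a). (a, b, i)) ` (SIGMA l : ?L. ?A (fst l))"
    using sw by (force simp: Rl_def image_iff split: if_splits)
  ultimately show ?thesis by (rule finite_subset[rotated])
qed

lemma finite_crd0_large:
  assumes x: "x \<in> V" and \<epsilon>: "0 < \<epsilon>"
  shows "finite {a \<in> W. \<epsilon> \<le> \<bar>crd a 0 x\<bar>}"
proof -
  have "{a \<in> W. \<epsilon> \<le> \<bar>crd a 0 x\<bar>} \<subseteq> fst ` {(a, i). a \<in> W \<and> i \<in> I \<and> \<epsilon> \<le> \<bar>crd a i x\<bar>}"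
    using I0 by force
  then show ?thesis using crd_c0[OF x \<epsilon>] finite_surj by blast
qed

lemma ex_P_small:
  assumes a: "a \<in> W" and x: "x \<in> V" and \<epsilon>: "0 < \<epsilon>"
  shows "\<exists>b\<in>W. P a b \<and> \<bar>crd b 0 x\<bar> < \<epsilon>"
proof (rule ccontr)
  assume "\<not> ?thesis"
  then have "{b \<in> W. P a b} \<subseteq> {a \<in> W. \<epsilon> \<le> \<bar>crd a 0 x\<bar>}" by force
  then show False using P_inf[OF a] finite_crd0_large[OF x \<epsilon>] finite_subset by blast
qed

text \<open>Among the infinitely many partners \<open>b\<close> of \<open>a\<close> some have an
  arbitrarily small coordinate, so the coordinate at \<open>a\<close> is a limit of values of
  functionals.\<close>

lemma crd_le_S:
  assumes a: "a \<in> W" and x: "x \<in> V"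
  shows "crd a 0 x \<le> S x"
proof (rule field_le_epsilon)
  fix \<epsilon> :: real assume \<epsilon>: "0 < \<epsilon>"
  obtain b where b: "b \<in> W" "P a b" "\<bar>crd b 0 x\<bar> < \<epsilon>" using ex_P_small[OF a x \<epsilon>] by blast
  have r: "(a, b, 0) \<in> Rl" using a b I0 by (simp add: Rl_def)
  have "\<bar>cf a b 0 * crd b 0 x\<bar> \<le> 1 * \<epsilon>"
    unfolding abs_mult using cf_bounds[of a b 0] b by (intro mult_mono) auto
  then show "crd a 0 x \<le> S x + \<epsilon>" using fn_le_S[OF r x] by (simp add: fn_def)
qed

text \<open>A maximising sequence of functionals either repeats itself or loses its second
  coordinate in the limit. Quantitatively: if all first coordinates stay below some m < S x, then
  values above \<open>m + \<delta>\<close> require a second coordinate of size at least \<delta>,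
  which happens finitely often.\<close>

lemma S_attained:
  assumes x: "x \<in> V"
  shows "(\<exists>r\<in>Rl. fn r x = S x) \<or> (\<exists>a\<in>W. crd a 0 x = S x)"
proof (cases "\<exists>a\<in>W. crd a 0 x = S x")
  case False
  \<comment> \<open>If some first coordinate is positive, \<open>m\<close> is their maximum, which
    is attained. Otherwise all of them vanish, because those at \<open>a\<close> and
    \<open>map s a\<close>, here \<open>sw a\<close>, are opposite, and
    \<open>m = 0\<close>.\<close>
  have "\<exists>m<S x. 0 \<le> m \<and> (\<forall>a\<in>W. crd a 0 x \<le> m)"
  proof (cases "\<exists>a\<in>W. 0 < crd a 0 x")
    case True
    then obtain a0 where a0: "a0 \<in> W" "0 < crd a0 0 x" by blast
    have "finite {a \<in> W. crd a0 0 x / 2 < crd a 0 x}"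
      by (rule finite_subset[OF _ finite_crd0_large[OF x, of "crd a0 0 x / 2"]]) (use a0 in auto)
    then obtain a where a: "a \<in> W" "crd a 0 x = (SUP a\<in>W. crd a 0 x)"
      using SUP_attained[of W "crd a0 0 x / 2" "\<lambda>a. crd a 0 x" a0] a0 by auto
    have bdd: "bdd_above ((\<lambda>a. crd a 0 x) ` W)"
      using crd_le[OF _ I0 x] by (intro bdd_aboveI2[of _ _ "N x"]) (auto simp: abs_le_iff)
    have "crd b 0 x \<le> crd a 0 x" if "b \<in> W" for b
      unfolding a(2) using that by (rule cSUP_upper[OF _ bdd])
    then show ?thesis
      using a0 order_less_le[of "crd a 0 x" "S x"] False crd_le_S[OF a(1) x] a(1)
      by (intro exI[of _ "crd a 0 x"]) (metis less_imp_le order_trans)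
  next
    case neg: False
    obtain a where a: "a \<in> W" using W_ne by blast
    have "crd (sw a) 0 x = - crd a 0 x" using crd_sw[OF a I0 x] .
    moreover have le0: "crd c 0 x \<le> 0" if "c \<in> W" for c using neg that by (metis not_less)
    ultimately have "crd a 0 x = 0" using le0[OF a] le0[OF sw(1)[OF a]] by linarith
    then have "S x \<noteq> 0" using False a by metis
    then have "0 < S x" using S_props(1)[OF x] by linarith
    then show ?thesis using le0 by (intro exI[of _ 0]) simp
  qed
  then obtain m where m: "m < S x" "0 \<le> m" "\<And>a. a \<in> W \<Longrightarrow> crd a 0 x \<le> m" by blast
  define \<delta> where "\<delta> = (S x - m) / 2"
  have \<delta>: "0 < \<delta>" using m by (simp add: \<delta>_def)
  have "{r \<in> Rl. m + \<delta> < fn r x} \<subseteq> {(a, b, i). (a, b, i) \<in> Rl \<and> \<delta> \<le> \<bar>crd b i x\<bar>}"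
  proof
    fix r assume "r \<in> {r \<in> Rl. m + \<delta> < fn r x}"
    moreover obtain a b i where abi: "r = (a, b, i)" by (cases r)
    ultimately have r: "(a, b, i) \<in> Rl" and gt: "m + \<delta> < crd a 0 x + cf a b i * crd b i x"
      by (auto simp: fn_def)
    have "\<delta> < cf a b i * crd b i x" using gt m(3)[of a] RlD[OF r] by linarith
    also have "\<dots> \<le> \<bar>cf a b i\<bar> * \<bar>crd b i x\<bar>" by (metis abs_ge_self abs_mult)
    also have "\<dots> \<le> 1 * \<bar>crd b i x\<bar>"
      using cf_bounds[of a b i] by (intro mult_right_mono) auto
    finally show "r \<in> {(a, b, i). (a, b, i) \<in> Rl \<and> \<delta> \<le> \<bar>crd b i x\<bar>}" using r abi by simp
  qed
  then have fin: "finite {r \<in> Rl. m + \<delta> < fn r x}"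
    using finite_Rl_large[OF x \<delta>] by (rule finite_subset)
  have "\<exists>r\<in>Rl. m + \<delta> < fn r x"
  proof (rule ccontr)
    assume "\<not> ?thesis"
    then have "S x \<le> m + \<delta>" by (intro fn_bounded_above[OF x]) (simp add: not_less)
    then show False using m by (simp add: \<delta>_def field_simps)
  qed
  then obtain r where r: "r \<in> Rl" "fn r x = (SUP r\<in>Rl. fn r x)"
    using SUP_attained[OF fin] by metis
  have "bdd_above ((\<lambda>r. fn r x) ` Rl)"
    using fn_le_S[OF _ x] by (intro bdd_aboveI2) auto
  then have "fn r' x \<le> fn r x" if "r' \<in> Rl" for r'
    unfolding r(2) by (rule cSUP_upper[OF that])
  then have "S x \<le> fn r x" by (rule fn_bounded_above[OF x])
  then have "fn r x = S x" using fn_le_S[OF r(1) x] by linarith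
  then show ?thesis using r(1) by blast
qed simp

text \<open>A large value of \<open>g b\<close> needs a large coordinate at \<open>b\<close> or at
  \<open>nx b\<close>; as \<open>nx\<close> is injective, both happen for finitely many
  \<open>b\<close>.\<close>

lemma q_attained:
  assumes x: "x \<in> V"
  shows "\<exists>b\<in>W. g b x = q x"
proof (cases "\<exists>b\<in>W. 0 < g b x")
  case True
  then obtain b0 where b0: "b0 \<in> W" "0 < g b0 x" by blast
  let ?L = "{a \<in> W. g b0 x / 4 \<le> \<bar>crd a 0 x\<bar>}"
  have fin: "finite ?L" using b0 by (intro finite_crd0_large[OF x]) simp
  have "{b \<in> W. g b0 x / 2 < g b x} \<subseteq> ?L \<union> {b \<in> W. nx b \<in> ?L}"
  proof
    fix b assume b: "b \<in> {b \<in> W. g b0 x / 2 < g b x}"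
    then have "g b0 x / 2 < \<bar>crd b 0 x\<bar> + \<bar>crd (nx b) 0 x\<bar>"
      using sqrt_sum_squares_le_sum_abs[of "crd b 0 x" "crd (nx b) 0 x"] by (simp add: g_def)
    then show "b \<in> ?L \<union> {b \<in> W. nx b \<in> ?L}" using b nx(1) by auto
  qed
  moreover have "finite {b \<in> W. nx b \<in> ?L}"
  proof -
    have "inj_on nx {b \<in> W. nx b \<in> ?L}" using nx(4) by (rule inj_on_subset) auto
    moreover have "nx ` {b \<in> W. nx b \<in> ?L} \<subseteq> ?L" by auto
    ultimately show ?thesis using fin inj_on_finite by blast
  qed
  ultimately have "finite {b \<in> W. g b0 x / 2 < g b x}"
    using fin by (meson finite_UnI finite_subset)
  then show ?thesis unfolding q_def using SUP_attained[of W "g b0 x / 2" "\<lambda>b. g b x" b0] b0 by auto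
next
  case False
  then have z: "g b x = 0" if "b \<in> W" for b
    using seminorm_leD(1)[OF seminorm_g[OF that] x] that False by (metis less_eq_real_def)
  then have "q x = 0" unfolding q_def using W_ne by simp
  then show ?thesis using z W_ne by auto
qed

section \<open>The linear functionals that agree with \<open>M\<close> on an open set\<close>

lemma seminorm_diff_le:
  assumes p: "seminorm_le V (\<lambda>x. B * N x) p" and x: "x \<in> V" and y: "y \<in> V"
  shows "\<bar>p y - p x\<bar> \<le> B * N (y - x)"
proof -
  have "p y \<le> p x + p (y - x)" "p x \<le> p y + p (x - y)"
    using seminorm_leD(4)[OF p x V_diff[OF y x]] seminorm_leD(4)[OF p y V_diff[OF x y]] by auto
  moreover have "N (x - y) = N (y - x)" using N_scale[OF V_diff[OF y x], of "-1"] by simp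
  ultimately show ?thesis
    using seminorm_leD(2)[OF p V_diff[OF y x]] seminorm_leD(2)[OF p V_diff[OF x y]] by auto
qed

lemma seminorm_N: "seminorm_le V (\<lambda>x. 1 * N x) N"
  unfolding seminorm_le_def using N_nonneg N_scale N_add by auto

text \<open>The notion through which isometries are controlled. The ball is taken with respect to
  \<open>N\<close>; since \<open>N\<close> and \<open>M\<close> are equivalent, composition with an
  \<open>M\<close>-isometry preserves the property.\<close>

definition locally_linear :: "('v \<Rightarrow> real) \<Rightarrow> bool" where
  "locally_linear l \<longleftrightarrow> (\<forall>x\<in>V. \<forall>y\<in>V. l (x + y) = l x + l y) \<and> (\<forall>x\<in>V. \<forall>c. l (c *\<^sub>R x) = c * l x) \<and>
     (\<exists>x\<in>V. \<exists>\<delta>>0. \<forall>y\<in>V. N (y - x) < \<delta> \<longrightarrow> M y = l y)"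

text \<open>The functional indexed by \<open>(a, b, i)\<close> is strictly dominant near \<open>e a 0 + t *\<^sub>R e b i\<close> for small \<open>t\<close>.\<close>

lemma locally_linear_fn:
  assumes r: "r \<in> Rl"
  shows "locally_linear (\<lambda>x. C * fn r x)"
proof -
  obtain a b i where abi: "r = (a, b, i)" by (cases r)
  have m: "a \<in> W" "b \<in> W" "i \<in> I" using RlD r abi by auto
  \<comment> \<open>At most 1/2 keeps the competing functionals below 1; the second bound gives
    \<open>t * N (e b i) \<le> 1\<close>, hence \<open>N x \<le> K + 1\<close>.\<close>
  define t where "t = min (1 / 2) (1 / (N (e b i) + 1))"
  have Ne: "0 \<le> N (e b i)" using N_nonneg[OF e_in[OF m(2,3)]] .
  have t: "0 < t" "t \<le> 1 / 2" using Ne by (auto simp: t_def)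
  have tN: "t * N (e b i) \<le> 1"
  proof -
    have "t * N (e b i) \<le> (1 / (N (e b i) + 1)) * N (e b i)"
      by (rule mult_right_mono) (use Ne in \<open>auto simp: t_def\<close>)
    also have "\<dots> \<le> 1" using Ne by (simp add: field_simps)
    finally show ?thesis .
  qed
  define x where "x = e a 0 + t *\<^sub>R e b i"
  have x: "x \<in> V" unfolding x_def by (intro V_add V_scale e_in m I0)
  have crd_x: "crd d j x = (if j = 0 then if d = a then 1 else if d = sw a then - 1 else 0 else 0)
      + t * (if j = i then if d = b then 1 else if d = sw b then - 1 else 0 else 0)"
    if "d \<in> W" "j \<in> I" for d j
    using that m I0 unfolding x_def
    by (simp add: crd_add crd_scale crd_e e_in V_scale)
  have sab: "sw a \<in> W" "sw b \<in> W" "sw (sw a) = a" "sw a \<noteq> a" "sw b \<noteq> b" "sw (sw b) = b" using sw m by auto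
  have i0: "i = 0 \<Longrightarrow> a \<noteq> b \<and> a \<noteq> sw b \<and> b \<noteq> sw a \<and> sw a \<noteq> sw b"
    using e_Rl[of a b i] r abi sab by metis
  have fr: "fn r x = 1 + t * cf a b i"
    using m I0 sab i0 by (auto simp: abi fn_def crd_x)
  \<comment> \<open>The gap: \<open>fn r x\<close> exceeds 1 by \<open>t * cf a b i\<close>, which
    is more than t/4. A competitor with first index \<open>a\<close> gains nothing from its second
    coordinate; any other has at most 1/2 from each of its terms.\<close>
  have small: "fn r' x \<le> 1" if r': "r' \<in> Rl" "r' \<noteq> r" for r'
  proof -
    obtain c d j where cdj: "r' = (c, d, j)" by (cases r')
    have m': "c \<in> W" "d \<in> W" "j \<in> I" using RlD r'(1) cdj by auto
    have cd: "j = 0 \<Longrightarrow> d \<noteq> c \<and> d \<noteq> sw c" using e_Rl[of c d j] r'(1) cdj by blast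
    note cfb = cf_bounds[of c d j]
    show ?thesis
    proof (cases "c = a")
      case True
      have "crd c 0 x = 1" using True m I0 i0 by (auto simp: crd_x)
      moreover have "crd d j x \<le> 0"
        using m' cd True r'(2) abi cdj t(1) by (auto simp: crd_x)
      ultimately show ?thesis using cfb by (simp add: cdj fn_def mult_nonneg_nonpos)
    next
      case False
      have "crd c 0 x \<le> 1 / 2" using False m' I0 t by (auto simp: crd_x)
      moreover have "cf c d j * crd d j x \<le> 1 / 2"
      proof (cases "0 \<le> crd d j x")
        case True
        have "crd d j x \<le> 1" using m' t i0 by (auto simp: crd_x)
        then show ?thesis using cfb True mult_mono[of "cf c d j" "1/2" "crd d j x" 1] by simp
      next
        case False
        then show ?thesis using cfb mult_nonneg_nonpos[of "cf c d j" "crd d j x"] by simp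
      qed
      ultimately show ?thesis by (simp add: cdj fn_def)
    qed
  qed
  have Nx: "N x \<le> K + 1"
  proof -
    have "N x \<le> N (e a 0) + t * N (e b i)"
      unfolding x_def using N_add[OF e_in[OF m(1) I0] V_scale[OF e_in[OF m(2,3)], of t]] N_scale[OF e_in[OF m(2,3)], of t] t
      by simp
    then show ?thesis using N_e[OF m(1)] tN by linarith
  qed
  \<comment> \<open>The functionals are 2-Lipschitz, so two of them together move by less than t/8,
    within the gap t/4. The other bound is at most 1/3 and gives \<open>N y < K + 4/3\<close>, as
    the choice of \<open>C\<close> demands.\<close>
  define \<delta> where "\<delta> = min (t / 32) (1 / (3 + 2 * C))"
  have \<delta>: "0 < \<delta>" using t C_pos by (simp add: \<delta>_def)
  have "M y = C * fn r y" if y: "y \<in> V" and d: "N (y - x) < \<delta>" for y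
  proof -
    have nn: "0 \<le> N (y - x)" using N_nonneg[OF V_diff[OF y x]] .
    have fd: "\<bar>fn r' y - fn r' x\<bar> \<le> 2 * N (y - x)" if "r' \<in> Rl" for r'
      using fn_le[OF that V_diff[OF y x]] fn_diff[OF that y x] by simp
    have t4: "t / 4 \<le> t * cf a b i" using cf_bounds[of a b i] t by (simp add: field_simps)
    have dt: "N (y - x) < t / 32" using d by (simp add: \<delta>_def)
    have "fn r' y \<le> fn r y" if r': "r' \<in> Rl" for r'
    proof (cases "r' = r")
      case False
      have "\<bar>fn r' y - fn r' x\<bar> < t / 16" "\<bar>fn r y - fn r x\<bar> < t / 16"
        using fd[OF r'] fd[OF r] dt by linarith+
      then show ?thesis using small[OF r' False] fr t4 by linarith
    qed simp
    then have S: "S y = fn r y" using fn_bounded_above[OF y] fn_le_S[OF r y] by (meson antisym)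
    have "fn r y \<ge> 1" using fd[OF r] fr t4 dt t by linarith
    then have "C * 1 \<le> C * S y" unfolding S using C_pos by (intro mult_left_mono) auto
    moreover have "N y + q y \<le> 3 * N y" using q_props(2)[OF y] by simp
    moreover have "N y \<le> N x + N (y - x)" using N_add[OF x V_diff[OF y x]] by simp
    moreover have "N (y - x) < 1 / 3"
    proof -
      have "1 / (3 + 2 * C) \<le> 1 / 3" using C_pos by (simp add: field_simps)
      then show ?thesis using d by (simp add: \<delta>_def)
    qed
    ultimately have "N y + q y \<le> C * S y" using Nx by (simp add: C_def)
    then show ?thesis by (simp add: M_def S)
  qed
  then show ?thesis
    unfolding locally_linear_def using fn_add[OF r] fn_scale[OF r] x \<delta>
    by (auto simp: algebra_simps)
qed

lemma N_small:
  assumes "h \<in> V" "0 < \<delta>"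
  obtains \<tau> where "0 < \<tau>" "N (\<tau> *\<^sub>R h) < \<delta>"
proof
  show "0 < \<delta> / (2 * (N h + 1))" using assms N_nonneg[OF assms(1)] by simp
  have "N ((\<delta> / (2 * (N h + 1))) *\<^sub>R h) = \<delta> / (2 * (N h + 1)) * N h"
    using N_scale[OF assms(1)] assms N_nonneg[OF assms(1)] by simp
  also have "\<dots> < \<delta>" using assms N_nonneg[OF assms(1)] by (simp add: field_simps add_strict_increasing)
  finally show "N ((\<delta> / (2 * (N h + 1))) *\<^sub>R h) < \<delta>" .
qed

text \<open>A seminorm below the linear function \<open>l\<close> that touches it at an interior point is additive along
  every line through that point; this fails for \<open>g b\<close>.\<close>

lemma not_locally_linear_Nq:
  assumes l: "\<And>x y. x \<in> V \<Longrightarrow> y \<in> V \<Longrightarrow> l (x + y) = l x + l y"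
    and x: "x \<in> V" and \<delta>: "0 < \<delta>" and eq: "\<And>y. y \<in> V \<Longrightarrow> N (y - x) < \<delta> \<Longrightarrow> N y + q y = l y"
  shows False
proof -
  obtain b where b: "b \<in> W" "g b x = q x" using q_attained[OF x] by blast
  have nb: "nx b \<in> W" "nx b \<noteq> b" "nx b \<noteq> sw b" using nx b by auto
  have nb': "b \<noteq> sw (nx b)" using sw(2)[OF nb(1)] nb(3) by metis
  \<comment> \<open>Along the segment \<open>N + q\<close> is linear, \<open>N\<close> is convex,
    and \<open>g b\<close> lies below \<open>q\<close> with equality at \<open>x\<close>; so
    \<open>g b\<close> inherits the inequality opposite to convexity.\<close>
  have key: "g b (x + h) + g b (x - h) \<le> 2 * g b x" if h: "h \<in> V" "N h < \<delta>" for h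
  proof -
    have Nh: "N (- h) = N h" using N_scale[OF h(1), of "-1"] by simp
    have p: "x + h \<in> V" "x - h \<in> V" "x + x \<in> V" using V_add V_diff x h by auto
    have xx: "(x + h) + (x - h) = x + x" by simp
    have "N (x + h) + q (x + h) = l (x + h)" "N (x - h) + q (x - h) = l (x - h)"
      using eq[OF p(1)] eq[OF p(2)] h Nh by auto
    moreover have "l (x + h) + l (x - h) = l x + l x"
      using l[OF p(1,2)] l[OF x x] xx by simp
    moreover have "N x + q x = l x" using eq[OF x] \<delta> N_zero[OF subspace_0[OF V]] by simp
    moreover have "2 * N x \<le> N (x + h) + N (x - h)"
      using N_add[OF p(1,2)] N_scale[OF x, of 2] unfolding xx by (simp add: scaleR_2)
    moreover have "g b (x + h) \<le> q (x + h)" "g b (x - h) \<le> q (x - h)"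
      using g_le_q b p by auto
    ultimately show ?thesis using b(2) by linarith
  qed
  define u where "u = crd b 0 x"
  define v where "v = crd (nx b) 0 x"
  \<comment> \<open>In the plane of the two coordinates, \<open>w\<close> is perpendicular to (u,
    v), so the Euclidean norm grows strictly in both directions. At the origin every direction
    serves.\<close>
  define w where "w = (if u = 0 \<and> v = 0 then e b 0 else u *\<^sub>R e (nx b) 0 - v *\<^sub>R e b 0)"
  have w: "w \<in> V" unfolding w_def using b nb nb' I0 by (auto intro!: V_diff V_scale e_in)
  have cw: "crd b 0 w = (if u = 0 \<and> v = 0 then 1 else - v)" "crd (nx b) 0 w = (if u = 0 \<and> v = 0 then 0 else u)"
    unfolding w_def using b nb nb' I0 by (auto simp: crd_diff crd_scale crd_e e_in V_scale)
  obtain \<tau> where \<tau>: "0 < \<tau>" "N (\<tau> *\<^sub>R w) < \<delta>" using N_small[OF w \<delta>] by blast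
  have gp: "g b (x + \<tau> *\<^sub>R w) = sqrt ((u + \<tau> * crd b 0 w)\<^sup>2 + (v + \<tau> * crd (nx b) 0 w)\<^sup>2)"
    "g b (x - \<tau> *\<^sub>R w) = sqrt ((u - \<tau> * crd b 0 w)\<^sup>2 + (v - \<tau> * crd (nx b) 0 w)\<^sup>2)"
    "g b x = sqrt (u\<^sup>2 + v\<^sup>2)"
    unfolding g_def u_def v_def using b nb nb' I0 w x by (simp_all add: crd_add crd_diff crd_scale V_scale)
  have "u\<^sup>2 + v\<^sup>2 < (u + \<tau> * crd b 0 w)\<^sup>2 + (v + \<tau> * crd (nx b) 0 w)\<^sup>2"
    "u\<^sup>2 + v\<^sup>2 < (u - \<tau> * crd b 0 w)\<^sup>2 + (v - \<tau> * crd (nx b) 0 w)\<^sup>2"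
  proof -
    have pos: "0 < \<tau>\<^sup>2 * ((crd b 0 w)\<^sup>2 + (crd (nx b) 0 w)\<^sup>2)"
      using \<tau> by (auto simp: cw sum_power2_gt_zero_iff)
    have orth: "u * crd b 0 w + v * crd (nx b) 0 w = 0" by (simp add: cw)
    have "(u + \<sigma> * crd b 0 w)\<^sup>2 + (v + \<sigma> * crd (nx b) 0 w)\<^sup>2
        = u\<^sup>2 + v\<^sup>2 + \<sigma>\<^sup>2 * ((crd b 0 w)\<^sup>2 + (crd (nx b) 0 w)\<^sup>2) + 2 * \<sigma> * (u * crd b 0 w + v * crd (nx b) 0 w)" for \<sigma>
      by (simp add: power2_eq_square algebra_simps)
    from this[of \<tau>] this[of "-\<tau>"] show "u\<^sup>2 + v\<^sup>2 < (u + \<tau> * crd b 0 w)\<^sup>2 + (v + \<tau> * crd (nx b) 0 w)\<^sup>2"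
    "u\<^sup>2 + v\<^sup>2 < (u - \<tau> * crd b 0 w)\<^sup>2 + (v - \<tau> * crd (nx b) 0 w)\<^sup>2"
      using pos unfolding orth by simp_all
  qed
  then have "g b x < g b (x + \<tau> *\<^sub>R w)" "g b x < g b (x - \<tau> *\<^sub>R w)"
    unfolding gp by simp_all
  then show False using key[OF V_scale[OF w] \<tau>(2)] by linarith
qed

text \<open>The linear function k - l is nonpositive near \<open>x\<close> and zero at
  \<open>x\<close>; evaluating it at x + \<tau>h and at x - \<tau>h gives both inequalities at
  \<open>h\<close>.\<close>

lemma touching:
  assumes l: "\<And>x y. x \<in> V \<Longrightarrow> y \<in> V \<Longrightarrow> l (x + y) = l x + l y" "\<And>x c. x \<in> V \<Longrightarrow> l (c *\<^sub>R x) = c * l x"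
    and k: "\<And>x y. x \<in> V \<Longrightarrow> y \<in> V \<Longrightarrow> k (x + y) = k x + k y" "\<And>x c. x \<in> V \<Longrightarrow> k (c *\<^sub>R x) = c * k x"
    and x: "x \<in> V" and \<delta>: "0 < \<delta>" and le: "\<And>y. y \<in> V \<Longrightarrow> N (y - x) < \<delta> \<Longrightarrow> k y \<le> l y"
    and eq: "k x = (l x :: real)" and h: "h \<in> V"
  shows "k h = l h"
proof -
  obtain \<tau> where \<tau>: "0 < \<tau>" "N (\<tau> *\<^sub>R h) < \<delta>" using N_small[OF h \<delta>] by blast
  have m: "\<tau> *\<^sub>R h \<in> V" "(-\<tau>) *\<^sub>R h \<in> V" by (rule V_scale[OF h])+
  have Nm: "N ((-\<tau>) *\<^sub>R h) < \<delta>" using \<tau> N_scale[OF h, of "-\<tau>"] N_scale[OF h, of \<tau>] by simp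
  have "k (x + \<tau> *\<^sub>R h) \<le> l (x + \<tau> *\<^sub>R h)" "k (x + (-\<tau>) *\<^sub>R h) \<le> l (x + (-\<tau>) *\<^sub>R h)"
    using le[OF V_add[OF x m(1)]] le[OF V_add[OF x m(2)]] \<tau> Nm by simp_all
  then have "\<tau> * k h \<le> \<tau> * l h" "\<tau> * l h \<le> \<tau> * k h"
    using eq by (simp_all only: l(1)[OF x m(1)] l(1)[OF x m(2)] k(1)[OF x m(1)] k(1)[OF x m(2)] l(2)[OF h] k(2)[OF h])
  then show ?thesis using \<tau> by simp
qed

text \<open>On the ball \<open>C * S\<close> must dominate, for otherwise \<open>N + q\<close> would
  be linear near some point. So \<open>C * S = l\<close> there, and the functional that attains
  \<open>S x\<close> touches \<open>l\<close>. It cannot be a bare coordinate at \<open>a\<close>: a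
  small step towards a partner \<open>b\<close> leaves this coordinate fixed but increases
  \<open>fn (a, b, 0)\<close> beyond it.\<close>

lemma locally_linear_imp_fn:
  assumes "locally_linear l"
  shows "\<exists>r\<in>Rl. \<forall>y\<in>V. l y = C * fn r y"
proof -
  obtain x \<delta> where l: "\<And>x y. x \<in> V \<Longrightarrow> y \<in> V \<Longrightarrow> l (x + y) = l x + l y" "\<And>x c. x \<in> V \<Longrightarrow> l (c *\<^sub>R x) = c * l x"
    and x: "x \<in> V" and \<delta>: "0 < \<delta>" and eq: "\<And>y. y \<in> V \<Longrightarrow> N (y - x) < \<delta> \<Longrightarrow> M y = l y"
    using assms unfolding locally_linear_def by blast
  have le: "N y + q y \<le> C * S y" if y: "y \<in> V" "N (y - x) < \<delta>" for y
  proof (rule ccontr)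
    assume "\<not> ?thesis"
    then have gap: "0 < N y + q y - C * S y" by simp
    \<comment> \<open>\<open>N\<close>, \<open>q\<close> and \<open>C * S\<close> have Lipschitz
      constants 1, 2 and 2C, so the gap persists within this radius, and the smaller ball stays
      inside the given one.\<close>
    define \<eta> where "\<eta> = min (\<delta> - N (y - x)) ((N y + q y - C * S y) / (3 + 2 * C))"
    have \<eta>: "0 < \<eta>" using gap y C_pos by (simp add: \<eta>_def)
    have "N z + q z = l z" if z: "z \<in> V" "N (z - y) < \<eta>" for z
    proof -
      have "N z + q z - C * S z \<ge> 0"
      proof -
        have "N (z - y) * (3 + 2 * C) \<le> (N y + q y - C * S y)"
        proof -
          have "N (z - y) \<le> (N y + q y - C * S y) / (3 + 2 * C)" using z by (simp add: \<eta>_def)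
          then show ?thesis using C_pos by (simp add: pos_le_divide_eq)
        qed
        moreover have "\<bar>N z - N y\<bar> \<le> 1 * N (z - y)" "\<bar>q z - q y\<bar> \<le> 2 * N (z - y)"
          using seminorm_diff_le[OF seminorm_N y(1) z(1)] seminorm_diff_le[OF q_seminorm y(1) z(1)] by auto
        moreover have "C * \<bar>S z - S y\<bar> \<le> C * (2 * N (z - y))"
          using seminorm_diff_le[OF S_seminorm y(1) z(1)] C_pos by (intro mult_left_mono) auto
        moreover have "C * S z - C * S y \<le> C * \<bar>S z - S y\<bar>"
          using C_pos by (metis abs_ge_self mult_left_mono less_imp_le right_diff_distrib)
        ultimately show ?thesis by (simp add: algebra_simps)
      qed
      then have "M z = N z + q z" by (simp add: M_def)
      moreover have "N (z - x) < \<delta>"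
        using N_add[OF V_diff[OF z(1) y(1)] V_diff[OF y(1) x]] z by (simp add: \<eta>_def)
      ultimately show ?thesis using eq z by simp
    qed
    then show False using not_locally_linear_Nq[of l y \<eta>] l(1) y(1) \<eta> by blast
  qed
  have leq: "C * S y = l y" if "y \<in> V" "N (y - x) < \<delta>" for y
    using eq[OF that] le[OF that] by (simp add: M_def)
  have xx: "N (x - x) < \<delta>" using \<delta> N_zero[OF subspace_0[OF V]] by simp
  have "\<not> (\<exists>a\<in>W. crd a 0 x = S x)"
  proof
    assume "\<exists>a\<in>W. crd a 0 x = S x"
    then obtain a where a: "a \<in> W" "crd a 0 x = S x" by blast
    have la: "C * crd a 0 h = l h" if h: "h \<in> V" for h
    proof (rule touching[where l = l and k = "\<lambda>h. C * crd a 0 h" and x = x and \<delta> = \<delta>])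
      show "C * crd a 0 (y + z) = C * crd a 0 y + C * crd a 0 z" if "y \<in> V" "z \<in> V" for y z
        using that a I0 by (simp add: crd_add algebra_simps)
      show "C * crd a 0 (c *\<^sub>R y) = c * (C * crd a 0 y)" if "y \<in> V" for y c
        using that a I0 by (simp add: crd_scale algebra_simps)
      show "C * crd a 0 y \<le> l y" if "y \<in> V" "N (y - x) < \<delta>" for y
        using leq[OF that] crd_le_S[OF a(1) that(1)] C_pos by (metis less_imp_le mult_left_mono)
      show "C * crd a 0 x = l x" using leq[OF x xx] a by simp
    qed (use l x \<delta> h in auto)
    \<comment> \<open>A step of length \<epsilon> along \<open>e b 0\<close> stays in the ball, and
      since the coordinate of \<open>x\<close> at \<open>b\<close> is smaller than \<epsilon> it
      becomes positive.\<close>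
    define \<epsilon> where "\<epsilon> = \<delta> / (2 * (K + 1))"
    have \<epsilon>: "0 < \<epsilon>" using \<delta> K_nonneg by (simp add: \<epsilon>_def)
    obtain b where b: "b \<in> W" "P a b" "\<bar>crd b 0 x\<bar> < \<epsilon>" using ex_P_small[OF a(1) x \<epsilon>] by blast
    have r: "(a, b, 0) \<in> Rl" using a b I0 by (simp add: Rl_def)
    have ab: "a \<noteq> b" "a \<noteq> sw b" "sw b \<noteq> b" using P_irr[OF a(1) b(1,2)] sw b by auto
    define y where "y = x + \<epsilon> *\<^sub>R e b 0"
    have y: "y \<in> V" unfolding y_def by (intro V_add V_scale e_in x b I0)
    have "N (y - x) = \<epsilon> * N (e b 0)" using N_scale[OF e_in[OF b(1) I0]] \<epsilon> by (simp add: y_def)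
    also have "\<dots> \<le> \<epsilon> * K" using N_e[OF b(1)] \<epsilon> by (intro mult_left_mono) auto
    also have "\<dots> < \<delta>" using \<delta> K_nonneg by (simp add: \<epsilon>_def field_simps add_strict_increasing)
    finally have yx: "N (y - x) < \<delta>" .
    have cy: "crd a 0 y = crd a 0 x" "crd b 0 y = crd b 0 x + \<epsilon>"
      using a b ab I0 x by (simp_all add: y_def crd_add crd_scale crd_e V_scale e_in)
    have "0 < cf a b 0 * crd b 0 y" using cf_bounds[of a b 0] b(3) unfolding cy by (intro mult_pos_pos) auto
    then have "crd a 0 y < S y" using fn_le_S[OF r y] by (simp add: fn_def)
    then have "C * crd a 0 y < C * S y" using C_pos by simp
    then show False using leq[OF y yx] la[OF y] by simp
  qed
  then obtain r where r: "r \<in> Rl" "fn r x = S x" using S_attained[OF x] by blast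
  have "C * fn r h = l h" if h: "h \<in> V" for h
  proof (rule touching[where l = l and k = "\<lambda>h. C * fn r h" and x = x and \<delta> = \<delta>])
    show "C * fn r (y + z) = C * fn r y + C * fn r z" if "y \<in> V" "z \<in> V" for y z
      using that r by (simp add: fn_add algebra_simps)
    show "C * fn r (c *\<^sub>R y) = c * (C * fn r y)" if "y \<in> V" for y c
      using that r by (simp add: fn_scale algebra_simps)
    show "C * fn r y \<le> l y" if "y \<in> V" "N (y - x) < \<delta>" for y
      using leq[OF that] fn_le_S[OF r(1) that(1)] C_pos by (metis less_imp_le mult_left_mono)
    show "C * fn r x = l x" using leq[OF x xx] r by simp
  qed (use l x \<delta> h in auto)
  then show ?thesis using r(1) by force
qed

end

section \<open>Isometries permute functionals and coordinates\<close>

lemma linear_on_diff: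
  assumes "subspace V" "linear_on V T" "x \<in> V" "y \<in> V"
  shows "T (x - y) = T x - T y"
proof -
  have m: "(-1) *\<^sub>R y \<in> V" using assms subspace_scale by blast
  have "T (x + (-1) *\<^sub>R y) = T x + T ((-1) *\<^sub>R y)" using assms m unfolding linear_on_def by blast
  moreover have "T ((-1) *\<^sub>R y) = (-1) *\<^sub>R T y" using assms unfolding linear_on_def by blast
  ultimately show ?thesis by simp
qed

lemma Isom_inverse:
  assumes V: "subspace V" and M: "norm_on V M" and T: "T \<in> Isom V M"
  obtains T' where "T' \<in> Isom V M" "\<And>x. x \<in> V \<Longrightarrow> T' (T x) = x" "\<And>x. x \<in> V \<Longrightarrow> T (T' x) = x"
proof -
  have lin: "linear_on V T" and im: "T ` V = V" and iso: "\<And>x. x \<in> V \<Longrightarrow> M (T x) = M x"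
    using T by (auto simp: Isom_def)
  have inj: "inj_on T V"
  proof (rule inj_onI)
    fix x y assume xy: "x \<in> V" "y \<in> V" "T x = T y"
    have d: "x - y \<in> V" using subspace_diff[OF V] xy by blast
    have "M (T (x - y)) = 0"
      using linear_on_diff[OF V lin xy(1,2)] xy(3) M subspace_0[OF V] unfolding norm_on_def by simp
    then have "M (x - y) = 0" using iso[OF d] by simp
    then show "x = y" using M d unfolding norm_on_def by auto
  qed
  define T' where "T' = restrict (inv_into V T) V"
  have l: "T' (T x) = x" if "x \<in> V" for x
    using inj im that by (auto simp: T'_def inv_into_f_f)
  have r: "T (T' x) = x" if "x \<in> V" for x
    using im that by (simp add: T'_def f_inv_into_f)
  have in': "T' x \<in> V" if "x \<in> V" for x
    using im that by (auto simp: T'_def inv_into_into)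
  have "T' \<in> Isom V M"
    unfolding Isom_def
  proof (intro CollectI conjI ballI)
    show "T' \<in> extensional V" by (simp add: T'_def)
    show "linear_on V T'"
      unfolding linear_on_def
    proof (intro conjI ballI allI)
      fix x y assume xy: "x \<in> V" "y \<in> V"
      have "T (T' x + T' y) = x + y"
        using lin in' xy r unfolding linear_on_def by simp
      then show "T' (x + y) = T' x + T' y"
        using l[OF subspace_add[OF V in'[OF xy(1)] in'[OF xy(2)]]] by simp
    next
      fix x c assume x: "x \<in> V"
      have "T (c *\<^sub>R T' x) = c *\<^sub>R x" using lin in' x r unfolding linear_on_def by simp
      then show "T' (c *\<^sub>R x) = c *\<^sub>R T' x" using l[OF subspace_scale[OF V in'[OF x]], of c] by simp
    qed
    have "x \<in> T' ` V" if "x \<in> V" for x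
      using l[OF that] im that by (metis imageI)
    then show "T' ` V = V" using in' by blast
    show "M (T' x) = M x" if "x \<in> V" for x
      using iso[OF in'[OF that]] r[OF that] by simp
  qed
  then show ?thesis using that l r by blast
qed

context rigid_frame begin

text \<open>Pulling back by \<open>T\<close> preserves local linearity, and the locally linear
  functionals are known. The radius shrinks by the factor 3 + 2C because
  \<open>N \<le> M \<le> (3 + 2 * C) * N\<close>.\<close>

lemma isom_fn:
  assumes T: "T \<in> Isom V M" and r: "r \<in> Rl"
  shows "\<exists>r'\<in>Rl. \<forall>x\<in>V. fn r (T x) = fn r' x"
proof -
  have lin: "linear_on V T" and im: "T ` V = V" and iso: "\<And>x. x \<in> V \<Longrightarrow> M (T x) = M x"
    using T by (auto simp: Isom_def)
  have Tin: "T x \<in> V" if "x \<in> V" for x using im that by (metis imageI)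
  have "\<exists>x\<in>V. \<exists>\<delta>>0. \<forall>y\<in>V. N (y - x) < \<delta> \<longrightarrow> M y = C * fn r y"
    using locally_linear_fn[OF r] unfolding locally_linear_def by (elim conjE)
  then obtain x \<delta> where x: "x \<in> V" and \<delta>: "0 < \<delta>" and eq: "\<And>y. y \<in> V \<Longrightarrow> N (y - x) < \<delta> \<Longrightarrow> M y = C * fn r y"
    by metis
  obtain x1 where x1: "x1 \<in> V" "T x1 = x" using im x by (metis imageE)
  have "M y = C * fn r (T y)" if y: "y \<in> V" "N (y - x1) < \<delta> / (3 + 2 * C)" for y
  proof -
    have d: "y - x1 \<in> V" using V_diff y x1 by blast
    have "N (T y - x) = N (T (y - x1))" using linear_on_diff[OF V lin y(1) x1(1)] x1 by simp
    also have "\<dots> \<le> M (T (y - x1))" by (rule M_ge[OF Tin[OF d]])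
    also have "\<dots> = M (y - x1)" by (rule iso[OF d])
    also have "\<dots> \<le> (3 + 2 * C) * N (y - x1)" by (rule M_le[OF d])
    also have "\<dots> < \<delta>" using y(2) C_pos by (simp add: pos_less_divide_eq mult.commute)
    finally have "N (T y - x) < \<delta>" .
    then show ?thesis using eq[OF Tin[OF y(1)]] iso[OF y(1)] by simp
  qed
  moreover have "0 < \<delta> / (3 + 2 * C)" using \<delta> C_pos by simp
  ultimately have "\<exists>x\<in>V. \<exists>\<delta>>0. \<forall>y\<in>V. N (y - x) < \<delta> \<longrightarrow> M y = C * fn r (T y)" using x1(1) by blast
  moreover have "fn r (T (y + z)) = fn r (T y) + fn r (T z)" if "y \<in> V" "z \<in> V" for y z
    using lin fn_add[OF r Tin Tin] that unfolding linear_on_def by simp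
  moreover have "fn r (T (c *\<^sub>R y)) = c * fn r (T y)" if "y \<in> V" for y c
    using lin fn_scale[OF r Tin] that unfolding linear_on_def by simp
  ultimately have "locally_linear (\<lambda>y. C * fn r (T y))"
    unfolding locally_linear_def by (auto simp: algebra_simps)
  then show ?thesis using locally_linear_imp_fn C_pos by fastforce
qed

lemma crd_e0:
  assumes "a \<in> W" "b \<in> W" "j \<in> I"
  shows "crd b j (e a 0) = (if j = 0 then if b = a then 1 else if b = sw a then - 1 else 0 else 0)"
  using crd_e[OF assms(1) I0 assms(2,3)] by simp

text \<open>The second term contributes at most 1/2, so the value 1 must come from the first
  coordinate.\<close>

lemma fn_e0_eq_1:
  assumes r: "(a', b', i') \<in> Rl" and a: "a \<in> W" and one: "fn (a', b', i') (e a 0) = 1"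
  shows "a' = a"
proof (rule ccontr)
  assume ne: "a' \<noteq> a"
  have m: "a' \<in> W" "b' \<in> W" "i' \<in> I" using RlD[OF r] by auto
  have bb: "i' = 0 \<Longrightarrow> b' \<noteq> a' \<and> b' \<noteq> sw a'" using e_Rl[OF r] by blast
  have c0: "crd a' 0 (e a 0) \<le> 0" using crd_e0[OF a m(1) I0] ne by auto
  have "cf a' b' i' * crd b' i' (e a 0) \<le> 1 / 2 * 1"
  proof (rule order_trans[OF abs_ge_self], unfold abs_mult, rule mult_mono)
    show "\<bar>cf a' b' i'\<bar> \<le> 1 / 2" using cf_bounds[of a' b' i'] by simp
    show "\<bar>crd b' i' (e a 0)\<bar> \<le> 1" using crd_e0[OF a m(2,3)] by auto
  qed auto
  then show False using one c0 by (simp add: fn_def)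
qed

text \<open>Evaluation at \<open>e a 0\<close> yields the first index, evaluation at
  \<open>e b i\<close> the second one together with its coefficient; positivity of \<open>c\<close>
  separates \<open>b\<close> from \<open>sw b\<close>. The right-hand side is not assumed to be
  indexed by \<open>Rl\<close>, as it will be a functional transported by an isometry.\<close>

lemma fn_determines:
  assumes r: "(a', b', i') \<in> Rl" and m: "a \<in> W" "b \<in> W" "i \<in> I"
    and ne: "i = 0 \<Longrightarrow> b \<noteq> a \<and> b \<noteq> sw a" and c: "0 < c"
    and eq: "\<And>x. x \<in> V \<Longrightarrow> fn (a', b', i') x = crd a 0 x + c * crd b i x"
  shows "a' = a \<and> b' = b \<and> i' = i \<and> cf a' b' i' = c"
proof -
  have m': "a' \<in> W" "b' \<in> W" "i' \<in> I" using RlD[OF r] by auto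
  have "fn (a', b', i') (e a 0) = 1"
    using eq[OF e_in[OF m(1) I0]] ne by (simp add: crd_e0[OF m(1)] m I0)
  then have a': "a' = a" by (rule fn_e0_eq_1[OF r m(1)])
  have sne: "i = 0 \<Longrightarrow> a \<noteq> sw b" using ne sw(2)[OF m(2)] by auto
  have "cf a' b' i' * crd b' i' (e b i) = c"
    using eq[OF e_in[OF m(2,3)]] ne sne a' m m' I0 by (auto simp: fn_def crd_e split: if_splits)
  then have "0 < cf a' b' i' * crd b' i' (e b i)" using c by simp
  then have "0 < crd b' i' (e b i)" using cf_bounds[of a' b' i'] by (simp add: zero_less_mult_iff)
  then have "b' = b \<and> i' = i"
    using crd_e[OF m(2,3) m'(2,3)] by (auto split: if_splits)
  then show ?thesis using a' \<open>cf a' b' i' * crd b' i' (e b i) = c\<close> crd_e[OF m(2,3) m'(2,3)] by simp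
qed

lemma fn_inj:
  assumes r: "r \<in> Rl" and r': "r' \<in> Rl" and eq: "\<And>x. x \<in> V \<Longrightarrow> fn r' x = fn r x"
  shows "r' = r"
proof -
  obtain a b i where abi: "r = (a, b, i)" by (cases r)
  obtain a' b' i' where abi': "r' = (a', b', i')" by (cases r')
  have m: "a \<in> W" "b \<in> W" "i \<in> I" using RlD r abi by auto
  have "a' = a \<and> b' = b \<and> i' = i \<and> cf a' b' i' = cf a b i"
  proof (rule fn_determines[OF _ m])
    show "(a', b', i') \<in> Rl" using r' abi' by simp
    show "i = 0 \<Longrightarrow> b \<noteq> a \<and> b \<noteq> sw a" using e_Rl[of a b i] r abi by blast
    show "0 < cf a b i" using cf_bounds(1)[of a b i] by linarith
    show "fn (a', b', i') x = crd a 0 x + cf a b i * crd b i x" if "x \<in> V" for x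
      using eq[OF that] by (simp add: abi abi' fn_def)
  qed
  then show ?thesis by (simp add: abi abi')
qed

text \<open>Distinct indices leave every finite set, in particular the set of those with a large
  second coordinate.\<close>

lemma fn_seq_diff:
  assumes inj: "inj rs" and rs: "range rs \<subseteq> Rl" and x: "x \<in> V"
  shows "(\<lambda>n. fn (rs n) x - crd (fst (rs n)) 0 x) \<longlonglongrightarrow> 0"
proof (rule LIMSEQ_I)
  fix \<epsilon> :: real assume \<epsilon>: "0 < \<epsilon>"
  let ?B = "{(a, b, i). (a, b, i) \<in> Rl \<and> \<epsilon> \<le> \<bar>crd b i x\<bar>}"
  have "finite (rs -` ?B)" using finite_Rl_large[OF x \<epsilon>] inj by (rule finite_vimageI)
  then obtain n0 where n0: "\<forall>n\<in>rs -` ?B. n < n0"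
    unfolding finite_nat_set_iff_bounded ..
  have "norm (fn (rs n) x - crd (fst (rs n)) 0 x - 0) < \<epsilon>" if "n0 \<le> n" for n
  proof -
    obtain a b i where abi: "rs n = (a, b, i)" by (cases "rs n")
    have r: "(a, b, i) \<in> Rl" using rs abi by (metis rangeI subsetD)
    have "rs n \<notin> ?B" using n0 that by (meson not_less vimageI2)
    then have "\<bar>crd b i x\<bar> < \<epsilon>" using abi r by simp
    moreover have "\<bar>cf a b i * crd b i x\<bar> \<le> 1 * \<bar>crd b i x\<bar>"
      unfolding abs_mult using cf_bounds[of a b i] by (intro mult_right_mono) auto
    ultimately show ?thesis by (simp add: abi fn_def)
  qed
  then show "\<exists>no. \<forall>n\<ge>no. norm (fn (rs n) x - crd (fst (rs n)) 0 x - 0) < \<epsilon>" by blast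
qed

text \<open>By \<open>fn_seq_diff\<close> only the first coordinates matter. If one first index
  occurs infinitely often, the limit is the coordinate there; otherwise the first indices leave
  every finite set and the limit is zero.\<close>

lemma fn_seq_limit:
  assumes inj: "inj rs" and rs: "range rs \<subseteq> Rl"
    and lim: "\<And>x. x \<in> V \<Longrightarrow> (\<lambda>n. fn (rs n) x) \<longlonglongrightarrow> \<phi> x"
  shows "(\<exists>a\<in>W. \<forall>x\<in>V. \<phi> x = crd a 0 x) \<or> (\<forall>x\<in>V. \<phi> x = 0)"
proof -
  define h where "h n = fst (rs n)" for n
  have hW: "h n \<in> W" for n
    using rs RlD by (cases "rs n") (metis fst_conv h_def rangeI subsetD)
  have lim': "(\<lambda>n. crd (h n) 0 x) \<longlonglongrightarrow> \<phi> x" if x: "x \<in> V" for x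
    using tendsto_diff[OF lim[OF x] fn_seq_diff[OF inj rs x]] by (simp add: h_def)
  show ?thesis
  proof (cases "\<exists>a. infinite {n. h n = a}")
    case True
    then obtain a where a: "infinite {n. h n = a}" by blast
    then have aW: "a \<in> W" using hW by (metis (mono_tags, lifting) Collect_empty_eq finite.emptyI)
    have "\<phi> x = crd a 0 x" if x: "x \<in> V" for x
    proof (rule ccontr)
      assume "\<phi> x \<noteq> crd a 0 x"
      then have "eventually (\<lambda>n. dist (crd (h n) 0 x) (\<phi> x) < dist (crd a 0 x) (\<phi> x)) sequentially"
        by (intro tendstoD[OF lim'[OF x]]) auto
      then obtain n0 where n0: "\<And>n. n0 \<le> n \<Longrightarrow> dist (crd (h n) 0 x) (\<phi> x) < dist (crd a 0 x) (\<phi> x)"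
        unfolding eventually_sequentially by blast
      obtain n where "n0 \<le> n" "h n = a" using a unfolding infinite_nat_iff_unbounded_le by blast
      then show False using n0[of n] by simp
    qed
    then show ?thesis using aW by blast
  next
    case False
    have "(\<lambda>n. crd (h n) 0 x) \<longlonglongrightarrow> 0" if x: "x \<in> V" for x
    proof (rule LIMSEQ_I)
      fix \<epsilon> :: real assume \<epsilon>: "0 < \<epsilon>"
      let ?B = "{a \<in> W. \<epsilon> \<le> \<bar>crd a 0 x\<bar>}"
      have "finite (\<Union>a\<in>?B. {n. h n = a})"
        using finite_crd0_large[OF x \<epsilon>] False by (intro finite_UN_I) auto
      then obtain n0 where n0: "\<forall>n\<in>(\<Union>a\<in>?B. {n. h n = a}). n < n0"
        unfolding finite_nat_set_iff_bounded ..
      have "norm (crd (h n) 0 x - 0) < \<epsilon>" if "n0 \<le> n" for n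
      proof -
        have "n \<notin> (\<Union>a\<in>?B. {n. h n = a})" using n0 that by (meson not_less)
        then show ?thesis using hW[of n] by simp
      qed
      then show "\<exists>no. \<forall>n\<ge>no. norm (crd (h n) 0 x - 0) < \<epsilon>" by blast
    qed
    then show ?thesis using lim' LIMSEQ_unique by blast
  qed
qed

text \<open>The coordinate at \<open>a\<close> is the limit of \<open>fn (a, b, 0)\<close> over
  distinct partners \<open>b\<close>. The isometry turns these into distinct functionals again, so
  its pullback is one of the possible limits.\<close>

lemma isom_crd0:
  assumes T: "T \<in> Isom V M" and a: "a \<in> W"
  shows "\<exists>a'\<in>W. \<forall>x\<in>V. crd a 0 (T x) = crd a' 0 x"
proof -
  have im: "T ` V = V" using T by (auto simp: Isom_def)
  obtain bs :: "nat \<Rightarrow> 'w" where bs: "inj bs" "range bs \<subseteq> {b \<in> W. P a b}"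
    using infinite_countable_subset[OF P_inf[OF a]] by blast
  define rs where "rs n = (a, bs n, 0::nat)" for n
  have rs: "rs n \<in> Rl" for n using bs a I0 by (auto simp: rs_def Rl_def)
  have "\<forall>n. \<exists>r'\<in>Rl. \<forall>x\<in>V. fn (rs n) (T x) = fn r' x" using isom_fn[OF T rs] by blast
  then obtain rs' where rs': "\<And>n. rs' n \<in> Rl" "\<And>n x. x \<in> V \<Longrightarrow> fn (rs n) (T x) = fn (rs' n) x" by metis
  have "inj rs'"
  proof (rule injI)
    fix n m assume eq: "rs' n = rs' m"
    have "rs n = rs m"
    proof (rule fn_inj[OF rs rs])
      fix y assume "y \<in> V"
      then obtain x where "x \<in> V" "y = T x" using im by (metis imageE)
      then show "fn (rs n) y = fn (rs m) y" using rs'(2) eq by simp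
    qed
    then show "n = m" using bs(1) by (simp add: rs_def inj_eq)
  qed
  have inj: "inj rs" using bs(1) by (auto simp: inj_def rs_def)
  have "(\<lambda>n. fn (rs' n) x) \<longlonglongrightarrow> crd a 0 (T x)" if x: "x \<in> V" for x
  proof -
    have "T x \<in> V" using im x by (metis imageI)
    then have "(\<lambda>n. fn (rs n) (T x) - crd (fst (rs n)) 0 (T x)) \<longlonglongrightarrow> 0"
      using rs by (intro fn_seq_diff[OF inj]) auto
    then have "(\<lambda>n. fn (rs n) (T x) - crd a 0 (T x)) \<longlonglongrightarrow> 0" by (simp add: rs_def)
    then show ?thesis using rs'(2)[OF x] by (simp add: LIM_zero_iff)
  qed
  then consider "\<exists>a'\<in>W. \<forall>x\<in>V. crd a 0 (T x) = crd a' 0 x" | "\<forall>x\<in>V. crd a 0 (T x) = 0"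
    using fn_seq_limit[OF \<open>inj rs'\<close>, of "\<lambda>x. crd a 0 (T x)"] rs'(1) by blast
  then show ?thesis
  proof cases
    \<comment> \<open>A zero limit is excluded by surjectivity: some \<open>x\<close> is mapped to
      \<open>e a 0\<close>.\<close>
    case 2
    obtain x where "x \<in> V" "T x = e a 0" using im e_in[OF a I0] by (metis imageE)
    then show ?thesis using 2 crd_e0[OF a a I0] by force
  qed
qed

lemma crd0_inj:
  assumes "a \<in> W" "b \<in> W" "\<And>x. x \<in> V \<Longrightarrow> crd a 0 x = crd b 0 x"
  shows "a = b"
  using assms(3)[OF e_in[OF assms(1) I0]] crd_e0[OF assms(1) _ I0] assms(1,2) by (auto split: if_splits)

text \<open>Coordinates at different points are different, so the maps on \<open>W\<close> induced
  by \<open>T\<close> and by its inverse are inverse to each other. This yields bijectivity as well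
  as the converse implication for \<open>P\<close>; the colour is recovered from the coefficient by
  injectivity of \<open>lam\<close>.\<close>

lemma isom_perm:
  assumes T: "T \<in> Isom V M"
  obtains \<alpha> where "bij_betw \<alpha> W W" "\<And>a x. a \<in> W \<Longrightarrow> x \<in> V \<Longrightarrow> crd a 0 (T x) = crd (\<alpha> a) 0 x"
    "\<And>a. a \<in> W \<Longrightarrow> \<alpha> (sw a) = sw (\<alpha> a)"
    "\<And>a b. a \<in> W \<Longrightarrow> b \<in> W \<Longrightarrow> P a b \<Longrightarrow> P (\<alpha> a) (\<alpha> b) \<and> kap (\<alpha> a) (\<alpha> b) = kap a b"
    "\<And>a b. a \<in> W \<Longrightarrow> b \<in> W \<Longrightarrow> P (\<alpha> a) (\<alpha> b) \<Longrightarrow> P a b"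
proof -
  have step: "\<exists>\<alpha>. (\<forall>a\<in>W. \<alpha> a \<in> W \<and> (\<forall>x\<in>V. crd a 0 (U x) = crd (\<alpha> a) 0 x)) \<and>
      (\<forall>a\<in>W. \<alpha> (sw a) = sw (\<alpha> a)) \<and>
      (\<forall>a\<in>W. \<forall>b\<in>W. P a b \<longrightarrow> P (\<alpha> a) (\<alpha> b) \<and> kap (\<alpha> a) (\<alpha> b) = kap a b)"
    if U: "U \<in> Isom V M" for U
  proof -
    obtain \<alpha> where \<alpha>: "\<And>a. a \<in> W \<Longrightarrow> \<alpha> a \<in> W" "\<And>a x. a \<in> W \<Longrightarrow> x \<in> V \<Longrightarrow> crd a 0 (U x) = crd (\<alpha> a) 0 x"
      using isom_crd0[OF U] by metis
    have Uin: "U x \<in> V" if "x \<in> V" for x using U that by (auto simp: Isom_def)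
    have im: "U ` V = V" using U by (auto simp: Isom_def)
    have \<alpha>inj: "a = b" if ab: "a \<in> W" "b \<in> W" "\<alpha> a = \<alpha> b" for a b
    proof (rule crd0_inj[OF ab(1,2)])
      fix y assume "y \<in> V"
      then obtain x where "x \<in> V" "y = U x" using im by (metis imageE)
      then show "crd a 0 y = crd b 0 y" using \<alpha>(2) ab by simp
    qed
    have \<alpha>sw: "\<alpha> (sw a) = sw (\<alpha> a)" if a: "a \<in> W" for a
    proof (rule crd0_inj)
      show "\<alpha> (sw a) \<in> W" "sw (\<alpha> a) \<in> W" using \<alpha>(1) sw a by auto
      show "crd (\<alpha> (sw a)) 0 x = crd (sw (\<alpha> a)) 0 x" if x: "x \<in> V" for x
        using \<alpha>(2)[OF sw(1)[OF a] x] crd_sw[OF a I0 Uin[OF x]] crd_sw[OF \<alpha>(1)[OF a] I0 x] \<alpha>(2)[OF a x] by simp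
    qed
    have "P (\<alpha> a) (\<alpha> b) \<and> kap (\<alpha> a) (\<alpha> b) = kap a b" if ab: "a \<in> W" "b \<in> W" "P a b" for a b
    proof -
      have r: "(a, b, 0) \<in> Rl" using ab I0 by (simp add: Rl_def)
      obtain a' b' i' where r': "(a', b', i') \<in> Rl" "\<And>x. x \<in> V \<Longrightarrow> fn (a, b, 0) (U x) = fn (a', b', i') x"
        using isom_fn[OF U r] by auto
      have ne: "b \<noteq> a" "b \<noteq> sw a" using e_Rl[OF r] by auto
      have "a' = \<alpha> a \<and> b' = \<alpha> b \<and> i' = 0 \<and> cf a' b' i' = cf a b 0"
      proof (rule fn_determines[OF r'(1) \<alpha>(1)[OF ab(1)] \<alpha>(1)[OF ab(2)] I0])
        show "\<alpha> b \<noteq> \<alpha> a \<and> \<alpha> b \<noteq> sw (\<alpha> a)"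
          using ne \<alpha>inj ab \<alpha>sw sw(1) by metis
        show "0 < cf a b 0" using cf_bounds(1)[of a b 0] by linarith
        show "fn (a', b', i') x = crd (\<alpha> a) 0 x + cf a b 0 * crd (\<alpha> b) 0 x" if x: "x \<in> V" for x
          using r'(2)[OF x] \<alpha>(2)[OF _ x] ab by (simp add: fn_def)
      qed
      then show ?thesis using r'(1) by (auto simp: Rl_def cf_def lam_inj split: if_splits)
    qed
    then show ?thesis using \<alpha> \<alpha>sw by blast
  qed
  obtain T' where T': "T' \<in> Isom V M" "\<And>x. x \<in> V \<Longrightarrow> T' (T x) = x" "\<And>x. x \<in> V \<Longrightarrow> T (T' x) = x"
    using Isom_inverse[OF V M_norm T] by blast
  obtain \<alpha> where \<alpha>: "\<And>a. a \<in> W \<Longrightarrow> \<alpha> a \<in> W" "\<And>a x. a \<in> W \<Longrightarrow> x \<in> V \<Longrightarrow> crd a 0 (T x) = crd (\<alpha> a) 0 x"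
    "\<And>a. a \<in> W \<Longrightarrow> \<alpha> (sw a) = sw (\<alpha> a)"
    "\<And>a b. a \<in> W \<Longrightarrow> b \<in> W \<Longrightarrow> P a b \<Longrightarrow> P (\<alpha> a) (\<alpha> b) \<and> kap (\<alpha> a) (\<alpha> b) = kap a b"
    using step[OF T] by blast
  obtain \<beta> where \<beta>: "\<And>a. a \<in> W \<Longrightarrow> \<beta> a \<in> W" "\<And>a x. a \<in> W \<Longrightarrow> x \<in> V \<Longrightarrow> crd a 0 (T' x) = crd (\<beta> a) 0 x"
    "\<And>a b. a \<in> W \<Longrightarrow> b \<in> W \<Longrightarrow> P a b \<Longrightarrow> P (\<beta> a) (\<beta> b)"
    using step[OF T'(1)] by blast
  have in': "T x \<in> V" "T' x \<in> V" if "x \<in> V" for x using T T' that by (auto simp: Isom_def)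
  have ba: "\<beta> (\<alpha> a) = a" if a: "a \<in> W" for a
    by (rule crd0_inj[OF \<beta>(1)[OF \<alpha>(1)[OF a]] a]) (use a \<alpha> \<beta> T' in' in metis)
  have ab: "\<alpha> (\<beta> a) = a" if a: "a \<in> W" for a
    by (rule crd0_inj[OF \<alpha>(1)[OF \<beta>(1)[OF a]] a]) (use a \<alpha> \<beta> T' in' in metis)
  have "bij_betw \<alpha> W W"
    by (rule bij_betwI[of _ _ _ \<beta>]) (use \<alpha>(1) \<beta>(1) ab ba in auto)
  moreover have "P a b" if "a \<in> W" "b \<in> W" "P (\<alpha> a) (\<alpha> b)" for a b
    using \<beta>(3)[OF \<alpha>(1) \<alpha>(1)] that ba by metis
  ultimately show ?thesis using that \<alpha> by blast
qed

text \<open>Level 0 is \<open>isom_perm\<close>. On a level \<open>i > 0\<close>, let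
  \<open>v\<close> be the coordinate at \<open>b\<close> composed with \<open>T\<close>. The
  functionals for \<open>(b, b, i)\<close> and \<open>(b, sw b, i)\<close> go to functionals whose
  first index is \<open>\<alpha> b\<close>; subtracting the coordinate there, v/2 and -lam i * v are
  multiples of coordinates in the summand of \<open>\<alpha> b\<close>. Comparing the coefficients
  leaves only the coordinate of the same level and sign.\<close>

theorem isom_structure:
  assumes T: "T \<in> Isom V M"
  obtains \<alpha> where "bij_betw \<alpha> W W"
    "\<And>a i x. a \<in> W \<Longrightarrow> i \<in> I \<Longrightarrow> x \<in> V \<Longrightarrow> crd a i (T x) = crd (\<alpha> a) i x"
    "\<And>a b. a \<in> W \<Longrightarrow> b \<in> W \<Longrightarrow> P a b \<Longrightarrow> P (\<alpha> a) (\<alpha> b) \<and> kap (\<alpha> a) (\<alpha> b) = kap a b"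
proof -
  obtain \<alpha> where bij: "bij_betw \<alpha> W W" and \<alpha>: "\<And>a x. a \<in> W \<Longrightarrow> x \<in> V \<Longrightarrow> crd a 0 (T x) = crd (\<alpha> a) 0 x"
    and \<alpha>sw: "\<And>a. a \<in> W \<Longrightarrow> \<alpha> (sw a) = sw (\<alpha> a)"
    and P: "\<And>a b. a \<in> W \<Longrightarrow> b \<in> W \<Longrightarrow> P a b \<Longrightarrow> P (\<alpha> a) (\<alpha> b) \<and> kap (\<alpha> a) (\<alpha> b) = kap a b"
    and P': "\<And>a b. a \<in> W \<Longrightarrow> b \<in> W \<Longrightarrow> P (\<alpha> a) (\<alpha> b) \<Longrightarrow> P a b"
    using isom_perm[OF T] by blast
  have im: "T ` V = V" using T by (auto simp: Isom_def)
  have \<alpha>W: "\<alpha> a \<in> W" if "a \<in> W" for a using bij that by (auto simp: bij_betw_def)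
  \<comment> \<open>The functionals of level 0 are already images of functionals of level 0, so by
    injectivity no other level is mapped there.\<close>
  have level: "i' \<noteq> 0" if r: "(a, b, i) \<in> Rl" "i \<noteq> 0" and r': "(a', b', i') \<in> Rl"
    and eq: "\<And>x. x \<in> V \<Longrightarrow> fn (a, b, i) (T x) = fn (a', b', i') x" for a b i a' b' i'
  proof
    assume 0: "i' = 0"
    have m': "a' \<in> W" "b' \<in> W" "P a' b'" using r' 0 by (auto simp: Rl_def)
    obtain a1 b1 where 1: "a1 \<in> W" "b1 \<in> W" "a' = \<alpha> a1" "b' = \<alpha> b1"
      using bij m' by (metis bij_betw_def imageE)
    have P1: "P a1 b1" using P' 1 m' by blast
    have r1: "(a1, b1, 0) \<in> Rl" using 1 P1 I0 by (simp add: Rl_def)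
    have "(a, b, i) = (a1, b1, 0)"
    proof (rule fn_inj[OF r1 r(1)])
      fix y assume "y \<in> V"
      then obtain x where x: "x \<in> V" "y = T x" using im by (metis imageE)
      have "kap a' b' = kap a1 b1" using P[OF 1(1,2) P1] 1 by simp
      then show "fn (a, b, i) y = fn (a1, b1, 0) y"
        using eq[OF x(1)] \<alpha>[OF _ x(1)] 1 0 x by (simp add: fn_def cf_def)
    qed
    then show False using r(2) by simp
  qed
  have "crd b i (T x) = crd (\<alpha> b) i x" if b: "b \<in> W" and i: "i \<in> I" and x: "x \<in> V" for b i x
  proof (cases "i = 0")
    case True
    then show ?thesis using \<alpha> b x by simp
  next
    case False
    have rp: "(b, b, i) \<in> Rl" and rm: "(b, sw b, i) \<in> Rl" using b i False sw by (auto simp: Rl_def)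
    obtain a1 b1 i1 where 1: "(a1, b1, i1) \<in> Rl" "\<And>x. x \<in> V \<Longrightarrow> fn (b, b, i) (T x) = fn (a1, b1, i1) x"
      using isom_fn[OF T rp] by auto
    obtain a2 b2 i2 where 2: "(a2, b2, i2) \<in> Rl" "\<And>x. x \<in> V \<Longrightarrow> fn (b, sw b, i) (T x) = fn (a2, b2, i2) x"
      using isom_fn[OF T rm] by auto
    have i12: "i1 \<noteq> 0" "i2 \<noteq> 0" using level[OF rp False 1] level[OF rm False 2] by auto
    define v where "v x = crd b i (T x)" for x
    have Tin: "T x \<in> V" if "x \<in> V" for x using im that by (metis imageI)
    have cfv: "cf b b i = 1 / 2" "cf b (sw b) i = lam i" using False sw(3)[OF b] by (auto simp: cf_def)
    have e1: "crd (\<alpha> b) 0 x + 1 / 2 * v x = crd a1 0 x + cf a1 b1 i1 * crd b1 i1 x" if "x \<in> V" for x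
      using 1(2)[OF that] \<alpha>[OF b that] cfv by (simp add: fn_def v_def)
    have e2: "crd (\<alpha> b) 0 x - lam i * v x = crd a2 0 x + cf a2 b2 i2 * crd b2 i2 x" if "x \<in> V" for x
      using 2(2)[OF that] \<alpha>[OF b that] cfv crd_sw[OF b i Tin[OF that]] by (simp add: fn_def v_def)
    have m: "a1 \<in> W" "b1 \<in> W" "i1 \<in> I" "a2 \<in> W" "b2 \<in> W" "i2 \<in> I" using RlD[OF 1(1)] RlD[OF 2(1)] by auto
    let ?E = "e (\<alpha> b) 0"
    have E: "?E \<in> V" using e_in \<alpha>W b I0 by blast
    have cE: "crd (\<alpha> b) 0 ?E = 1" "crd a1 0 ?E \<le> 1" "crd a2 0 ?E \<le> 1" "crd b1 i1 ?E = 0" "crd b2 i2 ?E = 0"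
      using i12 m I0 \<alpha>W[OF b] by (auto simp: crd_e0[OF \<alpha>W[OF b]])
    \<comment> \<open>Both images take a value of at most 1 at \<open>?E\<close>; since
      \<open>v\<close> enters them with opposite signs, it vanishes there.\<close>
    have "v ?E \<le> 0" using e1[OF E] cE by simp
    moreover have "0 \<le> lam i * v ?E" using e2[OF E] cE by simp
    then have "0 \<le> v ?E" using lam_gt[of i] by (simp add: zero_le_mult_iff)
    ultimately have vE: "v ?E = 0" by simp
    have a1: "a1 = \<alpha> b" and a2: "a2 = \<alpha> b"
      using fn_e0_eq_1[OF 1(1) \<alpha>W[OF b]] fn_e0_eq_1[OF 2(1) \<alpha>W[OF b]] e1[OF E] e2[OF E] vE cE
      by (simp_all add: fn_def)
    have f1: "1 / 2 * v x = cf a1 b1 i1 * crd b1 i1 x" and f2: "- lam i * v x = cf a2 b2 i2 * crd b2 i2 x"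
      if "x \<in> V" for x
      using e1[OF that] e2[OF that] a1 a2 by auto
    have b12: "b1 = \<alpha> b \<or> b1 = sw (\<alpha> b)" "b2 = \<alpha> b \<or> b2 = sw (\<alpha> b)"
      using 1(1) 2(1) i12 a1 a2 by (auto simp: Rl_def)
    let ?F = "e (\<alpha> b) i1"
    have F: "?F \<in> V" using e_in \<alpha>W b m by blast
    note sab = sw(3)[OF \<alpha>W[OF b]] sw(2)[OF \<alpha>W[OF b]]
    have c1: "crd b1 i1 ?F = (if b1 = \<alpha> b then 1 else - 1)"
      using b12 m \<alpha>W[OF b] sab by (auto simp: crd_e)
    have c2: "crd b2 i2 ?F = (if i2 = i1 then if b2 = \<alpha> b then 1 else - 1 else 0)"
      using b12 m \<alpha>W[OF b] sab by (auto simp: crd_e)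
    have v1: "v ?F = 2 * cf a1 b1 i1 * (if b1 = \<alpha> b then 1 else - 1)" using f1[OF F] c1 by simp
    have v2: "- lam i * v ?F = cf a2 b2 i2 * crd b2 i2 ?F" by (rule f2[OF F])
    have pos: "0 < lam i" "0 < cf a1 b1 i1" "0 < cf a2 b2 i2"
      using lam_gt[of i] cf_bounds(1)[of a1 b1 i1] cf_bounds(1)[of a2 b2 i2] by linarith+
    have "b1 = \<alpha> b \<and> i = i1"
    proof (cases "b1 = \<alpha> b")
      case True
      then have c: "cf a1 b1 i1 = 1 / 2" using i12 a1 by (simp add: cf_def)
      have "lam i = - (cf a2 b2 i2 * crd b2 i2 ?F)" using v1 v2 unfolding c by (simp add: True)
      then have "b2 \<noteq> \<alpha> b \<and> i2 = i1 \<and> lam i = cf a2 b2 i2" using pos c2 by (auto split: if_splits)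
      then have "lam i = lam i1" using a2 i12 by (simp add: cf_def)
      then show ?thesis using True lam_inj by simp
    next
      \<comment> \<open>The wrong sign would force 2 * lam i * lam i1 = 1/2, but on positive levels
        this product is at most 9/32.\<close>
      case ne: False
      then have c: "cf a1 b1 i1 = lam i1" using i12 a1 by (simp add: cf_def)
      have "lam i * (2 * lam i1) = cf a2 b2 i2 * crd b2 i2 ?F" using v1 v2 unfolding c by (simp add: ne)
      moreover have "0 < lam i * (2 * lam i1)" using pos c by simp
      ultimately have "b2 = \<alpha> b \<and> lam i * (2 * lam i1) = cf a2 b2 i2" using pos c2 by (auto split: if_splits)
      then have "lam i * (2 * lam i1) = 1 / 2" using a2 i12 by (simp add: cf_def)
      moreover have "lam i * (2 * lam i1) \<le> 3 / 8 * (2 * (3 / 8))"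
        using lam_le'[of i] lam_le'[of i1] False i12 pos c by (intro mult_mono) auto
      ultimately show ?thesis by simp
    qed
    then show ?thesis using f1[OF x] a1 i12 by (simp add: cf_def v_def)
  qed
  then show ?thesis using that bij P by blast
qed

text \<open>\<open>S\<close> and \<open>q\<close> are built from the coordinates alone, and \<beta>
  merely permutes the index sets of both suprema.\<close>

lemma M_invariant:
  assumes U: "\<And>x. x \<in> V \<Longrightarrow> U x \<in> V" "\<And>x. x \<in> V \<Longrightarrow> N (U x) = N x" and bij: "bij_betw \<beta> W W"
    and \<beta>: "\<And>a. a \<in> W \<Longrightarrow> \<beta> (sw a) = sw (\<beta> a)" "\<And>a. a \<in> W \<Longrightarrow> \<beta> (nx a) = nx (\<beta> a)"
      "\<And>a b. a \<in> W \<Longrightarrow> b \<in> W \<Longrightarrow> P (\<beta> a) (\<beta> b) \<longleftrightarrow> P a b"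
      "\<And>a b. a \<in> W \<Longrightarrow> b \<in> W \<Longrightarrow> kap (\<beta> a) (\<beta> b) = kap a b"
    and crd: "\<And>a i x. a \<in> W \<Longrightarrow> i \<in> I \<Longrightarrow> x \<in> V \<Longrightarrow> crd a i (U x) = crd (\<beta> a) i x"
    and x: "x \<in> V"
  shows "M (U x) = M x"
proof -
  have \<beta>W: "\<beta> a \<in> W" if "a \<in> W" for a using bij that by (auto simp: bij_betw_def)
  have \<beta>inj: "\<beta> a = \<beta> b \<longleftrightarrow> a = b" if "a \<in> W" "b \<in> W" for a b
    using bij that by (auto simp: bij_betw_def inj_on_def)
  have "g b (U x) = g (\<beta> b) x" if "b \<in> W" for b
    using that nx(1)[OF that] x I0 by (simp add: g_def crd \<beta>(2))
  then have "q (U x) = (SUP b\<in>W. g (\<beta> b) x)" unfolding q_def by (intro SUP_cong) auto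
  also have "\<dots> = (SUP b\<in>\<beta> ` W. g b x)" by (simp add: image_image)
  finally have q: "q (U x) = q x" using bij by (simp add: q_def bij_betw_def)
  define \<beta>R where "\<beta>R = (\<lambda>(a, b, i::nat). (\<beta> a, \<beta> b, i))"
  have cfb: "cf (\<beta> a) (\<beta> b) i = cf a b i" if "a \<in> W" "b \<in> W" for a b i
    using that \<beta>(4) \<beta>inj by (simp add: cf_def)
  have fnb: "fn r (U x) = fn (\<beta>R r) x" if "r \<in> Rl" for r
    using RlD[of "fst r" "fst (snd r)" "snd (snd r)"] that x I0 by (cases r) (simp add: fn_def \<beta>R_def crd cfb)
  have "\<beta>R ` Rl = Rl"
  proof
    show "\<beta>R ` Rl \<subseteq> Rl" using \<beta>(1,3) \<beta>W sw(1) by (auto simp: \<beta>R_def Rl_def split: if_splits)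
    show "Rl \<subseteq> \<beta>R ` Rl"
    proof
      fix r assume r: "r \<in> Rl"
      obtain a b i where abi: "r = (a, b, i)" by (cases r)
      have m: "a \<in> W" "b \<in> W" "i \<in> I" using RlD r abi by auto
      obtain a1 b1 where 1: "a1 \<in> W" "b1 \<in> W" "a = \<beta> a1" "b = \<beta> b1"
        using bij m by (metis bij_betw_def imageE)
      have "(a1, b1, i) \<in> Rl"
        using r 1(1,2) m \<beta>(3)[OF 1(1,2)] \<beta>inj[OF 1(2,1)] \<beta>inj[OF 1(2) sw(1)[OF 1(1)]] \<beta>(1)[OF 1(1)]
        unfolding abi Rl_def 1(3,4) by (simp split: if_splits)
      then show "r \<in> \<beta>R ` Rl" using abi 1 by (force simp: \<beta>R_def)
    qed
  qed
  moreover have "S (U x) = (SUP r\<in>Rl. \<bar>fn (\<beta>R r) x\<bar>)" unfolding S_def using fnb by (intro SUP_cong) auto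
  moreover have "(SUP r\<in>Rl. \<bar>fn (\<beta>R r) x\<bar>) = (SUP r\<in>\<beta>R ` Rl. \<bar>fn r x\<bar>)" by (simp add: image_image)
  ultimately have "S (U x) = S x" by (simp add: S_def)
  then show ?thesis using q U(2)[OF x] by (simp add: M_def)
qed

end

section \<open>Closed groups with a central involution\<close>

lemma carrier_Sinf: "carrier Sinf = {f. bij f}"
  by (auto simp: BijGroup_def Bij_def extensional_def)

lemma mult_Sinf: "f \<in> carrier Sinf \<Longrightarrow> h \<in> carrier Sinf \<Longrightarrow> f \<otimes>\<^bsub>Sinf\<^esub> h = f \<circ> h"
  by (auto simp: BijGroup_def compose_def fun_eq_iff)

lemma one_Sinf: "\<one>\<^bsub>Sinf\<^esub> = id"
  by (auto simp: BijGroup_def fun_eq_iff)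

abbreviation iv :: "(nat \<Rightarrow> nat) \<Rightarrow> nat \<Rightarrow> nat" where
  "iv \<equiv> inv_into UNIV"

lemma inv_Sinf: "f \<in> carrier Sinf \<Longrightarrow> m_inv Sinf f = iv f"
  using inv_BijGroup[of f UNIV] by (auto simp: BijGroup_def fun_eq_iff)

lemma topspace_Sinf: "topspace Sinf_topology = carrier Sinf"
proof -
  have "carrier Sinf \<in> {U. \<exists>f\<in>carrier Sinf. \<exists>A. finite A \<and> U = {g \<in> carrier Sinf. \<forall>x\<in>A. g x = f x}}"
    by (intro CollectI bexI[of _ id] exI[of _ "{}"]) (auto simp: carrier_Sinf)
  then show ?thesis
    unfolding Sinf_topology_def topology_generated_by_topspace by blast
qed

lemma openin_Sinf_basic:
  "f \<in> carrier Sinf \<Longrightarrow> finite A \<Longrightarrow> openin Sinf_topology {g \<in> carrier Sinf. \<forall>x\<in>A. g x = f x}"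
  unfolding Sinf_topology_def by (rule topology_generated_by_Basis) auto

lemma openin_Sinf_nbhd:
  assumes "openin Sinf_topology U" "f \<in> U"
  shows "\<exists>A. finite A \<and> {g \<in> carrier Sinf. \<forall>x\<in>A. g x = f x} \<subseteq> U"
proof -
  have "generate_topology_on {U. \<exists>f\<in>carrier Sinf. \<exists>A. finite A \<and> U = {g \<in> carrier Sinf. \<forall>x\<in>A. g x = f x}} U"
    using assms(1) unfolding Sinf_topology_def openin_topology_generated_by_iff .
  then show ?thesis using assms(2)
  proof induct
    case (Int a b)
    then obtain A B where "finite A" "{g \<in> carrier Sinf. \<forall>x\<in>A. g x = f x} \<subseteq> a"
      "finite B" "{g \<in> carrier Sinf. \<forall>x\<in>B. g x = f x} \<subseteq> b" by auto
    then show ?case by (intro exI[of _ "A \<union> B"]) auto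
  next
    case (UN K)
    then obtain k where "k \<in> K" "f \<in> k" by blast
    then show ?case using UN(2)[of k] by blast
  next
    case (Basis s)
    \<comment> \<open>The basic set is re-centred: as it contains \<open>f\<close>, prescribing
      \<open>f'\<close> on \<open>A\<close> is prescribing \<open>f\<close> on
      \<open>A\<close>.\<close>
    then obtain f' A where "finite A" "s = {g \<in> carrier Sinf. \<forall>x\<in>A. g x = f' x}" by blast
    then show ?case using Basis(2) by (intro exI[of _ A]) auto
  qed simp
qed

section \<open>The action on lists that contain a moved point\<close>

locale involution_group =
  fixes H :: "(nat \<Rightarrow> nat) set" and s :: "nat \<Rightarrow> nat"
  assumes subgroup: "subgroup H Sinf" and closed: "closedin Sinf_topology H"
    and s_in: "s \<in> H" and s_ne: "s \<noteq> id" and s_comm: "\<And>g. g \<in> H \<Longrightarrow> s \<circ> g = g \<circ> s" and s_s: "s \<circ> s = id"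
begin

lemma H_carrier: "g \<in> H \<Longrightarrow> g \<in> carrier Sinf"
  using subgroup by (rule subgroup.mem_carrier)

lemma H_bij: "g \<in> H \<Longrightarrow> bij g"
  using H_carrier by (simp add: carrier_Sinf)

lemma H_inj: "g \<in> H \<Longrightarrow> g x = g y \<longleftrightarrow> x = y"
  using H_bij by (auto simp: bij_def inj_def)

lemma H_id: "id \<in> H"
  using subgroup.one_closed[OF subgroup] by (simp add: one_Sinf)

lemma H_comp: "g \<in> H \<Longrightarrow> h \<in> H \<Longrightarrow> g \<circ> h \<in> H"
  using subgroup.m_closed[OF subgroup] mult_Sinf H_carrier by metis

lemma H_inv: "g \<in> H \<Longrightarrow> iv g \<in> H"
  using subgroup.m_inv_closed[OF subgroup] inv_Sinf H_carrier by metis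

lemma inv_H[simp]: "g \<in> H \<Longrightarrow> iv g (g x) = x" "g \<in> H \<Longrightarrow> g (iv g x) = x"
  using H_bij by (auto simp: bij_is_inj bij_is_surj surj_f_inv_f)

lemma inv_comp_H: "g \<in> H \<Longrightarrow> iv g \<circ> g = id" "g \<in> H \<Longrightarrow> g \<circ> iv g = id"
  by (auto simp: fun_eq_iff)

lemma s_comm': "g \<in> H \<Longrightarrow> s (g x) = g (s x)"
  using s_comm by (metis comp_apply)

lemma s_s'[simp]: "s (s x) = x"
  using s_s by (metis comp_apply id_apply)

text \<open>Working with lists instead of points makes the involution act freely and lets binary relations see
  the orbits of all finite tuples.\<close>

definition W :: "nat list set" where
  "W = {l. \<exists>m\<in>set l. s m \<noteq> m}"

text \<open>Inclusion together with the length bound leaves finitely many \<open>a\<close> for each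
  \<open>b\<close>, while padding gives infinitely many \<open>b\<close> for each \<open>a\<close>.
  The strict inequality of lengths excludes \<open>b = a\<close> and
  \<open>b = map s a\<close>.\<close>

definition P :: "nat list \<Rightarrow> nat list \<Rightarrow> bool" where
  "P a b \<longleftrightarrow> set a \<subseteq> set b \<and> length a < length b"

text \<open>A numbering of the orbits of pairs: the least code of an element of the orbit.\<close>

definition kap :: "nat list \<Rightarrow> nat list \<Rightarrow> nat" where
  "kap a b = (LEAST n. \<exists>g\<in>H. n = to_nat (map g a, map g b))"

text \<open>Repeating the head commutes with every \<open>map g\<close> on nonempty lists and is
  injective; the greater length keeps the result apart from \<open>a\<close> and
  \<open>map s a\<close>.\<close>

definition nx :: "nat list \<Rightarrow> nat list" where
  "nx a = hd a # a"

definition m0 :: nat where "m0 = (SOME m. s m \<noteq> m)"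

lemma m0: "s m0 \<noteq> m0"
proof -
  have "\<exists>m. s m \<noteq> m" using s_ne by (auto simp: fun_eq_iff)
  then show ?thesis unfolding m0_def by (rule someI_ex)
qed

lemma in_W: "m0 \<in> set l \<Longrightarrow> l \<in> W"
  using m0 by (auto simp: W_def)

lemma W_map: "g \<in> H \<Longrightarrow> a \<in> W \<Longrightarrow> map g a \<in> W"
  using H_inj by (auto simp: W_def s_comm')

lemma sw_W: "a \<in> W \<Longrightarrow> map s a \<in> W" "map s (map s a) = a" "a \<in> W \<Longrightarrow> map s a \<noteq> a"
  using W_map[OF s_in] by (auto simp: W_def map_idI o_def) (metis map_eq_conv map_ident)

lemma P_irr: "P a b \<Longrightarrow> a \<noteq> b \<and> a \<noteq> map s b"
  by (auto simp: P_def)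

lemma P_fin: "finite {a \<in> W. P a b}"
proof -
  have "{a \<in> W. P a b} \<subseteq> {a. set a \<subseteq> set b \<and> length a \<le> length b}" by (auto simp: P_def)
  then show ?thesis using finite_lists_length_le[of "set b" "length b"] finite_subset by blast
qed

lemma P_inf: assumes "a \<in> W" shows "infinite {b \<in> W. P a b}"
proof -
  let ?f = "\<lambda>n. replicate (Suc n) (hd a) @ a"
  have "inj ?f" by (rule injI) (metis Suc_inject append_same_eq length_replicate)
  then have "infinite (range ?f)" by (rule range_inj_infinite)
  moreover have "range ?f \<subseteq> {b \<in> W. P a b}" using assms by (auto simp: P_def W_def)
  ultimately show ?thesis using finite_subset by blast
qed

lemma P_map: "g \<in> H \<Longrightarrow> P (map g a) (map g b) \<longleftrightarrow> P a b"
  using H_bij[of g] by (auto simp: P_def inj_image_subset_iff bij_is_inj)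

lemma kap_map:
  assumes "g \<in> H" shows "kap (map g a) (map g b) = kap a b"
proof -
  have "(\<exists>h\<in>H. n = to_nat (map h (map g a), map h (map g b))) \<longleftrightarrow> (\<exists>h\<in>H. n = to_nat (map h a, map h b))" for n
  proof
    assume "\<exists>h\<in>H. n = to_nat (map h (map g a), map h (map g b))"
    then obtain h where h: "h \<in> H" "n = to_nat (map h (map g a), map h (map g b))" by blast
    then have "n = to_nat (map (h \<circ> g) a, map (h \<circ> g) b)" by simp
    then show "\<exists>h\<in>H. n = to_nat (map h a, map h b)" using H_comp[OF h(1) assms] by blast
  next
    assume "\<exists>h\<in>H. n = to_nat (map h a, map h b)"
    then obtain h where h: "h \<in> H" "n = to_nat (map h a, map h b)" by blast
    have "map (h \<circ> iv g) (map g c) = map h c" for c using assms by (simp add: o_def)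
    then have "n = to_nat (map (h \<circ> iv g) (map g a), map (h \<circ> iv g) (map g b))" using h by simp
    then show "\<exists>h\<in>H. n = to_nat (map h (map g a), map h (map g b))"
      using H_comp[OF h(1) H_inv[OF assms]] by blast
  qed
  then show ?thesis by (simp only: kap_def)
qed

lemma kap_attained: "\<exists>g\<in>H. kap a b = to_nat (map g a, map g b)"
  unfolding kap_def by (rule LeastI_ex) (use H_id in blast)

lemma kap_eq_imp:
  assumes "kap a' b' = kap a b"
  shows "\<exists>g\<in>H. a' = map g a \<and> b' = map g b"
proof -
  obtain g where g: "g \<in> H" "kap a b = to_nat (map g a, map g b)" using kap_attained by blast
  obtain h where h: "h \<in> H" "kap a' b' = to_nat (map h a', map h b')" using kap_attained by blast
  have eq: "map h a' = map g a" "map h b' = map g b" using g h assms by auto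
  have "map (iv h) (map h c) = c" for c using h by (simp add: o_def)
  then have "a' = map (iv h \<circ> g) a" "b' = map (iv h \<circ> g) b" using eq by (metis map_map)+
  then show ?thesis using H_comp H_inv g h by blast
qed

lemma nx: "a \<in> W \<Longrightarrow> nx a \<in> W" "nx a \<noteq> a" "nx a \<noteq> map s a" "inj_on nx W"
proof -
  show "nx a \<noteq> map s a" using arg_cong[of "nx a" "map s a" length] by (auto simp: nx_def)
qed (auto simp: nx_def W_def inj_on_def)

lemma nx_map: "a \<in> W \<Longrightarrow> nx (map g a) = map g (nx a)"
  by (cases a) (auto simp: nx_def W_def)

text \<open>The colour of the pair formed by \<open>q\<close> and a long list \<open>t n\<close>
  provides an element of \<open>H\<close> that induces \<alpha> on both. These elements stabilise
  pointwise to a map \<beta>; it induces \<alpha> on \<open>W\<close>, and it belongs to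
  \<open>H\<close> because \<open>H\<close> is closed.\<close>

lemma rigid:
  assumes bij: "bij_betw \<alpha> W W"
    and \<alpha>: "\<And>a b. a \<in> W \<Longrightarrow> b \<in> W \<Longrightarrow> P a b \<Longrightarrow> kap (\<alpha> a) (\<alpha> b) = kap a b"
  shows "\<exists>g\<in>H. \<forall>a\<in>W. \<alpha> a = map g a"
proof -
  \<comment> \<open>The entry \<open>m0\<close> puts the list into \<open>W\<close>; its length n +
    1 exceeds that of every \<open>q\<close> with \<open>length q \<le> n\<close>.\<close>
  define t where "t n = m0 # [0..<n]" for n
  define \<beta> where "\<beta> m = \<alpha> [m0, m] ! 1" for m
  have tW: "t n \<in> W" for n by (rule in_W) (simp add: t_def)
  have orb: "\<exists>g\<in>H. \<alpha> q = map g q \<and> \<alpha> (t n) = map g (t n)"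
    if q: "q \<in> W" "set q \<subseteq> set (t n)" "length q \<le> n" for q n
  proof -
    have "P q (t n)" using q by (simp add: P_def t_def)
    then show ?thesis using kap_eq_imp[OF \<alpha>[OF q(1) tW]] by blast
  qed
  \<comment> \<open>The right-hand side does not depend on \<open>n\<close>, so the group elements
    for different \<open>n\<close> agree on their common range. The bound \<open>2 \<le> n\<close>
    is the length of \<open>[m0, m]\<close>.\<close>
  have A: "g m = \<beta> m" if n: "2 \<le> n" "m0 < n" and g: "g \<in> H" "\<alpha> (t n) = map g (t n)" and m: "m < n" for g n m
  proof -
    obtain g1 where g1: "\<alpha> [m0, m] = map g1 [m0, m]" "\<alpha> (t n) = map g1 (t n)"
      using orb[of "[m0, m]" n] n m by (auto simp: in_W t_def)
    have "map g (t n) = map g1 (t n)" using g g1 by simp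
    then have "g m = g1 m" using m by (simp add: t_def)
    then show ?thesis using g1(1) by (simp add: \<beta>_def)
  qed
  have B: "\<exists>g\<in>H. (\<forall>m<n. g m = \<beta> m) \<and> \<alpha> q = map g q \<and> \<alpha> q = map \<beta> q" if q: "q \<in> W" for q n
  proof -
    define k where "k = Suc (Max (set (n # m0 # length q # 2 # q)))"
    have k: "x < k" if "x \<in> set (n # m0 # length q # 2 # q)" for x
      using that unfolding k_def less_Suc_eq_le by (intro Max_ge) auto
    have qk: "set q \<subseteq> set (t k)" "length q \<le> k" "n \<le> k" "2 \<le> k" "m0 < k"
      using k by (auto simp: t_def less_imp_le)
    obtain g where g: "g \<in> H" "\<alpha> q = map g q" "\<alpha> (t k) = map g (t k)"
      using orb[OF q qk(1,2)] by blast
    have gb: "g m = \<beta> m" if "m < k" for m using A[OF qk(4,5) g(1,3) that] .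
    have "map g q = map \<beta> q" using gb k by simp
    then show ?thesis using g gb qk(3) by (intro bexI[of _ g]) auto
  qed
  have m0W: "[m0] \<in> W" by (simp add: in_W)
  have "inj \<beta>"
  proof (rule injI)
    fix x y assume xy: "\<beta> x = \<beta> y"
    obtain g where "g \<in> H" "\<forall>m<Suc (max x y). g m = \<beta> m" using B[OF m0W] by blast
    then have "g x = g y" using xy by simp
    then show "x = y" using \<open>g \<in> H\<close> H_inj by blast
  qed
  \<comment> \<open>A pointwise limit of permutations is injective but may fail to be onto.
    Surjectivity of \<alpha> is what helps: some list is mapped to \<open>[m0, m]\<close>.\<close>
  moreover have "surj \<beta>"
  proof -
    have "m \<in> range \<beta>" for m
    proof -
      have "[m0, m] \<in> W" by (simp add: in_W)
      then obtain q where q: "q \<in> W" "\<alpha> q = [m0, m]" using bij by (metis bij_betw_def imageE)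
      then have "map \<beta> q = [m0, m]" using B[OF q(1)] by metis
      then have "m \<in> set (map \<beta> q)" by simp
      then show ?thesis by auto
    qed
    then show ?thesis by blast
  qed
  ultimately have \<beta>: "\<beta> \<in> carrier Sinf" by (simp add: carrier_Sinf bij_def)
  have "\<beta> \<in> H"
  proof (rule ccontr)
    assume "\<beta> \<notin> H"
    moreover have "openin Sinf_topology (topspace Sinf_topology - H)" using closed by (simp add: closedin_def)
    ultimately obtain A where A: "finite A" "{g \<in> carrier Sinf. \<forall>x\<in>A. g x = \<beta> x} \<subseteq> topspace Sinf_topology - H"
      using openin_Sinf_nbhd[of "topspace Sinf_topology - H" \<beta>] \<beta> topspace_Sinf by auto
    obtain n where n: "\<forall>x\<in>A. x < n" using A(1) unfolding finite_nat_set_iff_bounded ..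
    obtain g where "g \<in> H" "\<forall>m<n. g m = \<beta> m" using B[OF m0W] by blast
    then show False using A(2) n H_carrier by blast
  qed
  then show ?thesis using B by blast
qed

end

section \<open>Signed permutations of the summands\<close>

text \<open>The index \<open>k\<close> numbers the summands of a \<open>c\<^sub>0\<close>- or \<open>\<ell>\<^sub>p\<close>-like sum and \<open>\<phi> k i\<close> is the \<open>i\<close>-th coordinate in
  the summand \<open>k\<close>.\<close>

locale symmetric_space =
  fixes V :: "'v::real_vector set" and N0 N :: "'v \<Rightarrow> real" and I :: "nat set"
    and \<phi> :: "nat \<Rightarrow> nat \<Rightarrow> 'v \<Rightarrow> real" and z :: "nat \<Rightarrow> nat \<Rightarrow> 'v" and K :: real
  assumes V: "subspace V" and N0: "norm_on V N0" and N: "equivalent_norm V N0 N" and I0: "0 \<in> I"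
    and \<phi>_add: "\<And>k i x y. i \<in> I \<Longrightarrow> x \<in> V \<Longrightarrow> y \<in> V \<Longrightarrow> \<phi> k i (x + y) = \<phi> k i x + \<phi> k i y"
    and \<phi>_scale: "\<And>k i x c. i \<in> I \<Longrightarrow> x \<in> V \<Longrightarrow> \<phi> k i (c *\<^sub>R x) = c * \<phi> k i x"
    and \<phi>_le: "\<And>k i x. i \<in> I \<Longrightarrow> x \<in> V \<Longrightarrow> \<bar>\<phi> k i x\<bar> \<le> N x"
    and \<phi>_sep: "\<And>x y. x \<in> V \<Longrightarrow> y \<in> V \<Longrightarrow> (\<And>k i. i \<in> I \<Longrightarrow> \<phi> k i x = \<phi> k i y) \<Longrightarrow> x = y"
    and \<phi>_c0: "\<And>x \<epsilon>. x \<in> V \<Longrightarrow> 0 < \<epsilon> \<Longrightarrow> finite {(k, i). i \<in> I \<and> \<epsilon> \<le> \<bar>\<phi> k i x\<bar>}"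
    and z_in: "\<And>k i. i \<in> I \<Longrightarrow> z k i \<in> V"
    and \<phi>_z: "\<And>k i l j. i \<in> I \<Longrightarrow> j \<in> I \<Longrightarrow> \<phi> l j (z k i) = (if l = k \<and> j = i then 1 else 0)"
    and N_z: "\<And>k. N (z k 0) \<le> K"
    and signed_perm: "\<And>\<pi> \<sigma> x. bij \<pi> \<Longrightarrow> (\<And>k. \<bar>\<sigma> k\<bar> = 1) \<Longrightarrow> x \<in> V \<Longrightarrow>
       \<exists>y\<in>V. (\<forall>k. \<forall>i\<in>I. \<phi> k i y = \<sigma> k * \<phi> (\<pi> k) i x) \<and> N y = N x"
    and cut: "\<And>x \<epsilon>. x \<in> V \<Longrightarrow> 0 < \<epsilon> \<Longrightarrow>
       \<exists>n. \<exists>x'\<in>V. (\<forall>k. \<forall>i\<in>I. \<phi> k i x' = (if k < n then 0 else \<phi> k i x)) \<and> N x' < \<epsilon>"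
begin

lemma N_norm: "norm_on V N"
  using N by (simp add: equivalent_norm_def)

text \<open>If the first \<open>n\<close> summands are left alone, y - x is the difference between
  the image of the tail \<open>x'\<close> and this tail, both of norm less than
  \<epsilon>/2.\<close>

lemma signed_perm_near_identity:
  assumes x: "x \<in> V" and \<epsilon>: "0 < \<epsilon>"
  obtains n where "\<And>\<pi> \<sigma> y. bij \<pi> \<Longrightarrow> (\<And>k. \<bar>\<sigma> k\<bar> = 1) \<Longrightarrow> (\<And>k. k < n \<Longrightarrow> \<pi> k = k \<and> \<sigma> k = 1) \<Longrightarrow> y \<in> V \<Longrightarrow>
    (\<And>k i. i \<in> I \<Longrightarrow> \<phi> k i y = \<sigma> k * \<phi> (\<pi> k) i x) \<Longrightarrow> N (y - x) < \<epsilon>"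
proof -
  obtain n x' where x': "x' \<in> V" "\<And>k i. i \<in> I \<Longrightarrow> \<phi> k i x' = (if k < n then 0 else \<phi> k i x)" "N x' < \<epsilon> / 2"
    using cut[OF x, of "\<epsilon> / 2"] \<epsilon> by auto
  have "N (y - x) < \<epsilon>"
    if \<pi>: "bij \<pi>" and \<sigma>: "\<And>k. \<bar>\<sigma> k\<bar> = 1" and fixed: "\<And>k. k < n \<Longrightarrow> \<pi> k = k \<and> \<sigma> k = 1" and y: "y \<in> V"
      and eq: "\<And>k i. i \<in> I \<Longrightarrow> \<phi> k i y = \<sigma> k * \<phi> (\<pi> k) i x" for \<pi> \<sigma> y
  proof -
    obtain u where u: "u \<in> V" "\<And>k i. i \<in> I \<Longrightarrow> \<phi> k i u = \<sigma> k * \<phi> (\<pi> k) i x'" "N u = N x'"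
      using signed_perm[of \<pi> \<sigma> x', OF \<pi> \<sigma> x'(1)] by blast
    \<comment> \<open>An injective map that fixes the numbers below \<open>n\<close> also preserves
      the complement.\<close>
    have less: "\<pi> k < n \<longleftrightarrow> k < n" for k using fixed \<pi> by (metis bij_def inj_eq)
    have m: "y + (-1) *\<^sub>R x \<in> V" "u + (-1) *\<^sub>R x' \<in> V" "(-1) *\<^sub>R x \<in> V" "(-1) *\<^sub>R x' \<in> V"
      by (intro subspace_add[OF V] subspace_scale[OF V] x x' y u)+
    have "y + (-1) *\<^sub>R x = u + (-1) *\<^sub>R x'"
    proof (rule \<phi>_sep[OF m(1,2)])
      fix k i assume i: "i \<in> I"
      show "\<phi> k i (y + (-1) *\<^sub>R x) = \<phi> k i (u + (-1) *\<^sub>R x')"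
        unfolding \<phi>_add[OF i y m(3)] \<phi>_add[OF i u(1) m(4)] \<phi>_scale[OF i x] \<phi>_scale[OF i x'(1)]
        using i fixed[of k] by (simp add: eq u(2) x'(2) less)
    qed
    moreover have "N (u + (-1) *\<^sub>R x') \<le> N u + N ((-1) *\<^sub>R x')" "N ((-1) *\<^sub>R x') = \<bar>-1\<bar> * N x'"
      using N_norm u(1) x'(1) m(4) unfolding norm_on_def by blast+
    ultimately show ?thesis using u(3) x'(3) by simp
  qed
  then show ?thesis using that by blast
qed

end

locale symmetric_display = symmetric_space + involution_group
begin

text \<open>One representative of each pair \<open>{a, map s a}\<close>, chosen by the smaller code;
  the pair has two elements because \<open>s\<close> acts freely on \<open>W\<close>.\<close>

definition Rp :: "nat list set" where
  "Rp = {a \<in> W. to_nat a < to_nat (map s a)}"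

definition idx :: "nat list \<Rightarrow> nat" where
  "idx a = to_nat_on Rp (if a \<in> Rp then a else map s a)"

definition sg :: "nat list \<Rightarrow> real" where
  "sg a = (if a \<in> Rp then 1 else - 1)"

definition r :: "nat \<Rightarrow> nat list" where "r = from_nat_into Rp"

lemma Rp_W: "a \<in> Rp \<Longrightarrow> a \<in> W"
  by (simp add: Rp_def)

lemma Rp_sw: assumes "a \<in> W" shows "map s a \<in> Rp \<longleftrightarrow> a \<notin> Rp"
proof -
  have "to_nat a \<noteq> to_nat (map s a)" using sw_W(3)[OF assms] by simp
  then have "to_nat (map s a) < to_nat a \<longleftrightarrow> \<not> to_nat a < to_nat (map s a)" by linarith
  then show ?thesis
    unfolding Rp_def mem_Collect_eq sw_W(2) using assms sw_W(1)[OF assms] by blast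
qed

lemma countable_Rp: "countable Rp"
  by simp

lemma infinite_Rp: "infinite Rp"
proof
  assume fin: "finite Rp"
  have "W \<subseteq> Rp \<union> map s ` Rp"
  proof
    fix a assume a: "a \<in> W"
    show "a \<in> Rp \<union> map s ` Rp"
      using Rp_sw[OF a] sw_W(2)[of a] by (metis UnI1 UnI2 image_eqI)
  qed
  then have "finite W" using fin by (meson finite_UnI finite_imageI finite_subset)
  moreover have "[m0] \<in> W" by (simp add: in_W)
  then have "infinite {b \<in> W. P [m0] b}" by (rule P_inf)
  ultimately show False by simp
qed

lemma r_Rp: "r k \<in> Rp" and r_W: "r k \<in> W"
proof -
  have "Rp \<noteq> {}" using infinite_Rp by auto
  then show "r k \<in> Rp" unfolding r_def by (rule from_nat_into)
  then show "r k \<in> W" by (rule Rp_W)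
qed

lemma idx_r: "idx (r k) = k" and sg_r: "sg (r k) = 1"
proof -
  show "sg (r k) = 1" using r_Rp by (simp add: sg_def)
  have "idx (r k) = to_nat_on Rp (r k)" using r_Rp by (simp add: idx_def)
  then show "idx (r k) = k" unfolding r_def using infinite_Rp by simp
qed

lemma r_idx: assumes "a \<in> W" shows "r (idx a) = (if a \<in> Rp then a else map s a)"
  using Rp_sw[OF assms] unfolding r_def idx_def by (simp add: countable_Rp)

lemma idx_sw: "a \<in> W \<Longrightarrow> idx (map s a) = idx a"
  using Rp_sw[of a] sw_W(2)[of a] by (auto simp: idx_def simp del: map_map)

lemma sg_sw: "a \<in> W \<Longrightarrow> sg (map s a) = - sg a"
  using Rp_sw[of a] by (auto simp: sg_def)

lemma sg_sq[simp]: "sg a * sg a = 1" "\<bar>sg a\<bar> = 1" "sg a * (sg a * x) = x"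
  by (auto simp: sg_def)

lemma idx_eq: "a \<in> W \<Longrightarrow> b \<in> W \<Longrightarrow> idx a = idx b \<longleftrightarrow> a = b \<or> a = map s b"
  using r_idx[of a] r_idx[of b] idx_sw[of b] sw_W(2)[of a] sw_W(2)[of b] by metis

text \<open>One summand serves both \<open>a\<close> and \<open>map s a\<close>, read with opposite
  orientations, so that \<open>s\<close> becomes -1.\<close>

definition crd :: "nat list \<Rightarrow> nat \<Rightarrow> 'a \<Rightarrow> real" where
  "crd a i x = sg a * \<phi> (idx a) i x"

definition e :: "nat list \<Rightarrow> nat \<Rightarrow> 'a" where
  "e a i = sg a *\<^sub>R z (idx a) i"

sublocale rf: rigid_frame V N W "map s" I crd e K P kap nx
proof
  show "subspace V" "norm_on V N" "0 \<in> I" by (rule V N_norm I0)+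
  have m: "[m0] \<in> W" by (simp add: in_W)
  then show "W \<noteq> {}" by blast
  fix a b :: "nat list" and i j :: nat
  show "a \<in> W \<Longrightarrow> map s a \<in> W" "a \<in> W \<Longrightarrow> map s (map s a) = a" "a \<in> W \<Longrightarrow> map s a \<noteq> a"
    using sw_W by auto
  show "a \<in> W \<Longrightarrow> b \<in> W \<Longrightarrow> P a b \<Longrightarrow> a \<noteq> b \<and> a \<noteq> map s b" by (rule P_irr)
  show "finite {a \<in> W. P a b}" by (rule P_fin)
  show "a \<in> W \<Longrightarrow> infinite {b \<in> W. P a b}" by (rule P_inf)
  show "P a b \<Longrightarrow> P (map s a) (map s b)" by (simp add: P_map[OF s_in])
  show "kap (map s a) (map s b) = kap a b" by (rule kap_map[OF s_in])
  show "a \<in> W \<Longrightarrow> nx a \<in> W" "nx a \<noteq> a" "nx a \<noteq> map s a" "inj_on nx W" using nx by auto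
  show "a \<in> W \<Longrightarrow> N (e a 0) \<le> K"
    using N_norm N_z[of "idx a"] z_in[OF I0] by (simp add: e_def norm_on_def)
  assume i: "i \<in> I"
  show "e a i \<in> V" unfolding e_def using z_in[OF i] V by (intro subspace_scale)
  fix x assume x: "x \<in> V"
  show "crd a i (c *\<^sub>R x) = c * crd a i x" for c using x i by (simp add: crd_def \<phi>_scale)
  show "\<bar>crd a i x\<bar> \<le> N x" using \<phi>_le[OF i x] by (simp add: crd_def abs_mult)
  show "a \<in> W \<Longrightarrow> crd (map s a) i x = - crd a i x" by (simp add: crd_def idx_sw sg_sw)
  fix y assume y: "y \<in> V"
  show "crd a i (x + y) = crd a i x + crd a i y"
    using x y i by (simp add: crd_def \<phi>_add algebra_simps)
next
  fix x y assume x: "x \<in> V" and y: "y \<in> V" and eq: "\<And>a i. a \<in> W \<Longrightarrow> i \<in> I \<Longrightarrow> crd a i x = crd a i y"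
  show "x = y"
  proof (rule \<phi>_sep[OF x y])
    fix k i assume "i \<in> I"
    then show "\<phi> k i x = \<phi> k i y" using eq[OF r_W[of k]] by (simp add: crd_def idx_r sg_r)
  qed
next
  fix x and \<epsilon> :: real assume x: "x \<in> V" and \<epsilon>: "0 < \<epsilon>"
  let ?F = "{(k, i). i \<in> I \<and> \<epsilon> \<le> \<bar>\<phi> k i x\<bar>}"
  have "{(a, i). a \<in> W \<and> i \<in> I \<and> \<epsilon> \<le> \<bar>crd a i x\<bar>}
      \<subseteq> (\<lambda>(k, i). (r k, i)) ` ?F \<union> (\<lambda>(k, i). (map s (r k), i)) ` ?F"
  proof
    fix p assume "p \<in> {(a, i). a \<in> W \<and> i \<in> I \<and> \<epsilon> \<le> \<bar>crd a i x\<bar>}"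
    moreover obtain a i where p: "p = (a, i)" by (cases p)
    ultimately have a: "a \<in> W" "i \<in> I" "\<epsilon> \<le> \<bar>crd a i x\<bar>" by auto
    then have F: "(idx a, i) \<in> ?F" by (simp add: crd_def abs_mult)
    have "a = r (idx a) \<or> a = map s (r (idx a))"
      using r_idx[OF a(1)] sw_W(2)[of a] by metis
    then show "p \<in> (\<lambda>(k, i). (r k, i)) ` ?F \<union> (\<lambda>(k, i). (map s (r k), i)) ` ?F"
    proof
      assume "a = r (idx a)"
      then have "p = (\<lambda>(k, i). (r k, i)) (idx a, i)" using p by simp
      then show ?thesis using F by blast
    next
      assume "a = map s (r (idx a))"
      then have "p = (\<lambda>(k, i). (map s (r k), i)) (idx a, i)" using p by simp
      then show ?thesis using F by blast
    qed
  qed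
  moreover have "finite ((\<lambda>(k, i). (r k, i)) ` ?F \<union> (\<lambda>(k, i). (map s (r k), i)) ` ?F)"
    using \<phi>_c0[OF x \<epsilon>] by blast
  ultimately show "finite {(a, i). a \<in> W \<and> i \<in> I \<and> \<epsilon> \<le> \<bar>crd a i x\<bar>}" by (rule finite_subset)
next
  fix a b :: "nat list" and i j :: nat assume a: "a \<in> W" "i \<in> I" and b: "b \<in> W" "j \<in> I"
  have "crd b j (e a i) = sg a * sg b * (if idx b = idx a \<and> j = i then 1 else 0)"
    using \<phi>_z[OF a(2) b(2)] \<phi>_scale[OF b(2) z_in[OF a(2)]] by (simp add: crd_def e_def)
  then show "crd b j (e a i) = (if j = i then if b = a then 1 else if b = map s a then - 1 else 0 else 0)"
    using idx_eq[OF b(1) a(1)] sg_sw[OF a(1)] by auto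
qed

text \<open>The action is prescribed through coordinates: existence comes from
  \<open>signed_perm\<close>, uniqueness from separation. The inverse of \<open>g\<close> makes it a
  left action.\<close>

definition is_act :: "(nat \<Rightarrow> nat) \<Rightarrow> 'a \<Rightarrow> 'a \<Rightarrow> bool" where
  "is_act g x y \<longleftrightarrow> y \<in> V \<and> (\<forall>a\<in>W. \<forall>i\<in>I. crd a i y = crd (map (iv g) a) i x)"

definition act :: "(nat \<Rightarrow> nat) \<Rightarrow> 'a \<Rightarrow> 'a" where
  "act g = (\<lambda>x\<in>V. SOME y. is_act g x y)"

definition \<pi>' :: "(nat \<Rightarrow> nat) \<Rightarrow> nat \<Rightarrow> nat" where "\<pi>' g k = idx (map (iv g) (r k))"

definition \<sigma>' :: "(nat \<Rightarrow> nat) \<Rightarrow> nat \<Rightarrow> real" where "\<sigma>' g k = sg (map (iv g) (r k))"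

lemma W_iv: "g \<in> H \<Longrightarrow> a \<in> W \<Longrightarrow> map (iv g) a \<in> W"
  by (rule W_map[OF H_inv])

lemma map_iv: "g \<in> H \<Longrightarrow> map (iv g) (map g a) = a" "g \<in> H \<Longrightarrow> map g (map (iv g) a) = a"
  by (auto simp: o_def)

lemma iv_sw: "g \<in> H \<Longrightarrow> map (iv g) (map s a) = map s (map (iv g) a)"
  using s_comm'[OF H_inv] by simp

lemma \<pi>'_inverse: assumes g: "g \<in> H" shows "idx (map g (r (\<pi>' g k))) = k"
proof -
  let ?b = "map (iv g) (r k)"
  have b: "?b \<in> W" using W_iv[OF g r_W] .
  have "r (\<pi>' g k) = ?b \<or> r (\<pi>' g k) = map s ?b" using r_idx[OF b] by (metis \<pi>'_def)
  moreover have "map g (map s ?b) = map s (map g ?b)" using s_comm'[OF g] by simp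
  ultimately have "map g (r (\<pi>' g k)) = r k \<or> map g (r (\<pi>' g k)) = map s (r k)"
    using map_iv(2)[OF g, of "r k"] by metis
  then show ?thesis using idx_r idx_sw[OF r_W] by metis
qed

lemma iv_iv: "g \<in> H \<Longrightarrow> iv (iv g) = g"
  using H_bij by (simp add: inv_inv_eq)

lemma \<pi>'_bij: assumes g: "g \<in> H" shows "bij (\<pi>' g)"
proof (rule bijI)
  show "inj (\<pi>' g)" using \<pi>'_inverse[OF g] by (rule inj_on_inverseI)
  \<comment> \<open>\<open>\<pi>'_inverse\<close> for \<open>iv g\<close> says that
    \<open>\<pi>' (iv g)\<close> is a right inverse.\<close>
  show "surj (\<pi>' g)"
    using \<pi>'_inverse[OF H_inv[OF g]] unfolding \<pi>'_def iv_iv[OF g] by (rule surjI)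
qed

text \<open>Both sides of the defining condition change sign under \<open>map s\<close>, so it may
  be tested on the representatives \<open>r k\<close>; there it has the form that
  \<open>signed_perm\<close> solves.\<close>

lemma is_act_iff:
  assumes g: "g \<in> H" and x: "x \<in> V"
  shows "is_act g x y \<longleftrightarrow> y \<in> V \<and> (\<forall>k. \<forall>i\<in>I. \<phi> k i y = \<sigma>' g k * \<phi> (\<pi>' g k) i x)"
proof
  assume a: "is_act g x y"
  have "\<phi> k i y = \<sigma>' g k * \<phi> (\<pi>' g k) i x" if "i \<in> I" for k i
  proof -
    have "crd (r k) i y = crd (map (iv g) (r k)) i x" using a that r_W[of k] by (simp add: is_act_def)
    then show ?thesis by (simp add: crd_def idx_r sg_r \<sigma>'_def \<pi>'_def)
  qed
  then show "y \<in> V \<and> (\<forall>k. \<forall>i\<in>I. \<phi> k i y = \<sigma>' g k * \<phi> (\<pi>' g k) i x)" using a by (simp add: is_act_def)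
next
  assume a: "y \<in> V \<and> (\<forall>k. \<forall>i\<in>I. \<phi> k i y = \<sigma>' g k * \<phi> (\<pi>' g k) i x)"
  have "crd b i y = crd (map (iv g) b) i x" if b: "b \<in> W" and i: "i \<in> I" for b i
  proof -
    have "crd b i y = sg b * (sg (map (iv g) (r (idx b))) * \<phi> (idx (map (iv g) (r (idx b)))) i x)"
      using a i by (simp add: crd_def \<sigma>'_def \<pi>'_def)
    also have "\<dots> = crd (map (iv g) b) i x"
    proof (cases "b \<in> Rp")
      case True
      then show ?thesis using r_idx[OF b] by (simp add: crd_def sg_def)
    next
      case False
      then have "map (iv g) (r (idx b)) = map s (map (iv g) b)" using r_idx[OF b] iv_sw[OF g] by simp
      then show ?thesis
        using False idx_sw[OF W_iv[OF g b]] sg_sw[OF W_iv[OF g b]] by (simp only: crd_def) (simp add: sg_def)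
    qed
    finally show ?thesis .
  qed
  then show "is_act g x y" using a by (simp add: is_act_def)
qed

lemma is_act_unique: "is_act g x y \<Longrightarrow> is_act g x y' \<Longrightarrow> y = y'"
  by (rule rf.crd_sep) (auto simp: is_act_def)

lemma act_props:
  assumes g: "g \<in> H" and x: "x \<in> V"
  shows "is_act g x (act g x)" "N (act g x) = N x"
proof -
  have "\<bar>\<sigma>' g k\<bar> = 1" for k by (simp add: \<sigma>'_def)
  then obtain y where y: "is_act g x y" "N y = N x"
    using signed_perm[OF \<pi>'_bij[OF g] _ x] is_act_iff[OF g x] by blast
  have "is_act g x (SOME y. is_act g x y)" using y(1) by (rule someI)
  then show 1: "is_act g x (act g x)" using x by (simp add: act_def)
  show "N (act g x) = N x" using is_act_unique[OF 1 y(1)] y(2) by simp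
qed

lemma act_in: "g \<in> H \<Longrightarrow> x \<in> V \<Longrightarrow> act g x \<in> V"
  and crd_act: "g \<in> H \<Longrightarrow> x \<in> V \<Longrightarrow> a \<in> W \<Longrightarrow> i \<in> I \<Longrightarrow> crd a i (act g x) = crd (map (iv g) a) i x"
  using act_props(1) by (auto simp: is_act_def)

lemma act_ext: "act g \<in> extensional V"
  by (simp add: act_def)

lemma act_eqI: "g \<in> H \<Longrightarrow> x \<in> V \<Longrightarrow> y \<in> V \<Longrightarrow> (\<And>a i. a \<in> W \<Longrightarrow> i \<in> I \<Longrightarrow> crd a i y = crd (map (iv g) a) i x) \<Longrightarrow> act g x = y"
  by (rule is_act_unique[OF act_props(1)]) (auto simp: is_act_def)

lemma act_comp: assumes g: "g \<in> H" and h: "h \<in> H" and x: "x \<in> V" shows "act (g \<circ> h) x = act g (act h x)"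
proof (rule act_eqI[OF H_comp[OF g h] x])
  show "act g (act h x) \<in> V" using act_in g h x by blast
  fix a i assume a: "a \<in> W" and i: "i \<in> I"
  have "iv (g \<circ> h) = iv h \<circ> iv g" using H_bij g h by (simp add: o_inv_distrib)
  then show "crd a i (act g (act h x)) = crd (map (iv (g \<circ> h)) a) i x"
    using crd_act[OF g act_in[OF h x] a i] crd_act[OF h x W_iv[OF g a] i] by simp
qed

lemma act_id: "x \<in> V \<Longrightarrow> act id x = x"
  by (rule act_eqI[OF H_id]) (auto simp: inv_id)

lemma act_iv: assumes "g \<in> H" "x \<in> V" shows "act (iv g) (act g x) = x" "act g (act (iv g) x) = x"
  using act_comp[OF H_inv[OF assms(1)] assms] act_comp[OF assms(1) H_inv[OF assms(1)] assms(2)]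
    act_id[OF assms(2)] inv_comp_H[OF assms(1)] by simp_all

lemma act_linear: assumes g: "g \<in> H" shows "linear_on V (act g)"
  unfolding linear_on_def
proof (intro conjI ballI allI)
  fix x y assume xy: "x \<in> V" "y \<in> V"
  show "act g (x + y) = act g x + act g y"
    using act_in[OF g] xy V
    by (intro act_eqI[OF g]) (auto intro!: subspace_add simp: rf.crd_add crd_act[OF g] W_iv[OF g] simp del: list.map_comp)
next
  fix x c assume x: "x \<in> V"
  show "act g (c *\<^sub>R x) = c *\<^sub>R act g x"
    using act_in[OF g] x V
    by (intro act_eqI[OF g]) (auto intro!: subspace_scale simp: rf.crd_scale crd_act[OF g] W_iv[OF g])
qed

lemma act_bij: assumes g: "g \<in> H" shows "bij_betw (act g) V V"
  by (rule bij_betwI[of _ _ _ "act (iv g)"]) (use act_in[OF g] act_in[OF H_inv[OF g]] act_iv[OF g] in auto)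

lemma N_bounds: obtains \<alpha> \<beta> where "0 < \<alpha>" "0 < \<beta>" "\<And>x. x \<in> V \<Longrightarrow> \<alpha> * N0 x \<le> N x" "\<And>x. x \<in> V \<Longrightarrow> N x \<le> \<beta> * N0 x"
proof -
  have "\<exists>a>0. \<exists>b>0. \<forall>x\<in>V. a * N0 x \<le> N x \<and> N x \<le> b * N0 x"
    using N unfolding equivalent_norm_def by (rule conjunct2)
  then show ?thesis using that by (elim exE conjE) blast
qed

lemma act_bounded: assumes g: "g \<in> H" shows "bounded_linear_on V N0 (act g)"
proof -
  obtain \<alpha> \<beta> where ab: "0 < \<alpha>" "0 < \<beta>" "\<And>x. x \<in> V \<Longrightarrow> \<alpha> * N0 x \<le> N x" "\<And>x. x \<in> V \<Longrightarrow> N x \<le> \<beta> * N0 x"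
    using N_bounds by metis
  have "N0 (act g x) \<le> \<beta> / \<alpha> * N0 x" if x: "x \<in> V" for x
  proof -
    have "\<alpha> * N0 (act g x) \<le> \<beta> * N0 x"
      using ab(3)[OF act_in[OF g x]] ab(4)[OF x] act_props(2)[OF g x] by simp
    then show ?thesis using ab(1) by (simp add: field_simps)
  qed
  then show ?thesis using act_linear[OF g] unfolding bounded_linear_on_def by blast
qed

lemma act_inv_into: assumes g: "g \<in> H" and x: "x \<in> V" shows "inv_into V (act g) x = act (iv g) x"
proof (rule inv_into_f_eq)
  show "inj_on (act g) V" using act_bij[OF g] by (simp add: bij_betw_def)
qed (use act_in[OF H_inv[OF g] x] act_iv[OF g x] in auto)

lemma bounded_linear_on_cong:
  "(\<And>x. x \<in> V \<Longrightarrow> T x = T' x) \<Longrightarrow> bounded_linear_on V N0 T' \<Longrightarrow> bounded_linear_on V N0 T"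
  using V by (simp add: bounded_linear_on_def linear_on_def subspace_add subspace_scale)

lemma act_GL: assumes g: "g \<in> H" shows "act g \<in> GL_set V N0"
proof -
  have "bounded_linear_on V N0 (inv_into V (act g))"
    by (rule bounded_linear_on_cong[OF act_inv_into[OF g] act_bounded[OF H_inv[OF g]]])
  then show ?thesis
    using act_bij[OF g] act_ext act_bounded[OF g] by (simp add: GL_set_def Bij_def)
qed

lemma act_hom: "act \<in> hom (Sinf\<lparr>carrier := H\<rparr>) (GL V N0)"
proof (rule homI)
  show "x \<in> carrier (Sinf\<lparr>carrier := H\<rparr>) \<Longrightarrow> act x \<in> carrier (GL V N0)" for x
    using act_GL by (simp add: GL_def)
  fix x y assume xy: "x \<in> carrier (Sinf\<lparr>carrier := H\<rparr>)" "y \<in> carrier (Sinf\<lparr>carrier := H\<rparr>)"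
  then have m: "x \<in> H" "y \<in> H" by auto
  have "act (x \<circ> y) = compose V (act x) (act y)"
    using act_comp[OF m] act_ext by (intro extensionalityI[of _ V]) (auto simp: compose_def)
  moreover have "act x \<in> Bij V" "act y \<in> Bij V" using act_GL m by (auto simp: GL_set_def)
  ultimately show "act (x \<otimes>\<^bsub>Sinf\<lparr>carrier := H\<rparr>\<^esub> y) = act x \<otimes>\<^bsub>GL V N0\<^esub> act y"
    using mult_Sinf[OF H_carrier[OF m(1)] H_carrier[OF m(2)]] by (simp add: GL_def) (simp add: BijGroup_def)
qed

lemma act_isom: assumes g: "g \<in> H" shows "act g \<in> Isom V rf.M"
  unfolding Isom_def
proof (intro CollectI conjI ballI)
  show "act g \<in> extensional V" by (rule act_ext)
  show "linear_on V (act g)" by (rule act_linear[OF g])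
  show "act g ` V = V" using act_bij[OF g] by (simp add: bij_betw_def)
  show "rf.M (act g x) = rf.M x" if x: "x \<in> V" for x
  proof (rule rf.M_invariant[where U = "act g" and \<beta> = "map (iv g)", OF _ _ _ _ _ _ _ _ x])
    show "bij_betw (map (iv g)) W W"
      by (rule bij_betwI[of _ _ _ "map g"]) (use W_map[OF g] W_iv[OF g] map_iv[OF g] in \<open>auto simp del: map_map\<close>)
    show "map (iv g) (map s a) = map s (map (iv g) a)" if "a \<in> W" for a by (rule iv_sw[OF g])
    show "map (iv g) (nx a) = nx (map (iv g) a)" if "a \<in> W" for a using nx_map[OF that] by simp
    show "P (map (iv g) a) (map (iv g) b) = P a b" for a b by (rule P_map[OF H_inv[OF g]])
    show "kap (map (iv g) a) (map (iv g) b) = kap a b" for a b by (rule kap_map[OF H_inv[OF g]])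
  qed (use act_in[OF g] act_props(2)[OF g] crd_act[OF g] in auto)
qed

lemma isom_act: assumes T: "T \<in> Isom V rf.M" shows "T \<in> act ` H"
proof -
  obtain \<alpha> where \<alpha>: "bij_betw \<alpha> W W"
    "\<And>a i x. a \<in> W \<Longrightarrow> i \<in> I \<Longrightarrow> x \<in> V \<Longrightarrow> crd a i (T x) = crd (\<alpha> a) i x"
    "\<And>a b. a \<in> W \<Longrightarrow> b \<in> W \<Longrightarrow> P a b \<Longrightarrow> P (\<alpha> a) (\<alpha> b) \<and> kap (\<alpha> a) (\<alpha> b) = kap a b"
    using rf.isom_structure[OF T] by metis
  obtain h where h: "h \<in> H" "\<And>a. a \<in> W \<Longrightarrow> \<alpha> a = map h a" using rigid[OF \<alpha>(1)] \<alpha>(3) by metis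
  have Tin: "T x \<in> V" if "x \<in> V" for x using T that by (auto simp: Isom_def)
  have "act (iv h) = T"
  proof (rule extensionalityI[of _ V])
    show "act (iv h) \<in> extensional V" by (rule act_ext)
    show "T \<in> extensional V" using T by (simp add: Isom_def)
    show "act (iv h) x = T x" if x: "x \<in> V" for x
      by (rule act_eqI[OF H_inv[OF h(1)] x Tin[OF x]]) (use \<alpha>(2)[OF _ _ x] h iv_iv in auto)
  qed
  then show ?thesis using H_inv[OF h(1)] by blast
qed

lemma M_equivalent: "equivalent_norm V N0 rf.M"
proof -
  obtain \<alpha> \<beta> where ab: "0 < \<alpha>" "0 < \<beta>" "\<And>x. x \<in> V \<Longrightarrow> \<alpha> * N0 x \<le> N x" "\<And>x. x \<in> V \<Longrightarrow> N x \<le> \<beta> * N0 x"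
    using N_bounds by metis
  have c: "0 < (3 + 2 * rf.C) * \<beta>" using rf.C_pos ab by (intro mult_pos_pos) auto
  have "\<alpha> * N0 x \<le> rf.M x \<and> rf.M x \<le> (3 + 2 * rf.C) * \<beta> * N0 x" if x: "x \<in> V" for x
  proof
    show "\<alpha> * N0 x \<le> rf.M x" using ab(3)[OF x] rf.M_ge[OF x] by linarith
    have "(3 + 2 * rf.C) * N x \<le> (3 + 2 * rf.C) * (\<beta> * N0 x)"
      using ab(4)[OF x] rf.C_pos by (intro mult_left_mono) auto
    then show "rf.M x \<le> (3 + 2 * rf.C) * \<beta> * N0 x" using rf.M_le[OF x] by (simp add: mult.assoc)
  qed
  then show ?thesis unfolding equivalent_norm_def using rf.M_norm ab(1) c by blast
qed

section \<open>The action is a homeomorphism onto its image\<close>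

lemma norm_dist_in: "x \<in> V \<Longrightarrow> y \<in> V \<Longrightarrow> norm_dist V N0 x y = N0 (x - y)"
  by (simp add: norm_dist_def)

lemma topspace_norm: "topspace (norm_topology V N0) = V"
  unfolding norm_topology_def by (rule Metric_space.topspace_mtopology[OF Metric_space_norm_dist[OF V N0]])

text \<open>Writing h = u o g reduces the claim to elements \<open>u\<close> near the identity that
  act on the vector \<open>act g x\<close>; by \<open>signed_perm_near_identity\<close> it is enough
  that \<open>u\<close> fixes the first \<open>n\<close> representatives.\<close>

lemma continuous_act_at:
  assumes x: "x \<in> V"
  shows "continuous_map (subtopology Sinf_topology H) (norm_topology V N0) (\<lambda>g. act g x)"
proof -
  interpret ms: Metric_space V "norm_dist V N0" by (rule Metric_space_norm_dist[OF V N0])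
  obtain \<alpha> \<beta> where ab: "0 < \<alpha>" "0 < \<beta>" "\<And>x. x \<in> V \<Longrightarrow> \<alpha> * N0 x \<le> N x" "\<And>x. x \<in> V \<Longrightarrow> N x \<le> \<beta> * N0 x"
    using N_bounds by metis
  show ?thesis
    unfolding norm_topology_def ms.continuous_map_to_metric
  proof (intro ballI allI impI)
    fix g and \<epsilon> :: real assume g: "g \<in> topspace (subtopology Sinf_topology H)" and \<epsilon>: "0 < \<epsilon>"
    have gH: "g \<in> H" using g by simp
    have y: "act g x \<in> V" by (rule act_in[OF gH x])
    have e': "0 < \<alpha> * \<epsilon>" using ab \<epsilon> by simp
    obtain n where n: "\<And>\<pi> \<sigma> y'. bij \<pi> \<Longrightarrow> (\<And>k. \<bar>\<sigma> k\<bar> = 1) \<Longrightarrow> (\<And>k. k < n \<Longrightarrow> \<pi> k = k \<and> \<sigma> k = 1) \<Longrightarrow> y' \<in> V \<Longrightarrow>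
        (\<And>k i. i \<in> I \<Longrightarrow> \<phi> k i y' = \<sigma> k * \<phi> (\<pi> k) i (act g x)) \<Longrightarrow> N (y' - act g x) < \<alpha> * \<epsilon>"
      using signed_perm_near_identity[OF y e'] by blast
    \<comment> \<open>The preimages under \<open>g\<close> of all entries of these representatives:
      agreement of \<open>h\<close> with \<open>g\<close> on \<open>A\<close> makes \<open>u\<close>
      fix the entries.\<close>
    define A where "A = iv g ` (\<Union>k<n. set (r k))"
    have finA: "finite A" by (simp add: A_def)
    define U where "U = {h \<in> carrier Sinf. \<forall>m\<in>A. h m = g m} \<inter> H"
    have "openin (subtopology Sinf_topology H) U"
      unfolding U_def using openin_Sinf_basic[OF H_carrier[OF gH] finA] by (auto simp: openin_subtopology)
    moreover have "g \<in> U" using gH H_carrier by (simp add: U_def)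
    moreover have "act h x \<in> ms.mball (act g x) \<epsilon>" if h: "h \<in> U" for h
    proof -
      have hH: "h \<in> H" using h by (simp add: U_def)
      define u where "u = h \<circ> iv g"
      have uH: "u \<in> H" unfolding u_def by (rule H_comp[OF hH H_inv[OF gH]])
      have ug: "u \<circ> g = h" using inv_comp_H[OF gH] by (simp add: u_def o_assoc[symmetric])
      have fix1: "map (iv u) (r k) = r k" if k: "k < n" for k
      proof (rule map_idI)
        fix m assume m: "m \<in> set (r k)"
        have "iv g m \<in> A" using m k by (auto simp: A_def)
        then have "h (iv g m) = g (iv g m)" using h by (simp add: U_def)
        then have "u m = m" using gH by (simp add: u_def)
        then show "iv u m = m" using inv_H(1)[OF uH, of m] by simp
      qed
      have "N (act u (act g x) - act g x) < \<alpha> * \<epsilon>"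
      proof (rule n)
        show "bij (\<pi>' u)" by (rule \<pi>'_bij[OF uH])
        show "\<bar>\<sigma>' u k\<bar> = 1" for k by (simp add: \<sigma>'_def)
        show "\<pi>' u k = k \<and> \<sigma>' u k = 1" if "k < n" for k
          using fix1[OF that] by (simp add: \<pi>'_def \<sigma>'_def idx_r sg_r)
        show "act u (act g x) \<in> V" by (rule act_in[OF uH y])
        show "\<phi> k i (act u (act g x)) = \<sigma>' u k * \<phi> (\<pi>' u k) i (act g x)" if "i \<in> I" for k i
          using act_props(1)[OF uH y] is_act_iff[OF uH y] that by blast
      qed
      then have "N (act h x - act g x) < \<alpha> * \<epsilon>" using act_comp[OF uH gH x] ug by simp
      moreover have hx: "act h x \<in> V" by (rule act_in[OF hH x])
      ultimately have "\<alpha> * N0 (act h x - act g x) < \<alpha> * \<epsilon>"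
        using ab(3)[OF subspace_diff[OF V hx y]] by linarith
      then have "N0 (act h x - act g x) < \<epsilon>" using ab(1) by simp
      then show ?thesis
        using hx y ms.commute[of "act g x" "act h x"] by (simp add: norm_dist_in ms.in_mball)
    qed
    ultimately show "\<exists>U. openin (subtopology Sinf_topology H) U \<and> g \<in> U \<and> (\<forall>y\<in>U. act y x \<in> ms.mball (act g x) \<epsilon>)"
      by blast
  qed
qed

lemma continuous_act:
  "continuous_map (subtopology Sinf_topology H)
     (subtopology (strong_operator_topology V N0) (act ` H)) act"
  unfolding strong_operator_topology_def continuous_map_in_subtopology continuous_map_componentwise
proof (intro conjI ballI)
  show "act ` topspace (subtopology Sinf_topology H) \<subseteq> extensional V" using act_ext by blast
  show "continuous_map (subtopology Sinf_topology H) (norm_topology V N0) (\<lambda>g. act g x)" if "x \<in> V" for x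
    by (rule continuous_act_at[OF that])
  show "act \<in> topspace (subtopology Sinf_topology H) \<rightarrow> GL_set V N0" using act_GL by auto
  show "act \<in> topspace (subtopology Sinf_topology H) \<rightarrow> act ` H" by auto
qed

lemma topspace_H: "topspace (subtopology Sinf_topology H) = H"
  using H_carrier by (auto simp: topspace_Sinf)

text \<open>The coordinate at \<open>map g a\<close> is 1 for one vector, hence positive for the
  other. The coordinates of \<open>e a 0\<close> are 1, -1 or 0, and 1 occurs only at
  \<open>a\<close>; the sign thus separates \<open>a\<close> from \<open>map s a\<close>.\<close>

lemma act_e_near:
  assumes g: "g \<in> H" and h: "h \<in> H" and a: "a \<in> W" and near: "N (act h (e a 0) - act g (e a 0)) < 1"
  shows "map h a = map g a"
proof -
  have ea: "e a 0 \<in> V" by (rule rf.e_in[OF a I0])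
  have ga: "map g a \<in> W" by (rule W_map[OF g a])
  have "crd (map g a) 0 (act g (e a 0)) = 1"
    using crd_act[OF g ea ga I0] map_iv(1)[OF g] rf.crd_e[OF a I0 a I0] by simp
  moreover have "\<bar>crd (map g a) 0 (act h (e a 0) - act g (e a 0))\<bar> < 1"
    using rf.crd_le[OF ga I0 rf.V_diff[OF act_in[OF h ea] act_in[OF g ea]]] near by linarith
  ultimately have "0 < crd (map g a) 0 (act h (e a 0))"
    using rf.crd_diff[OF ga I0 act_in[OF h ea] act_in[OF g ea]] by linarith
  then have "0 < crd (map (iv h) (map g a)) 0 (e a 0)" using crd_act[OF h ea ga I0] by simp
  then have "map (iv h) (map g a) = a"
    using rf.crd_e[OF a I0 W_iv[OF h ga] I0] by (auto split: if_splits simp del: map_map)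
  then show ?thesis using map_iv(2)[OF h] by metis
qed

text \<open>The images of the finitely many vectors \<open>e [m0, m] 0\<close> with \<open>m\<close>
  in \<open>A\<close>, known up to a fixed error, determine \<open>h\<close> on \<open>A\<close> by
  \<open>act_e_near\<close>.\<close>

lemma open_act:
  "open_map (subtopology Sinf_topology H)
     (subtopology (strong_operator_topology V N0) (act ` H)) act"
  unfolding open_map_def
proof (intro allI impI)
  interpret ms: Metric_space V "norm_dist V N0" by (rule Metric_space_norm_dist[OF V N0])
  obtain \<alpha> \<beta> where ab: "0 < \<alpha>" "0 < \<beta>" "\<And>x. x \<in> V \<Longrightarrow> \<alpha> * N0 x \<le> N x" "\<And>x. x \<in> V \<Longrightarrow> N x \<le> \<beta> * N0 x"
    using N_bounds by metis
  let ?SOT = "strong_operator_topology V N0"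
  have comp: "continuous_map ?SOT (norm_topology V N0) (\<lambda>T. T x)" if "x \<in> V" for x
    unfolding strong_operator_topology_def
    by (rule continuous_map_from_subtopology[OF continuous_map_product_projection[OF that]])
  fix U assume U: "openin (subtopology Sinf_topology H) U"
  then obtain U0 where U0: "openin Sinf_topology U0" "U = U0 \<inter> H" by (auto simp: openin_subtopology)
  show "openin (subtopology ?SOT (act ` H)) (act ` U)"
  proof (subst openin_subopen, intro ballI)
    fix T assume "T \<in> act ` U"
    then obtain g where g: "g \<in> U" "T = act g" by blast
    then have gH: "g \<in> H" and gU0: "g \<in> U0" using U0 by auto
    obtain A where A: "finite A" "{h \<in> carrier Sinf. \<forall>x\<in>A. h x = g x} \<subseteq> U0"
      using openin_Sinf_nbhd[OF U0(1) gU0] by blast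
    let ?w = "\<lambda>m. e [m0, m] 0"
    have w: "?w m \<in> V" for m by (rule rf.e_in[OF in_W I0]) simp
    \<comment> \<open>The radius 1/\<beta> for \<open>N0\<close> guarantees a distance less than 1
      for \<open>N\<close>.\<close>
    define Q where "Q m = {T \<in> topspace ?SOT. T (?w m) \<in> ms.mball (act g (?w m)) (1 / \<beta>)}" for m
    have Q: "openin ?SOT (Q m)" for m
    proof -
      have "openin (norm_topology V N0) (ms.mball (act g (?w m)) (1 / \<beta>))"
        unfolding norm_topology_def by (rule ms.openin_mball)
      then show ?thesis unfolding Q_def by (rule openin_continuous_map_preimage[OF comp[OF w]])
    qed
    \<comment> \<open>For empty \<open>A\<close> the \<open>\<Inter>\<close> is \<open>UNIV\<close>,
      hence the intersection with the whole space.\<close>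
    define R where "R = (act ` H) \<inter> (topspace ?SOT \<inter> (\<Inter>m\<in>A. Q m))"
    have topin: "act h \<in> topspace ?SOT" if "h \<in> H" for h
      using act_GL[OF that] act_ext act_in[OF that]
      by (auto simp: strong_operator_topology_def topspace_norm PiE_def)
    have "openin ?SOT (topspace ?SOT \<inter> (\<Inter>m\<in>A. Q m))"
    proof (cases "A = {}")
      case False
      then show ?thesis using A(1) Q by (intro openin_Int openin_topspace openin_INT2) auto
    qed simp
    then have "openin (subtopology ?SOT (act ` H)) R"
      unfolding R_def by (auto simp: openin_subtopology)
    moreover have "T \<in> R"
      using g(2) gH topin[OF gH] act_in[OF gH w] ab(2) unfolding R_def Q_def by auto
    moreover have "R \<subseteq> act ` U"
    proof
      fix T' assume T': "T' \<in> R"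
      then obtain h where h: "h \<in> H" "T' = act h" by (auto simp: R_def)
      have "h m = g m" if m: "m \<in> A" for m
      proof -
        have "act h (?w m) \<in> ms.mball (act g (?w m)) (1 / \<beta>)" using T' h m by (auto simp: R_def Q_def)
        then have "norm_dist V N0 (act h (?w m)) (act g (?w m)) < 1 / \<beta>"
          using ms.commute[of "act g (?w m)" "act h (?w m)"] by simp
        then have "\<beta> * N0 (act h (?w m) - act g (?w m)) < 1"
          using act_in[OF h(1) w] act_in[OF gH w] ab(2) by (simp add: norm_dist_in field_simps)
        then have "N (act h (?w m) - act g (?w m)) < 1"
          using ab(4)[OF rf.V_diff[OF act_in[OF h(1) w] act_in[OF gH w]]] by (meson le_less_trans)
        then have "map h [m0, m] = map g [m0, m]" by (intro act_e_near[OF gH h(1)]) (simp_all add: in_W)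
        then show ?thesis by simp
      qed
      then have "h \<in> U" using A(2) H_carrier[OF h(1)] h(1) U0(2) by blast
      then show "T' \<in> act ` U" using h by blast
    qed
    ultimately show "\<exists>R. openin (subtopology ?SOT (act ` H)) R \<and> T \<in> R \<and> R \<subseteq> act ` U" by blast
  qed
qed

lemma act_inj: "inj_on act H"
proof (rule inj_onI)
  fix g h assume gh: "g \<in> H" "h \<in> H" "act g = act h"
  have z: "N (0::'a) = 0" using rf.N_zero[OF subspace_0[OF V]] by simp
  show "g = h"
  proof
    fix m
    have "map h [m0, m] = map g [m0, m]"
      using gh z by (intro act_e_near) (simp_all add: in_W)
    then show "g m = h m" by simp
  qed
qed

theorem displayable: "displayable (Sinf\<lparr>carrier := H\<rparr>) (subtopology Sinf_topology H) V N0"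
proof -
  have "topspace (subtopology (strong_operator_topology V N0) (act ` H)) = act ` H"
    using act_GL act_ext act_in
    by (auto simp: strong_operator_topology_def topspace_norm PiE_def)
  then have "homeomorphic_map (subtopology Sinf_topology H) (subtopology (strong_operator_topology V N0) (act ` H)) act"
    using continuous_act open_act act_inj by (intro bijective_open_imp_homeomorphic_map) (simp_all only: topspace_H)
  moreover have "act ` H = Isom V rf.M" using act_isom isom_act by blast
  ultimately have "is_display (Sinf\<lparr>carrier := H\<rparr>) (subtopology Sinf_topology H) V N0 act"
    unfolding is_display_def using act_hom M_equivalent by auto
  then show ?thesis unfolding displayable_def by blast
qed

end

section \<open>Triangular systems of coordinates\<close>

text \<open>Forward substitution: \<open>unmix c t\<close> are the coefficients of \<open>t\<close> with respect to the columns of the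
  lower triangular matrix \<open>c\<close>, so it turns a triangular system into a biorthogonal one.\<close>

fun unmix :: "(nat \<Rightarrow> nat \<Rightarrow> real) \<Rightarrow> (nat \<Rightarrow> real) \<Rightarrow> nat \<Rightarrow> real" where
  "unmix c t i = t i - (\<Sum>j<i. c i j * unmix c t j)"

declare unmix.simps[simp del]

lemma unmix_add: "unmix c (\<lambda>j. t j + u j) i = unmix c t i + unmix c u i"
proof (induction i rule: less_induct)
  case (less i)
  have "(\<Sum>j<i. c i j * unmix c (\<lambda>j. t j + u j) j) = (\<Sum>j<i. c i j * unmix c t j + c i j * unmix c u j)"
    using less by (intro sum.cong) (auto simp: algebra_simps)
  then show ?case
    unfolding unmix.simps[of c _ i] by (simp add: sum.distrib)
qed

lemma unmix_scale: "unmix c (\<lambda>j. a * t j) i = a * unmix c t i"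
proof (induction i rule: less_induct)
  case (less i)
  have "(\<Sum>j<i. c i j * unmix c (\<lambda>j. a * t j) j) = (\<Sum>j<i. a * (c i j * unmix c t j))"
    using less by (intro sum.cong) auto
  then show ?case
    unfolding unmix.simps[of c _ i] by (simp add: sum_distrib_left algebra_simps)
qed

lemma unmix_0: "unmix c (\<lambda>j. 0) i = 0"
  using unmix_scale[of c 0 "\<lambda>_. 0" i] by simp

lemma unmix_zero: "(\<And>i. unmix c t i = 0) \<Longrightarrow> t i = 0"
  using unmix.simps[of c t i] by simp

text \<open>The biorthogonality: substitution returns the unit vector that selects a column.\<close>

lemma unmix_column:
  assumes "\<And>i. c i i = 1" "\<And>i j. i < j \<Longrightarrow> c i j = 0"
  shows "unmix c (\<lambda>i. c i k) i = (if i = k then 1 else 0)"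
proof (induction i rule: less_induct)
  case (less i)
  have "(\<Sum>j<i. c i j * unmix c (\<lambda>i. c i k) j) = (\<Sum>j<i. if j = k then c i k else 0)"
    using less by (intro sum.cong) auto
  also have "\<dots> = (if k < i then c i k else 0)" by simp
  finally show ?case unfolding unmix.simps[of c _ i] using assms by (cases i k rule: linorder_cases) auto
qed

text \<open>Each component is a finite combination of entries of \<open>t\<close>. The bound depends
  on \<open>i\<close> but not on \<open>t\<close>, so it can be absorbed in a weight.\<close>

lemma unmix_bounded:
  "\<exists>B>0. \<forall>t m. (\<forall>j. \<bar>t j\<bar> \<le> m) \<longrightarrow> \<bar>unmix c t i\<bar> \<le> B * m"
proof (induction i rule: less_induct)
  case (less i)
  then obtain B where B: "\<And>j. j < i \<Longrightarrow> 0 < B j" "\<And>j t m. j < i \<Longrightarrow> \<forall>j. \<bar>t j\<bar> \<le> m \<Longrightarrow> \<bar>unmix c t j\<bar> \<le> B j * m"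
    by metis
  have "\<bar>unmix c t i\<bar> \<le> (1 + (\<Sum>j<i. \<bar>c i j\<bar> * B j)) * m" if t: "\<forall>j. \<bar>t j\<bar> \<le> m" for t m
  proof -
    have "\<bar>unmix c t i\<bar> \<le> \<bar>t i\<bar> + \<bar>\<Sum>j<i. c i j * unmix c t j\<bar>"
      unfolding unmix.simps[of c _ i] by (rule abs_triangle_ineq4)
    also have "\<bar>\<Sum>j<i. c i j * unmix c t j\<bar> \<le> (\<Sum>j<i. \<bar>c i j\<bar> * B j * m)"
    proof (rule order_trans[OF sum_abs sum_mono])
      fix j assume "j \<in> {..<i}"
      then show "\<bar>c i j * unmix c t j\<bar> \<le> \<bar>c i j\<bar> * B j * m"
        using B(2)[of j t m] t by (simp add: abs_mult mult.assoc mult_left_mono)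
    qed
    also have "\<dots> = (\<Sum>j<i. \<bar>c i j\<bar> * B j) * m" by (simp add: sum_distrib_right)
    finally show ?thesis using t by (simp add: algebra_simps) (meson add_mono order_trans order_refl)
  qed
  moreover have "0 < 1 + (\<Sum>j<i. \<bar>c i j\<bar> * B j)"
    using B(1) by (intro add_pos_nonneg sum_nonneg) (auto simp: less_imp_le)
  ultimately show ?case by blast
qed

definition unmix_bd :: "(nat \<Rightarrow> nat \<Rightarrow> real) \<Rightarrow> nat \<Rightarrow> real" where
  "unmix_bd c i = (SOME B. B > 0 \<and> (\<forall>t m. (\<forall>j. \<bar>t j\<bar> \<le> m) \<longrightarrow> \<bar>unmix c t i\<bar> \<le> B * m))"

lemma unmix_bd: "unmix_bd c i > 0" "(\<And>j. \<bar>t j\<bar> \<le> m) \<Longrightarrow> \<bar>unmix c t i\<bar> \<le> unmix_bd c i * m"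
proof -
  have "unmix_bd c i > 0 \<and> (\<forall>t m. (\<forall>j. \<bar>t j\<bar> \<le> m) \<longrightarrow> \<bar>unmix c t i\<bar> \<le> unmix_bd c i * m)"
    unfolding unmix_bd_def by (rule someI_ex) (use unmix_bounded[of c i] in blast)
  then show "unmix_bd c i > 0" "(\<And>j. \<bar>t j\<bar> \<le> m) \<Longrightarrow> \<bar>unmix c t i\<bar> \<le> unmix_bd c i * m" by blast+
qed

text \<open>Evaluations at a dense sequence have no biorthogonal continuous functions, since a
  function that vanishes at all other points of the sequence vanishes everywhere. Vanishing at the
  earlier points is possible, however, and gives a unitriangular matrix \<open>c\<close>. Unmixing
  takes place inside a summand and therefore commutes with signed permutations of the
  summands.\<close>

locale triangular_space =
  fixes V :: "'v::real_vector set" and N0 N :: "'v \<Rightarrow> real"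
    and \<theta> :: "nat \<Rightarrow> nat \<Rightarrow> 'v \<Rightarrow> real" and z :: "nat \<Rightarrow> nat \<Rightarrow> 'v" and c :: "nat \<Rightarrow> nat \<Rightarrow> real" and K :: real
  assumes V: "subspace V" and N0: "norm_on V N0" and N: "equivalent_norm V N0 N"
    and c: "\<And>i. c i i = 1" "\<And>i j. i < j \<Longrightarrow> c i j = 0"
    and \<theta>_add: "\<And>k i x y. x \<in> V \<Longrightarrow> y \<in> V \<Longrightarrow> \<theta> k i (x + y) = \<theta> k i x + \<theta> k i y"
    and \<theta>_scale: "\<And>k i x a. x \<in> V \<Longrightarrow> \<theta> k i (a *\<^sub>R x) = a * \<theta> k i x"
    and \<theta>_le: "\<And>k i x. x \<in> V \<Longrightarrow> \<bar>\<theta> k i x\<bar> \<le> N x"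
    and \<theta>_sep: "\<And>x y. x \<in> V \<Longrightarrow> y \<in> V \<Longrightarrow> (\<And>k i. \<theta> k i x = \<theta> k i y) \<Longrightarrow> x = y"
    and z_in: "\<And>k i. z k i \<in> V"
    and \<theta>_z: "\<And>k i l j. \<theta> l j (z k i) = (if l = k then c j i else 0)"
    and N_z: "\<And>k. N (z k 0) \<le> K"
    and signed_perm: "\<And>\<pi> \<sigma> x. bij \<pi> \<Longrightarrow> (\<And>k. \<bar>\<sigma> k\<bar> = 1) \<Longrightarrow> x \<in> V \<Longrightarrow>
       \<exists>y\<in>V. (\<forall>k i. \<theta> k i y = \<sigma> k * \<theta> (\<pi> k) i x) \<and> N y = N x"
    and cut: "\<And>x \<epsilon>. x \<in> V \<Longrightarrow> 0 < \<epsilon> \<Longrightarrow>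
       \<exists>n. \<exists>x'\<in>V. (\<forall>k i. \<theta> k i x' = (if k < n then 0 else \<theta> k i x)) \<and> N x' < \<epsilon>"
begin

text \<open>The first factor bounds the unmixed coordinates by the norm, the powers of 2 make them
  tend to zero with the level.\<close>

definition w :: "nat \<Rightarrow> real" where
  "w i = inverse (unmix_bd c i * 2 ^ i)"

definition \<phi> :: "nat \<Rightarrow> nat \<Rightarrow> 'v \<Rightarrow> real" where
  "\<phi> k i x = w i * unmix c (\<lambda>j. \<theta> k j x) i"

lemma w_pos: "0 < w i"
  using unmix_bd(1)[of c i] by (simp add: w_def)

lemma \<phi>_bound: assumes "\<And>j. \<bar>\<theta> k j x\<bar> \<le> m" shows "\<bar>\<phi> k i x\<bar> \<le> m / 2 ^ i"
proof -
  have "\<bar>\<phi> k i x\<bar> \<le> w i * (unmix_bd c i * m)"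
    unfolding \<phi>_def abs_mult using w_pos[of i] unmix_bd(2)[of "\<lambda>j. \<theta> k j x", OF assms]
    by (simp add: mult_left_mono)
  also have "\<dots> = m / 2 ^ i" using unmix_bd(1)[of c i] by (simp add: w_def field_simps)
  finally show ?thesis .
qed

text \<open>For fixed \<open>k\<close>, unmixing is linear and injective. The same equivalence, with
  trivial \<sigma> and \<pi>, gives separation of points.\<close>

lemma \<phi>_perm_iff:
  "(\<forall>k i. \<phi> k i y = \<sigma> k * \<phi> (\<pi> k) i x) \<longleftrightarrow> (\<forall>k i. \<theta> k i y = \<sigma> k * \<theta> (\<pi> k) i x)"
proof
  assume a: "\<forall>k i. \<theta> k i y = \<sigma> k * \<theta> (\<pi> k) i x"
  show "\<forall>k i. \<phi> k i y = \<sigma> k * \<phi> (\<pi> k) i x" by (simp add: a \<phi>_def unmix_scale)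
next
  assume a: "\<forall>k i. \<phi> k i y = \<sigma> k * \<phi> (\<pi> k) i x"
  have "\<theta> k i y + (- \<sigma> k) * \<theta> (\<pi> k) i x = 0" for k i
  proof (rule unmix_zero)
    fix i
    have "w i * (unmix c (\<lambda>j. \<theta> k j y) i - \<sigma> k * unmix c (\<lambda>j. \<theta> (\<pi> k) j x) i) = 0"
      using a[rule_format, of k i] by (simp add: \<phi>_def algebra_simps)
    then have "unmix c (\<lambda>j. \<theta> k j y) i - \<sigma> k * unmix c (\<lambda>j. \<theta> (\<pi> k) j x) i = 0"
      using w_pos[of i] by simp
    then show "unmix c (\<lambda>i. \<theta> k i y + (- \<sigma> k) * \<theta> (\<pi> k) i x) i = 0"
      by (simp only: unmix_add unmix_scale)
  qed
  then show "\<forall>k i. \<theta> k i y = \<sigma> k * \<theta> (\<pi> k) i x" by (simp add: algebra_simps)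
qed

sublocale symmetric_space V N0 N UNIV \<phi> "\<lambda>k i. inverse (w i) *\<^sub>R z k i" "inverse (w 0) * K"
proof
  show "subspace V" "norm_on V N0" "equivalent_norm V N0 N" by (rule V N0 N)+
  show "(0::nat) \<in> UNIV" by simp
  fix k i :: nat and x assume x: "x \<in> V"
  show "\<phi> k i (a *\<^sub>R x) = a * \<phi> k i x" for a using x by (simp add: \<phi>_def \<theta>_scale unmix_scale)
  have "\<bar>\<phi> k i x\<bar> \<le> N x / 2 ^ i" by (rule \<phi>_bound) (rule \<theta>_le[OF x])
  also have "N x / 2 ^ i \<le> N x / 1"
    using \<theta>_le[OF x, of 0 0] by (intro divide_left_mono) auto
  finally show "\<bar>\<phi> k i x\<bar> \<le> N x" by simp
  fix y assume y: "y \<in> V"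
  show "\<phi> k i (x + y) = \<phi> k i x + \<phi> k i y"
    using x y by (simp add: \<phi>_def \<theta>_add unmix_add algebra_simps)
next
  fix x y assume xy: "x \<in> V" "y \<in> V" and eq: "\<And>k i. i \<in> UNIV \<Longrightarrow> \<phi> k i x = \<phi> k i y"
  have "\<forall>k i. \<phi> k i x = 1 * \<phi> (id k) i y" using eq by simp
  then have "\<forall>k i. \<theta> k i x = 1 * \<theta> (id k) i y" by (subst (asm) \<phi>_perm_iff)
  then show "x = y" using \<theta>_sep[OF xy] by simp
next
  fix x and \<epsilon> :: real assume x: "x \<in> V" and \<epsilon>: "0 < \<epsilon>"
  have nn: "0 \<le> N x" using \<theta>_le[OF x, of 0 0] by linarith
  \<comment> \<open>Beyond \<open>n\<close> the coordinates are those of the small vector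
    \<open>x'\<close>, which bounds \<open>k\<close>; the weights bound \<open>i\<close>.\<close>
  obtain n x' where x': "x' \<in> V" "\<And>k i. \<theta> k i x' = (if k < n then 0 else \<theta> k i x)" "N x' < \<epsilon> / 2"
    using cut[OF x, of "\<epsilon> / 2"] \<epsilon> by auto
  have n: "\<bar>\<theta> k i x\<bar> \<le> \<epsilon> / 2" if "n \<le> k" for k i
    using \<theta>_le[OF x'(1), of k i] x'(2)[of k i] x'(3) that by simp
  obtain m where m: "(1 / 2) ^ m < \<epsilon> / (N x + 1)"
    using real_arch_pow_inv[of "\<epsilon> / (N x + 1)" "1 / 2"] \<epsilon> nn by auto
  have "{(k, i). i \<in> UNIV \<and> \<epsilon> \<le> \<bar>\<phi> k i x\<bar>} \<subseteq> {..<n} \<times> {..<m}"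
  proof clarify
    fix k i assume e: "\<epsilon> \<le> \<bar>\<phi> k i x\<bar>"
    have "k < n"
    proof (rule ccontr)
      assume "\<not> k < n"
      then have "\<bar>\<phi> k i x\<bar> \<le> (\<epsilon> / 2) / 2 ^ i" using n by (intro \<phi>_bound) auto
      also have "\<dots> \<le> (\<epsilon> / 2) / 1" using \<epsilon> by (intro divide_left_mono) auto
      finally show False using e \<epsilon> by simp
    qed
    moreover have "i < m"
    proof (rule ccontr)
      assume i: "\<not> i < m"
      have "\<bar>\<phi> k i x\<bar> \<le> N x / 2 ^ i" by (rule \<phi>_bound) (rule \<theta>_le[OF x])
      also have "\<dots> \<le> (N x + 1) * (1 / 2) ^ i" by (simp add: power_one_over field_simps)
      also have "\<dots> \<le> (N x + 1) * (1 / 2) ^ m"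
        using i nn by (intro mult_left_mono power_decreasing) auto
      also have "\<dots> < \<epsilon>" using m nn by (simp add: field_simps)
      finally show False using e by simp
    qed
    ultimately show "k \<in> {..<n} \<and> i \<in> {..<m}" by simp
  qed
  then show "finite {(k, i). i \<in> UNIV \<and> \<epsilon> \<le> \<bar>\<phi> k i x\<bar>}" by (rule finite_subset) simp
next
  fix k i l j :: nat
  show "inverse (w i) *\<^sub>R z k i \<in> V" using z_in V by (intro subspace_scale)
  have col: "unmix c (\<lambda>j. c j i) j = (if j = i then 1 else 0)" by (rule unmix_column) (auto simp: c)
  have "\<phi> l j (inverse (w i) *\<^sub>R z k i) = w j * inverse (w i) * (if l = k then unmix c (\<lambda>j. c j i) j else unmix c (\<lambda>j. 0) j)"
    unfolding \<phi>_def \<theta>_scale[OF z_in] unmix_scale \<theta>_z by (cases "l = k") simp_all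
  also have "\<dots> = (if l = k \<and> j = i then 1 else 0)"
    using w_pos[of i] col by (auto simp: unmix_0)
  finally show "\<phi> l j (inverse (w i) *\<^sub>R z k i) = (if l = k \<and> j = i then 1 else 0)" .
next
  fix k
  have "N (inverse (w 0) *\<^sub>R z k 0) = \<bar>inverse (w 0)\<bar> * N (z k 0)"
    using N z_in by (simp add: equivalent_norm_def norm_on_def)
  then show "N (inverse (w 0) *\<^sub>R z k 0) \<le> inverse (w 0) * K"
    using w_pos[of 0] N_z[of k] by (simp add: mult_left_mono)
next
  fix \<pi> :: "nat \<Rightarrow> nat" and \<sigma> :: "nat \<Rightarrow> real" and x
  assume "bij \<pi>" "\<And>k. \<bar>\<sigma> k\<bar> = 1" "x \<in> V"
  then obtain y where "y \<in> V" "\<forall>k i. \<theta> k i y = \<sigma> k * \<theta> (\<pi> k) i x" "N y = N x" using signed_perm by metis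
  then show "\<exists>y\<in>V. (\<forall>k. \<forall>i\<in>UNIV. \<phi> k i y = \<sigma> k * \<phi> (\<pi> k) i x) \<and> N y = N x"
    using \<phi>_perm_iff by auto
next
  fix x and \<epsilon> :: real assume x: "x \<in> V" and \<epsilon>: "0 < \<epsilon>"
  obtain n x' where x': "x' \<in> V" "\<And>k i. \<theta> k i x' = (if k < n then 0 else \<theta> k i x)" "N x' < \<epsilon>"
    using cut[OF x \<epsilon>] by blast
  have "\<phi> k i x' = (if k < n then 0 else \<phi> k i x)" for k i by (simp add: \<phi>_def x'(2) unmix_0)
  then show "\<exists>n. \<exists>x'\<in>V. (\<forall>k. \<forall>i\<in>UNIV. \<phi> k i x' = (if k < n then 0 else \<phi> k i x)) \<and> N x' < \<epsilon>"
    using x'(1,3) by blast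
qed

end

section \<open>Sequence spaces\<close>

lemma abs_powr_convex:
  fixes a b t p :: real
  assumes p: "1 \<le> p" and t: "0 \<le> t" "t \<le> 1"
  shows "\<bar>(1 - t) * a + t * b\<bar> powr p \<le> (1 - t) * \<bar>a\<bar> powr p + t * \<bar>b\<bar> powr p"
proof -
  have sub: "u powr p \<le> u" if "0 \<le> u" "u \<le> 1" for u :: real
  proof (cases "u = 0")
    case False
    then show ?thesis using powr_mono'[of 1 p u] p that by simp
  qed (use p in simp)
  have "\<bar>(1 - t) * a + t * b\<bar> \<le> (1 - t) * \<bar>a\<bar> + t * \<bar>b\<bar>"
    using t by (intro order_trans[OF abs_triangle_ineq]) (simp add: abs_mult)
  then have "\<bar>(1 - t) * a + t * b\<bar> powr p \<le> ((1 - t) * \<bar>a\<bar> + t * \<bar>b\<bar>) powr p"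
    using p by (intro powr_mono2) auto
  also have "\<dots> \<le> (1 - t) * \<bar>a\<bar> powr p + t * \<bar>b\<bar> powr p"
  \<comment> \<open>Convexity of the power is applied to positive arguments; if one vanishes,
    \<open>u powr p \<le> u\<close> on the unit interval suffices.\<close>
  proof (cases "a = 0 \<or> b = 0")
    case True
    have 1: "((1 - t) * \<bar>a\<bar>) powr p \<le> (1 - t) * \<bar>a\<bar> powr p"
      using sub[of "1 - t"] t by (simp add: powr_mult mult_right_mono)
    have 2: "(t * \<bar>b\<bar>) powr p \<le> t * \<bar>b\<bar> powr p"
      using sub[of t] t by (simp add: powr_mult mult_right_mono)
    show ?thesis using True 1 2 p by auto
  next
    case False
    then show ?thesis
      using convex_onD[OF powr_convex[OF p], of t "\<bar>a\<bar>" "\<bar>b\<bar>"] t by simp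
  qed
  finally show ?thesis .
qed

lemma abs_powr_add:
  fixes a b p :: real
  assumes p: "1 \<le> p"
  shows "\<bar>a + b\<bar> powr p \<le> 2 powr p * (\<bar>a\<bar> powr p + \<bar>b\<bar> powr p)"
proof -
  have "a + b = 2 * ((1 - 1/2) * a + 1/2 * b)" by simp
  then have "\<bar>a + b\<bar> = 2 * \<bar>(1 - 1/2) * a + 1/2 * b\<bar>" by (metis abs_mult abs_numeral)
  then have "\<bar>a + b\<bar> powr p = 2 powr p * \<bar>(1 - 1/2) * a + 1/2 * b\<bar> powr p"
    by (simp only: powr_mult)
  also have "\<dots> \<le> 2 powr p * ((1 - 1/2) * \<bar>a\<bar> powr p + 1/2 * \<bar>b\<bar> powr p)"
    by (intro mult_left_mono abs_powr_convex[OF p]) auto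
  also have "\<dots> \<le> 2 powr p * (\<bar>a\<bar> powr p + \<bar>b\<bar> powr p)"
    by (intro mult_left_mono add_mono) auto
  finally show ?thesis .
qed

text \<open>For sums and integrals of \<open>p\<close>-th powers this is Minkowski's inequality.\<close>

lemma modular_norm:
  fixes \<rho> :: "'a::real_vector \<Rightarrow> real" and p :: real
  assumes V: "subspace V" and p: "1 \<le> p"
    and nn: "\<And>x. x \<in> V \<Longrightarrow> 0 \<le> \<rho> x" and zero: "\<And>x. x \<in> V \<Longrightarrow> \<rho> x = 0 \<longleftrightarrow> x = 0"
    and hom: "\<And>x c. x \<in> V \<Longrightarrow> \<rho> (c *\<^sub>R x) = \<bar>c\<bar> powr p * \<rho> x"
    and conv: "\<And>x y t. x \<in> V \<Longrightarrow> y \<in> V \<Longrightarrow> 0 \<le> t \<Longrightarrow> t \<le> 1 \<Longrightarrow>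
      \<rho> ((1 - t) *\<^sub>R x + t *\<^sub>R y) \<le> (1 - t) * \<rho> x + t * \<rho> y"
  shows "norm_on V (\<lambda>x. \<rho> x powr (1 / p))"
  unfolding norm_on_def
proof (intro conjI ballI allI)
  let ?N = "\<lambda>x. \<rho> x powr (1 / p)"
  fix x assume x: "x \<in> V"
  show "0 \<le> ?N x" by simp
  show "?N x = 0 \<longleftrightarrow> x = 0" using zero[OF x] by simp
  show "?N (c *\<^sub>R x) = \<bar>c\<bar> * ?N x" for c
    using hom[OF x] nn[OF x] p by (simp add: powr_mult powr_powr)
next
  let ?N = "\<lambda>x. \<rho> x powr (1 / p)"
  fix x y assume x: "x \<in> V" and y: "y \<in> V"
  show "?N (x + y) \<le> ?N x + ?N y"
  proof (cases "x = 0 \<or> y = 0")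
    case False
    define A where "A = ?N x"
    define B where "B = ?N y"
    have pos: "0 < \<rho> x" "0 < \<rho> y" using False zero nn x y by (metis less_eq_real_def)+
    have A: "0 < A" "A powr p = \<rho> x" and B: "0 < B" "B powr p = \<rho> y"
      using pos p by (auto simp: A_def B_def powr_powr)
    have unit: "\<rho> (inverse A *\<^sub>R x) = 1" "\<rho> (inverse B *\<^sub>R y) = 1"
      using hom[OF x, of "inverse A"] hom[OF y, of "inverse B"] A B pos
      by (simp_all add: inverse_eq_divide powr_divide)
    have m: "inverse A *\<^sub>R x \<in> V" "inverse B *\<^sub>R y \<in> V" using V x y by (auto intro: subspace_scale)
    \<comment> \<open>With these weights the convex combination of the normalised vectors is (x + y)
      / (A + B).\<close>
    define t where "t = B / (A + B)"
    have t: "0 \<le> t" "t \<le> 1" "1 - t = A / (A + B)" using A B by (auto simp: t_def field_simps)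
    have "(1 - t) *\<^sub>R inverse A *\<^sub>R x + t *\<^sub>R inverse B *\<^sub>R y = inverse (A + B) *\<^sub>R (x + y)"
      using A B unfolding t(3) by (simp add: t_def scaleR_add_right field_simps)
    then have "\<rho> (inverse (A + B) *\<^sub>R (x + y)) \<le> 1"
      using conv[OF m t(1,2)] unit by simp
    then have "inverse (A + B) powr p * \<rho> (x + y) \<le> 1"
      using hom[OF subspace_add[OF V x y], of "inverse (A + B)"] A B by simp
    then have "\<rho> (x + y) \<le> (A + B) powr p"
      using A B by (simp add: inverse_eq_divide powr_divide field_simps)
    then have "?N (x + y) \<le> ((A + B) powr p) powr (1 / p)"
      using p nn[OF subspace_add[OF V x y]] by (intro powr_mono2) auto
    also have "\<dots> = A + B" using A B p by (simp add: powr_powr)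
    finally show ?thesis by (simp add: A_def B_def)
  qed auto
qed

lemma equivalent_norm_refl: "norm_on V N \<Longrightarrow> equivalent_norm V N N"
  unfolding equivalent_norm_def by (intro conjI exI[of _ 1]) auto

section \<open>Null sequences\<close>

lemma c0_bdd:
  assumes "x \<in> c0_space" shows "bdd_above (range (\<lambda>n. \<bar>x n\<bar>))"
proof -
  have "Bseq x" using assms by (intro convergent_imp_Bseq) (auto simp: c0_space_def convergent_def)
  then obtain B where "\<And>n. \<bar>x n\<bar> \<le> B" by (auto simp: Bseq_def)
  then show ?thesis by (intro bdd_aboveI2)
qed

lemma c0_le: "x \<in> c0_space \<Longrightarrow> \<bar>x n\<bar> \<le> c0_norm x"
  unfolding c0_norm_def using c0_bdd by (intro cSUP_upper) auto

lemma c0_least: "(\<And>n. \<bar>x n\<bar> \<le> c) \<Longrightarrow> c0_norm x \<le> c"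
  unfolding c0_norm_def by (intro cSUP_least) auto

lemma subspace_c0: "subspace c0_space"
  unfolding subspace_def c0_space_def
  by (auto simp: plus_fun_def zero_fun_def scaleR_fun_def intro: tendsto_eq_intros)

lemma norm_c0: "norm_on c0_space c0_norm"
  unfolding c0_norm_def[abs_def]
  by (rule norm_on_SUP[where B = c0_norm, OF subspace_c0])
    (auto simp: c0_le plus_fun_def scaleR_fun_def zero_fun_def fun_eq_iff)

lemma finite_ge_null_sequence:
  fixes x :: "nat \<Rightarrow> real"
  assumes "x \<longlonglongrightarrow> 0" "0 < \<epsilon>" shows "\<exists>n. \<forall>k\<ge>n. \<bar>x k\<bar> < \<epsilon>"
  using LIMSEQ_D[OF assms] by simp

lemma c0_perm:
  assumes x: "x \<in> c0_space" and \<pi>: "bij \<pi>" and \<sigma>: "\<And>k::nat. \<bar>\<sigma> k\<bar> = 1"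
  shows "(\<lambda>k. \<sigma> k * x (\<pi> k)) \<in> c0_space"
  unfolding c0_space_def mem_Collect_eq
proof (rule LIMSEQ_I)
  fix \<epsilon> :: real assume \<epsilon>: "0 < \<epsilon>"
  obtain n where n: "\<forall>k\<ge>n. \<bar>x k\<bar> < \<epsilon>"
    using finite_ge_null_sequence[OF _ \<epsilon>, of x] x by (auto simp: c0_space_def)
  have "finite (\<pi> -` {..<n})" using \<pi> by (intro finite_vimageI) (auto simp: bij_def)
  then obtain m where m: "\<forall>k\<in>\<pi> -` {..<n}. k < m" unfolding finite_nat_set_iff_bounded ..
  have "norm (\<sigma> k * x (\<pi> k) - 0) < \<epsilon>" if "m \<le> k" for k
  proof -
    have "n \<le> \<pi> k" using m that by (metis lessThan_iff not_le vimageI)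
    then show ?thesis using n \<sigma>[of k] by (simp add: abs_mult)
  qed
  then show "\<exists>m. \<forall>k\<ge>m. norm (\<sigma> k * x (\<pi> k) - 0) < \<epsilon>" by blast
qed

text \<open>The summands are lines, so level 0 is the only one and the unit vectors are biorthogonal
  to the coordinates.\<close>

lemma c0_symmetric:
  "symmetric_space c0_space c0_norm c0_norm {0} (\<lambda>k i x. x k) (\<lambda>k i n. if n = k then 1 else 0) 1"
proof
  show "subspace c0_space" by (rule subspace_c0)
  show "norm_on c0_space c0_norm" by (rule norm_c0)
  show "equivalent_norm c0_space c0_norm c0_norm" by (rule equivalent_norm_refl[OF norm_c0])
  show "(\<lambda>n. if n = k then 1 else 0) \<in> c0_space" for k
    unfolding c0_space_def mem_Collect_eq by (rule tendsto_eventually) (auto simp: eventually_sequentially intro!: exI[of _ "Suc k"])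
  show "c0_norm (\<lambda>n. if n = k then 1 else 0) \<le> 1" for k by (rule c0_least) simp
  show "(0::nat) \<in> {0}" by simp
  fix x assume x: "x \<in> c0_space"
  show "\<bar>x k\<bar> \<le> c0_norm x" for k by (rule c0_le[OF x])
  have lim: "x \<longlonglongrightarrow> 0" using x by (simp add: c0_space_def)
  fix \<epsilon> :: real assume \<epsilon>: "0 < \<epsilon>"
  show "finite {(k, i). i \<in> {0::nat} \<and> \<epsilon> \<le> \<bar>x k\<bar>}"
  proof -
    obtain n where n: "\<forall>k\<ge>n. \<bar>x k\<bar> < \<epsilon>" using finite_ge_null_sequence[OF lim \<epsilon>] by blast
    then have "{(k, i). i \<in> {0::nat} \<and> \<epsilon> \<le> \<bar>x k\<bar>} \<subseteq> {..<n} \<times> {0}" by (auto simp: not_le[symmetric])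
    then show ?thesis by (rule finite_subset) simp
  qed
  obtain n where n: "\<forall>k\<ge>n. \<bar>x k\<bar> < \<epsilon> / 2" using finite_ge_null_sequence[OF lim, of "\<epsilon> / 2"] \<epsilon> by auto
  let ?t = "\<lambda>k. if k < n then 0 else x k"
  have "c0_norm ?t \<le> \<epsilon> / 2" using n \<epsilon> by (intro c0_least) (simp add: less_imp_le)
  moreover have "?t \<longlonglongrightarrow> 0"
    by (rule Lim_transform_eventually[OF lim]) (auto simp: eventually_sequentially intro!: exI[of _ n])
  ultimately show "\<exists>n. \<exists>x'\<in>c0_space. (\<forall>k. \<forall>i\<in>{0::nat}. x' k = (if k < n then 0 else x k)) \<and> c0_norm x' < \<epsilon>"
    using \<epsilon> by (intro exI[of _ n] bexI[of _ ?t]) (auto simp: c0_space_def)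
next
  fix \<pi> :: "nat \<Rightarrow> nat" and \<sigma> :: "nat \<Rightarrow> real" and x
  assume \<pi>: "bij \<pi>" and \<sigma>: "\<And>k. \<bar>\<sigma> k\<bar> = 1" and x: "x \<in> c0_space"
  let ?y = "\<lambda>k. \<sigma> k * x (\<pi> k)"
  have y: "?y \<in> c0_space" by (rule c0_perm[OF x \<pi> \<sigma>])
  have "c0_norm ?y \<le> c0_norm x" using c0_le[OF x] \<sigma> by (intro c0_least) (simp add: abs_mult)
  moreover have "c0_norm x \<le> c0_norm ?y"
  proof (rule c0_least)
    fix k
    obtain l where "k = \<pi> l" using \<pi> by (metis bij_pointE)
    then show "\<bar>x k\<bar> \<le> c0_norm ?y" using c0_le[OF y, of l] \<sigma> by (simp add: abs_mult)
  qed
  ultimately show "\<exists>y\<in>c0_space. (\<forall>k. \<forall>i\<in>{0::nat}. y k = \<sigma> k * x (\<pi> k)) \<and> c0_norm y = c0_norm x"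
    using y by (intro bexI[of _ ?y]) auto
qed (auto simp: plus_fun_def scaleR_fun_def fun_eq_iff)

section \<open>Sequences summable to the power p\<close>

lemma bij_suminf:
  fixes f :: "nat \<Rightarrow> real"
  assumes "bij \<pi>" "\<And>n. 0 \<le> f n" "summable f"
  shows "summable (\<lambda>k. f (\<pi> k))" "(\<Sum>k. f (\<pi> k)) = (\<Sum>k. f k)"
proof -
  have inj: "inj \<pi>" and surj: "range \<pi> = UNIV" using assms(1) by (auto simp: bij_def)
  show "summable (\<lambda>k. f (\<pi> k))" using summable_reindex[OF assms(3) inj assms(2)] by (simp add: o_def)
  show "(\<Sum>k. f (\<pi> k)) = (\<Sum>k. f k)" using suminf_reindex[OF assms(3) inj assms(2)] surj by (simp add: o_def)
qed

lemma lp_summable: "x \<in> lp_space p \<Longrightarrow> summable (\<lambda>n. \<bar>x n\<bar> powr p)"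
  by (simp add: lp_space_def)

lemma subspace_lp: assumes p: "1 \<le> p" shows "subspace (lp_space p)"
  unfolding subspace_def
proof (intro conjI ballI allI)
  show "0 \<in> lp_space p" using p by (simp add: lp_space_def zero_fun_def)
  fix x assume x: "x \<in> lp_space p"
  show "c *\<^sub>R x \<in> lp_space p" for c
    using summable_mult[OF lp_summable[OF x], of "\<bar>c\<bar> powr p"]
    by (simp add: lp_space_def scaleR_fun_def abs_mult powr_mult)
  fix y assume y: "y \<in> lp_space p"
  have s: "summable (\<lambda>n. 2 powr p * (\<bar>x n\<bar> powr p + \<bar>y n\<bar> powr p))"
    by (intro summable_mult summable_add lp_summable x y)
  have "summable (\<lambda>n. \<bar>(x + y) n\<bar> powr p)"
  proof (rule summable_comparison_test'[OF s, of 0])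
    fix n
    show "norm (\<bar>(x + y) n\<bar> powr p) \<le> 2 powr p * (\<bar>x n\<bar> powr p + \<bar>y n\<bar> powr p)"
      using abs_powr_add[OF p, of "x n" "y n"] by (simp add: plus_fun_def)
  qed
  then show "x + y \<in> lp_space p" by (simp add: lp_space_def)
qed

lemma norm_lp: assumes p: "1 \<le> p" shows "norm_on (lp_space p) (lp_norm p)"
proof -
  let ?\<rho> = "\<lambda>x. \<Sum>n. \<bar>x n\<bar> powr p"
  have "norm_on (lp_space p) (\<lambda>x. ?\<rho> x powr (1 / p))"
  proof (rule modular_norm[OF subspace_lp[OF p] p])
    fix x assume x: "x \<in> lp_space p"
    note s = lp_summable[OF x]
    show "0 \<le> ?\<rho> x" by (intro suminf_nonneg s) auto
    show "?\<rho> x = 0 \<longleftrightarrow> x = 0"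
      using suminf_eq_zero_iff[OF s] p by (auto simp: fun_eq_iff zero_fun_def)
    show "?\<rho> (c *\<^sub>R x) = \<bar>c\<bar> powr p * ?\<rho> x" for c
      using suminf_mult[OF s, of "\<bar>c\<bar> powr p"] by (simp add: scaleR_fun_def abs_mult powr_mult)
    fix y t assume y: "y \<in> lp_space p" and t: "0 \<le> t" "t \<le> (1::real)"
    have s2: "summable (\<lambda>n. (1 - t) * \<bar>x n\<bar> powr p + t * \<bar>y n\<bar> powr p)"
      by (intro summable_add summable_mult lp_summable x y)
    have "(1 - t) *\<^sub>R x + t *\<^sub>R y \<in> lp_space p"
      using subspace_lp[OF p] x y by (intro subspace_add subspace_scale)
    then have "?\<rho> ((1 - t) *\<^sub>R x + t *\<^sub>R y) \<le> (\<Sum>n. (1 - t) * \<bar>x n\<bar> powr p + t * \<bar>y n\<bar> powr p)"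
      using abs_powr_convex[OF p t] s2
      by (intro suminf_le lp_summable) (simp_all add: plus_fun_def scaleR_fun_def)
    also have "\<dots> = (1 - t) * ?\<rho> x + t * ?\<rho> y"
      using lp_summable[OF x] lp_summable[OF y] by (simp add: suminf_add[symmetric] suminf_mult summable_mult)
    finally show "?\<rho> ((1 - t) *\<^sub>R x + t *\<^sub>R y) \<le> (1 - t) * ?\<rho> x + t * ?\<rho> y" .
  qed
  then show ?thesis by (simp add: lp_norm_def[abs_def])
qed

lemma lp_coord_le: assumes p: "1 \<le> p" and x: "x \<in> lp_space p" shows "\<bar>x k\<bar> \<le> lp_norm p x"
proof -
  have "\<bar>x k\<bar> = (\<bar>x k\<bar> powr p) powr (1 / p)" using p by (simp add: powr_powr)
  also have "\<bar>x k\<bar> powr p = (\<Sum>n\<in>{k}. \<bar>x n\<bar> powr p)" by simp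
  also have "\<dots> powr (1 / p) \<le> lp_norm p x"
    unfolding lp_norm_def using p by (intro powr_mono2 sum_le_suminf lp_summable[OF x]) auto
  finally show ?thesis .
qed

lemma lp_null: assumes p: "1 \<le> p" and x: "x \<in> lp_space p" shows "x \<longlonglongrightarrow> 0"
proof -
  have "(\<lambda>n. (\<bar>x n\<bar> powr p) powr (1 / p)) \<longlonglongrightarrow> 0 powr (1 / p)"
    using p by (intro tendsto_powr2 summable_LIMSEQ_zero[OF lp_summable[OF x]] tendsto_const) auto
  then show ?thesis using p by (simp add: powr_powr tendsto_rabs_zero_iff)
qed

lemma lp_perm:
  assumes p: "1 \<le> p" and x: "x \<in> lp_space p" and \<pi>: "bij \<pi>" and \<sigma>: "\<And>k::nat. \<bar>\<sigma> k\<bar> = 1"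
  shows "(\<lambda>k. \<sigma> k * x (\<pi> k)) \<in> lp_space p" "lp_norm p (\<lambda>k. \<sigma> k * x (\<pi> k)) = lp_norm p x"
  using bij_suminf[OF \<pi> _ lp_summable[OF x]] \<sigma> by (simp_all add: lp_space_def lp_norm_def abs_mult)

lemma lp_tail:
  assumes p: "1 \<le> p" and x: "x \<in> lp_space p" and \<epsilon>: "0 < \<epsilon>"
  obtains n where "(\<lambda>k. if k < n then 0 else x k) \<in> lp_space p" "lp_norm p (\<lambda>k. if k < n then 0 else x k) < \<epsilon>"
proof -
  note s = lp_summable[OF x]
  obtain n where n: "norm (\<Sum>i. \<bar>x (i + n)\<bar> powr p) < \<epsilon> powr p"
    using suminf_exist_split[OF _ s, of "\<epsilon> powr p"] \<epsilon> by auto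
  let ?t = "\<lambda>k. if k < n then 0 else x k"
  have st: "summable (\<lambda>k. \<bar>?t k\<bar> powr p)"
    by (rule summable_comparison_test'[OF s, of 0]) simp
  have "(\<Sum>k. \<bar>?t k\<bar> powr p) = (\<Sum>i. \<bar>?t (i + n)\<bar> powr p) + (\<Sum>k<n. \<bar>?t k\<bar> powr p)"
    by (rule suminf_split_initial_segment[OF st])
  also have "\<dots> = (\<Sum>i. \<bar>x (i + n)\<bar> powr p)" using p by simp
  also have "\<dots> < \<epsilon> powr p" using n by simp
  finally have lt: "(\<Sum>k. \<bar>?t k\<bar> powr p) < \<epsilon> powr p" .
  have "lp_norm p ?t < (\<epsilon> powr p) powr (1 / p)"
    unfolding lp_norm_def using p by (intro powr_less_mono2 lt suminf_nonneg st) auto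
  then have "lp_norm p ?t < \<epsilon>" using p \<epsilon> by (simp add: powr_powr)
  then show ?thesis using st that[of n] by (simp add: lp_space_def)
qed

lemma lp_symmetric:
  assumes p: "1 \<le> p"
  shows "symmetric_space (lp_space p) (lp_norm p) (lp_norm p) {0} (\<lambda>k i x. x k) (\<lambda>k i n. if n = k then 1 else 0) 1"
proof
  show "subspace (lp_space p)" by (rule subspace_lp[OF p])
  show "norm_on (lp_space p) (lp_norm p)" by (rule norm_lp[OF p])
  show "equivalent_norm (lp_space p) (lp_norm p) (lp_norm p)" by (rule equivalent_norm_refl[OF norm_lp[OF p]])
  have e: "(\<lambda>n. \<bar>if n = k then 1 else 0\<bar> powr p) = (\<lambda>n. if n = k then 1 else (0::real))" for k :: nat
    using p by auto
  show "(\<lambda>n. if n = k then 1 else 0) \<in> lp_space p" for k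
    unfolding lp_space_def mem_Collect_eq e by (rule summable_single)
  have "(\<Sum>n. if n = k then 1 else (0::real)) = 1" for k :: nat using sums_single[of k "\<lambda>_. 1::real"] by (simp add: sums_iff)
  then show "lp_norm p (\<lambda>n. if n = k then 1 else 0) \<le> 1" for k
    unfolding lp_norm_def e by simp
  show "(0::nat) \<in> {0}" by simp
  fix x assume x: "x \<in> lp_space p"
  show "\<bar>x k\<bar> \<le> lp_norm p x" for k by (rule lp_coord_le[OF p x])
  fix \<epsilon> :: real assume \<epsilon>: "0 < \<epsilon>"
  show "finite {(k, i). i \<in> {0::nat} \<and> \<epsilon> \<le> \<bar>x k\<bar>}"
  proof -
    obtain n where n: "\<forall>k\<ge>n. \<bar>x k\<bar> < \<epsilon>" using finite_ge_null_sequence[OF lp_null[OF p x] \<epsilon>] by blast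
    then have "{(k, i). i \<in> {0::nat} \<and> \<epsilon> \<le> \<bar>x k\<bar>} \<subseteq> {..<n} \<times> {0}" by (auto simp: not_le[symmetric])
    then show ?thesis by (rule finite_subset) simp
  qed
  obtain n where n: "(\<lambda>k. if k < n then 0 else x k) \<in> lp_space p" "lp_norm p (\<lambda>k. if k < n then 0 else x k) < \<epsilon>"
    using lp_tail[OF p x \<epsilon>] by blast
  then show "\<exists>n. \<exists>x'\<in>lp_space p. (\<forall>k. \<forall>i\<in>{0::nat}. x' k = (if k < n then 0 else x k)) \<and> lp_norm p x' < \<epsilon>"
    by (intro exI[of _ n] bexI[OF _ n(1)]) simp
next
  fix \<pi> :: "nat \<Rightarrow> nat" and \<sigma> :: "nat \<Rightarrow> real" and x
  assume \<pi>: "bij \<pi>" and \<sigma>: "\<And>k. \<bar>\<sigma> k\<bar> = 1" and x: "x \<in> lp_space p"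
  show "\<exists>y\<in>lp_space p. (\<forall>k. \<forall>i\<in>{0::nat}. y k = \<sigma> k * x (\<pi> k)) \<and> lp_norm p y = lp_norm p x"
    using lp_perm[OF p x \<pi> \<sigma>] by (intro bexI[of _ "\<lambda>k. \<sigma> k * x (\<pi> k)"]) auto
qed (auto simp: plus_fun_def scaleR_fun_def fun_eq_iff)

section \<open>Continuous functions\<close>

definition dseq :: "nat \<Rightarrow> real" where
  "dseq = from_nat_into (\<rat> \<inter> {0<..<1})"

lemma dseq_range: "range dseq = \<rat> \<inter> {0<..<1}" and dseq_inj: "inj dseq"
proof -
  let ?Q = "\<rat> \<inter> {0<..<1::real}"
  have c: "countable ?Q" using countable_rat by blast
  have ne: "?Q \<noteq> {}" using Rats_dense_in_real[of 0 1] by auto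
  have "infinite ?Q"
  proof
    assume fin: "finite ?Q"
    obtain q where "q \<in> \<rat>" "0 < q" "q < Min ?Q"
      using Rats_dense_in_real[of 0 "Min ?Q"] Min_in[OF fin ne] by auto
    then show False using Min_le[OF fin, of q] Min_in[OF fin ne] by auto
  qed
  then have "bij_betw dseq UNIV ?Q" unfolding dseq_def by (rule bij_betw_from_nat_into[OF c])
  then show "range dseq = ?Q" "inj dseq" by (auto simp: bij_betw_def)
qed

lemma dseq: "0 < dseq j" "dseq j < 1"
proof -
  have "dseq j \<in> \<rat> \<inter> {0<..<1}" using dseq_range by blast
  then show "0 < dseq j" "dseq j < 1" by auto
qed

lemma closure_dseq: "{0..1} \<subseteq> closure (range dseq)"
proof -
  have "{0<..<1::real} \<subseteq> closure ({0<..<1} \<inter> \<rat>)"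
    using open_Int_closure_subset[of "{0<..<1::real}" \<rat>] Rats_closure_real by auto
  then have "closure {0<..<1::real} \<subseteq> closure ({0<..<1} \<inter> \<rat>)"
    by (metis closure_mono closure_closure)
  then show ?thesis by (simp add: dseq_range Int_commute)
qed

text \<open>The largest half-width for which the tent at \<open>dseq j\<close> vanishes at all
  earlier points and outside the open unit interval.\<close>

definition gap :: "nat \<Rightarrow> real" where
  "gap j = Min ({dseq j, 1 - dseq j} \<union> (\<lambda>i. \<bar>dseq j - dseq i\<bar>) ` {..<j})"

lemma gap: "0 < gap j" "gap j \<le> dseq j" "gap j \<le> 1 - dseq j" "i < j \<Longrightarrow> gap j \<le> \<bar>dseq j - dseq i\<bar>"
proof -
  let ?A = "{dseq j, 1 - dseq j} \<union> (\<lambda>i. \<bar>dseq j - dseq i\<bar>) ` {..<j}"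
  have "gap j \<in> ?A" unfolding gap_def by (rule Min_in) auto
  then show "0 < gap j" using dseq[of j] dseq_inj by (auto simp: inj_eq)
  show "gap j \<le> dseq j" "gap j \<le> 1 - dseq j" "i < j \<Longrightarrow> gap j \<le> \<bar>dseq j - dseq i\<bar>"
    unfolding gap_def by (rule Min_le; auto)+
qed

definition bump :: "nat \<Rightarrow> real \<Rightarrow> real" where
  "bump j u = max 0 (1 - \<bar>u - dseq j\<bar> / gap j)"

lemma bump_outside: "u \<notin> {0<..<1} \<Longrightarrow> bump j u = 0"
  using gap[of j] by (auto simp: bump_def max_def field_simps)

lemma bump_diag: "bump j (dseq j) = 1"
  by (simp add: bump_def)

lemma bump_lower: assumes "i < j" shows "bump j (dseq i) = 0"
  using gap(1)[of j] gap(4)[OF assms] by (simp add: bump_def max_def abs_minus_commute)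

lemma bump_continuous: "continuous_on UNIV (bump j)"
  unfolding bump_def using gap(1)[of j] by (intro continuous_intros) auto

definition dy :: "nat \<Rightarrow> real" where "dy k = (1 / 2) ^ k"

lemma dy: "0 < dy k" "dy k \<le> 1" "dy (Suc k) = dy k / 2" "dy 0 = 1"
  by (auto simp: dy_def power_le_one)

lemma dy_mono: "k \<le> l \<Longrightarrow> dy l \<le> dy k"
  unfolding dy_def by (rule power_decreasing) auto

lemma dy_null: "0 < \<epsilon> \<Longrightarrow> \<exists>n. \<forall>k\<ge>n. dy k < \<epsilon>"
proof -
  assume "0 < \<epsilon>"
  then obtain n where "dy n < \<epsilon>" using real_arch_pow_inv[of \<epsilon> "1/2"] by (auto simp: dy_def)
  then show ?thesis using dy_mono by (meson le_less_trans)
qed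

lemma dyadic_interval:
  assumes "0 < t" "t \<le> 1" shows "\<exists>k. dy (Suc k) < t \<and> t \<le> dy k"
proof -
  obtain n where n: "\<forall>k\<ge>n. dy k < t" using dy_null[OF assms(1)] by blast
  define m where "m = (LEAST k. dy k < t)"
  have m: "dy m < t" unfolding m_def by (rule LeastI_ex) (use n in blast)
  have "m \<noteq> 0" using m assms dy(4) by (metis not_le)
  then obtain k where k: "m = Suc k" using not0_implies_Suc by blast
  have "\<not> dy k < t" using not_less_Least[of k "\<lambda>k. dy k < t"] k unfolding m_def by simp
  then show ?thesis using m k by auto
qed

lemma convex_abs_le:
  fixes a b u m :: real
  assumes "0 \<le> u" "u \<le> 1" "\<bar>a\<bar> \<le> m" "\<bar>b\<bar> \<le> m"
  shows "\<bar>(1 - u) * a + u * b\<bar> \<le> m"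
proof -
  have "\<bar>(1 - u) * a\<bar> \<le> (1 - u) * m" "\<bar>u * b\<bar> \<le> u * m"
    using assms by (simp_all add: abs_mult mult_left_mono)
  then show ?thesis using abs_triangle_ineq[of "(1 - u) * a" "u * b"] by (simp add: algebra_simps)
qed

text \<open>The interval from \<open>dy (Suc k)\<close> to \<open>dy k\<close> has length
  \<open>dy (Suc k)\<close>, hence the parameter u with t = dy (Suc k) * (1 + u).\<close>

definition seg :: "(real \<Rightarrow> real) \<Rightarrow> nat \<Rightarrow> real \<Rightarrow> real" where
  "seg f k u = f (dy (Suc k) * (1 + u)) - ((1 - u) * f (dy (Suc k)) + u * f (dy k))"

text \<open>These coordinates identify \<open>C([0,1])\<close> with the \<open>c\<^sub>0\<close>-sum of countably many copies of
  \<open>\<real> \<oplus> C\<^sub>0(0,1)\<close>: a function is recovered from \<open>f 0\<close>, the increments \<open>f (dy k) - f 0\<close> and, on each dyadic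
  interval, its difference to the linear interpolation.\<close>

definition \<theta>C :: "nat \<Rightarrow> nat \<Rightarrow> (real \<Rightarrow> real) \<Rightarrow> real" where
  "\<theta>C k i f = (case i of 0 \<Rightarrow> (case k of 0 \<Rightarrow> f 0 | Suc k' \<Rightarrow> f (dy k') - f 0) | Suc j \<Rightarrow> seg f k (dseq j))"

text \<open>Permuting the summands does not preserve the sup norm of functions, but it preserves
  this supremum over coordinates.\<close>

definition NC :: "(real \<Rightarrow> real) \<Rightarrow> real" where
  "NC f = (SUP r\<in>UNIV. \<bar>\<theta>C (fst r) (snd r) f\<bar>)"

lemma C01_bdd: "f \<in> C01_space \<Longrightarrow> bdd_above ((\<lambda>t. \<bar>f t\<bar>) ` {0..1})"
  unfolding C01_space_def
  by (intro bounded_imp_bdd_above compact_imp_bounded compact_continuous_image continuous_intros) auto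

lemma C01_le: "f \<in> C01_space \<Longrightarrow> \<bar>f t\<bar> \<le> C01_norm f"
proof -
  assume f: "f \<in> C01_space"
  have u: "\<bar>f s\<bar> \<le> C01_norm f" if "s \<in> {0..1}" for s
    unfolding C01_norm_def using that by (rule cSUP_upper[OF _ C01_bdd[OF f]])
  show ?thesis
  proof (cases "t \<in> {0..1}")
    case False
    then have "f t = 0" using f by (simp add: C01_space_def)
    then show ?thesis using u[of 0] by simp
  qed (rule u)
qed

lemma C01_least: "(\<And>t. 0 \<le> t \<Longrightarrow> t \<le> 1 \<Longrightarrow> \<bar>f t\<bar> \<le> c) \<Longrightarrow> C01_norm f \<le> c"
  unfolding C01_norm_def by (intro cSUP_least) auto

lemma subspace_C01: "subspace C01_space"
  unfolding subspace_def C01_space_def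
  by (auto simp: plus_fun_def zero_fun_def scaleR_fun_def intro!: continuous_intros)

lemma norm_C01: "norm_on C01_space C01_norm"
  unfolding C01_norm_def[abs_def]
proof (rule norm_on_SUP[where B = C01_norm, OF subspace_C01])
  fix x :: "real \<Rightarrow> real" assume "x \<in> C01_space" "\<And>t. t \<in> {0..1} \<Longrightarrow> x t = 0"
  then have "x t = 0" for t by (cases "t \<in> {0..1}") (auto simp: C01_space_def)
  then show "x = 0" by (simp add: fun_eq_iff zero_fun_def)
qed (auto simp: C01_le plus_fun_def scaleR_fun_def)

lemma \<theta>C_add: "\<theta>C k i (f + g) = \<theta>C k i f + \<theta>C k i g"
  by (simp add: \<theta>C_def seg_def plus_fun_def algebra_simps split: nat.split)

lemma \<theta>C_scale: "\<theta>C k i (a *\<^sub>R f) = a * \<theta>C k i f"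
  by (simp add: \<theta>C_def seg_def scaleR_fun_def algebra_simps split: nat.split)

lemma seg_le: assumes f: "f \<in> C01_space" and u: "0 \<le> u" "u \<le> 1" shows "\<bar>seg f k u\<bar> \<le> 2 * C01_norm f"
proof -
  have "\<bar>(1 - u) * f (dy (Suc k)) + u * f (dy k)\<bar> \<le> C01_norm f"
    using u by (intro convex_abs_le C01_le[OF f])
  then show ?thesis
    using C01_le[OF f, of "dy (Suc k) * (1 + u)"] unfolding seg_def by linarith
qed

lemma \<theta>C_le: assumes f: "f \<in> C01_space" shows "\<bar>\<theta>C k i f\<bar> \<le> 2 * C01_norm f"
proof (cases i)
  case 0
  show ?thesis
  proof (cases k)
    case 0
    then show ?thesis using C01_le[OF f, of 0] \<open>i = 0\<close> by (simp add: \<theta>C_def)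
  next
    case (Suc k')
    then show ?thesis
      using C01_le[OF f, of 0] C01_le[OF f, of "dy k'"] \<open>i = 0\<close> by (simp add: \<theta>C_def)
  qed
next
  case (Suc j)
  then show ?thesis using seg_le[OF f, of "dseq j"] dseq[of j] by (simp add: \<theta>C_def)
qed

lemma \<theta>C_le_NC: assumes "f \<in> C01_space" shows "\<bar>\<theta>C k i f\<bar> \<le> NC f"
proof -
  have "bdd_above (range (\<lambda>r. \<bar>\<theta>C (fst r) (snd r) f\<bar>))"
    using \<theta>C_le[OF assms] by (intro bdd_aboveI2) auto
  from cSUP_upper[OF _ this, of "(k, i)"] show ?thesis by (simp add: NC_def)
qed

lemma NC_least: "(\<And>k i. \<bar>\<theta>C k i f\<bar> \<le> m) \<Longrightarrow> NC f \<le> m"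
  unfolding NC_def by (intro cSUP_least) auto

lemma dy_arg: "0 \<le> u \<Longrightarrow> u \<le> 1 \<Longrightarrow> 0 \<le> dy (Suc k) * (1 + u) \<and> dy (Suc k) * (1 + u) \<le> dy k"
  using dy(1)[of "Suc k"] dy(3)[of k] mult_left_mono[of "1 + u" 2 "dy (Suc k)"] by auto

lemma continuous_seg: assumes f: "f \<in> C01_space" shows "continuous_on {0..1} (seg f k)"
  unfolding seg_def
proof (intro continuous_intros)
  show "continuous_on {0..1} (\<lambda>u. f (dy (Suc k) * (1 + u)))"
  proof (rule continuous_on_compose2[of "{0..1}" f])
    show "continuous_on {0..1} f" using f by (simp add: C01_space_def)
    show "(\<lambda>u. dy (Suc k) * (1 + u)) ` {0..1} \<subseteq> {0..1}"
      using dy_arg[of _ k] dy(2)[of k] by fastforce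
  qed (intro continuous_intros)
qed

text \<open>The coordinates give the bound at the points \<open>dseq j\<close>; density and
  continuity extend it.\<close>

lemma seg_le_NC: assumes f: "f \<in> C01_space" and u: "0 \<le> u" "u \<le> 1" shows "\<bar>seg f k u\<bar> \<le> NC f"
proof -
  have cl: "closure (range dseq) = {0..1}"
  proof
    show "closure (range dseq) \<subseteq> {0..1}" using dseq by (intro closure_minimal) (auto simp: less_imp_le)
  qed (rule closure_dseq)
  have "continuous_on (closure (range dseq)) (\<lambda>u. \<bar>seg f k u\<bar>)"
    unfolding cl by (intro continuous_intros continuous_seg f)
  moreover have "u \<in> closure (range dseq)" using u cl by simp
  moreover have "\<bar>seg f k v\<bar> \<le> NC f" if "v \<in> range dseq" for v
  proof -
    obtain j where "v = dseq j" using \<open>v \<in> range dseq\<close> by blast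
    then show ?thesis using \<theta>C_le_NC[OF f, of k "Suc j"] by (simp add: \<theta>C_def)
  qed
  ultimately show ?thesis by (rule continuous_le_on_closure)
qed

text \<open>\<open>f t\<close> is the sum of \<open>f 0\<close>, the interpolated increments and
  \<open>seg\<close>, each bounded by \<open>NC f\<close>; hence 3.\<close>

lemma C01_norm_le_NC: assumes f: "f \<in> C01_space" shows "C01_norm f \<le> 3 * NC f"
proof (rule C01_least)
  fix t :: real assume t: "0 \<le> t" "t \<le> 1"
  have 0: "\<bar>f 0\<bar> \<le> NC f" using \<theta>C_le_NC[OF f, of 0 0] by (simp add: \<theta>C_def)
  show "\<bar>f t\<bar> \<le> 3 * NC f"
  proof (cases "t = 0")
    case False
    then obtain k where k: "dy (Suc k) < t" "t \<le> dy k" using dyadic_interval[of t] t by auto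
    define u where "u = t / dy (Suc k) - 1"
    have u: "0 \<le> u" "u \<le> 1" "dy (Suc k) * (1 + u) = t"
      using k dy(1)[of "Suc k"] dy(3)[of k] by (simp_all add: u_def field_simps)
    have n: "\<bar>f (dy l) - f 0\<bar> \<le> NC f" for l using \<theta>C_le_NC[OF f, of "Suc l" 0] by (simp add: \<theta>C_def)
    have "f t = f 0 + ((1 - u) * (f (dy (Suc k)) - f 0) + u * (f (dy k) - f 0)) + seg f k u"
      unfolding seg_def u(3) by (simp add: algebra_simps)
    moreover have "\<bar>(1 - u) * (f (dy (Suc k)) - f 0) + u * (f (dy k) - f 0)\<bar> \<le> NC f"
      using u by (intro convex_abs_le n)
    ultimately show ?thesis using 0 seg_le_NC[OF f u(1,2), of k] by linarith
  qed (use 0 in auto)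
qed

lemma equivalent_NC: "equivalent_norm C01_space C01_norm NC"
proof -
  have "norm_on C01_space NC"
    unfolding NC_def[abs_def]
  proof (rule norm_on_SUP[OF subspace_C01])
    show "\<bar>\<theta>C (fst r) (snd r) x\<bar> \<le> 2 * C01_norm x" if "x \<in> C01_space" for r x by (rule \<theta>C_le[OF that])
    fix x assume x: "x \<in> C01_space" and 0: "\<And>r. r \<in> UNIV \<Longrightarrow> \<theta>C (fst r) (snd r) x = 0"
    have "\<bar>\<theta>C k i x\<bar> \<le> 0" for k i using 0[of "(k, i)"] by simp
    then have "NC x \<le> 0" by (rule NC_least)
    then have "C01_norm x \<le> 0" using C01_norm_le_NC[OF x] by linarith
    then show "x = 0" using norm_C01 x by (metis antisym norm_on_def)
  qed (simp_all add: \<theta>C_add \<theta>C_scale)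
  moreover have "1 / 3 * C01_norm f \<le> NC f \<and> NC f \<le> 2 * C01_norm f" if f: "f \<in> C01_space" for f
    using C01_norm_le_NC[OF f] NC_least[OF \<theta>C_le[OF f]] by simp
  ultimately show ?thesis
    unfolding equivalent_norm_def by (intro conjI exI[of _ "1/3"] exI[of _ 2]) auto
qed

section \<open>Gluing a continuous function from its coordinates\<close>

definition hat :: "nat \<Rightarrow> real \<Rightarrow> real" where
  "hat k t = max 0 (min (t / dy (Suc k) - 1) (2 - t / dy k))"

definition piece :: "(nat \<Rightarrow> real) \<Rightarrow> (nat \<Rightarrow> real \<Rightarrow> real) \<Rightarrow> nat \<Rightarrow> real \<Rightarrow> real" where
  "piece v g k t = v (Suc k) * hat k t + g k (t / dy (Suc k) - 1)"

text \<open>Inverse to the coordinates \<open>\<theta>C\<close>. \<open>hat k\<close> is the tent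
  with peak 1 at \<open>dy k\<close> that vanishes at \<open>dy (Suc k)\<close> and at
  \<open>2 * dy k\<close>; since \<open>v 0\<close> is the value at 0, the increment at
  \<open>dy k\<close> is \<open>v (Suc k)\<close>.\<close>

definition glue :: "(nat \<Rightarrow> real) \<Rightarrow> (nat \<Rightarrow> real \<Rightarrow> real) \<Rightarrow> real \<Rightarrow> real" where
  "glue v g t = (if t \<in> {0..1} then v 0 + (\<Sum>k. piece v g k t) else 0)"

lemma hat_bounds: "0 \<le> hat k t" "hat k t \<le> 1"
proof -
  have "t / dy (Suc k) = 2 * (t / dy k)" by (simp add: dy(3))
  then show "hat k t \<le> 1" unfolding hat_def by linarith
qed (simp add: hat_def)

lemma hat_zero: "t \<le> dy (Suc k) \<or> 2 * dy k \<le> t \<Longrightarrow> hat k t = 0"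
proof -
  assume "t \<le> dy (Suc k) \<or> 2 * dy k \<le> t"
  then have "t / dy (Suc k) - 1 \<le> 0 \<or> 2 - t / dy k \<le> 0"
    using dy(1)[of k] dy(1)[of "Suc k"] by (auto simp: pos_divide_le_eq pos_le_divide_eq)
  then show ?thesis unfolding hat_def by linarith
qed

locale glue_data =
  fixes v :: "nat \<Rightarrow> real" and g :: "nat \<Rightarrow> real \<Rightarrow> real"
  assumes v: "\<And>\<epsilon>. 0 < \<epsilon> \<Longrightarrow> \<exists>n. \<forall>k\<ge>n. \<bar>v k\<bar> \<le> \<epsilon>"
    and g: "\<And>\<epsilon>. 0 < \<epsilon> \<Longrightarrow> \<exists>n. \<forall>k\<ge>n. \<forall>u. \<bar>g k u\<bar> \<le> \<epsilon>"
    and g_cont: "\<And>k. continuous_on UNIV (g k)"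
    and g_out: "\<And>k u. u \<notin> {0<..<1} \<Longrightarrow> g k u = 0"
begin

lemma piece_zero: "t \<le> dy (Suc k) \<or> 2 * dy k \<le> t \<Longrightarrow> piece v g k t = 0"
proof -
  assume t: "t \<le> dy (Suc k) \<or> 2 * dy k \<le> t"
  then have "t / dy (Suc k) - 1 \<le> 0 \<or> 1 \<le> t / dy (Suc k) - 1"
    using dy(1)[of "Suc k"] dy(3)[of k] by (auto simp: pos_divide_le_eq pos_le_divide_eq)
  then have "g k (t / dy (Suc k) - 1) = 0" by (intro g_out) auto
  then show ?thesis using hat_zero[OF t] by (simp add: piece_def)
qed

lemma piece_sum:
  assumes "dy (Suc k) < t" "t \<le> dy k"
  shows "\<And>l. l \<notin> {k, Suc k} \<Longrightarrow> piece v g l t = 0"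
proof -
  fix l assume l: "l \<notin> {k, Suc k}"
  show "piece v g l t = 0"
  proof (cases "l < k")
    case True
    then have "dy k \<le> dy (Suc l)" by (intro dy_mono) simp
    then show ?thesis using assms by (intro piece_zero) linarith
  next
    case False
    then have "dy l \<le> dy (Suc (Suc k))" using l by (intro dy_mono) auto
    then show ?thesis using assms dy(3)[of "Suc k"] by (intro piece_zero) linarith
  qed
qed

lemma glue_at:
  assumes "dy (Suc k) < t" "t \<le> dy k"
  shows "glue v g t = v 0 + piece v g k t + piece v g (Suc k) t"
proof -
  have "(\<Sum>l. piece v g l t) = (\<Sum>l\<in>{k, Suc k}. piece v g l t)"
    by (rule suminf_finite) (use piece_sum[OF assms] in auto)
  moreover have "t \<in> {0..1}" using assms dy(1)[of "Suc k"] dy(2)[of k] by simp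
  ultimately show ?thesis by (simp add: glue_def)
qed

lemma glue_0: "glue v g 0 = v 0"
proof -
  have "piece v g k 0 = 0" for k using dy(1)[of "Suc k"] by (intro piece_zero) simp
  then show ?thesis by (simp add: glue_def)
qed

lemma glue_segment:
  assumes u: "0 < u" "u \<le> 1"
  shows "glue v g (dy (Suc k) * (1 + u)) = v 0 + (1 - u) * v (Suc (Suc k)) + u * v (Suc k) + g k u"
proof -
  let ?t = "dy (Suc k) * (1 + u)"
  have d: "0 < dy (Suc k)" by (rule dy)
  have t: "dy (Suc k) < ?t" "?t \<le> dy k" using u d dy(3)[of k] mult_left_mono[of "1 + u" 2 "dy (Suc k)"] by auto
  have q: "?t / dy (Suc k) = 1 + u" "?t / dy k = (1 + u) / 2" "?t / dy (Suc (Suc k)) = 2 * (1 + u)"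
    using d dy(3)[of k] dy(3)[of "Suc k"] by (simp_all add: field_simps)
  have "hat k ?t = u" unfolding hat_def q using u by (auto simp: min_def max_def field_simps)
  moreover have "hat (Suc k) ?t = 1 - u" unfolding hat_def q using u by (auto simp: min_def max_def field_simps)
  \<comment> \<open>In the parameter of the next interval the point is 1 + 2u, which lies beyond the
    right end.\<close>
  moreover have "g (Suc k) (2 * (1 + u) - 1) = 0" using u by (intro g_out) simp
  ultimately show ?thesis unfolding glue_at[OF t] piece_def q by simp
qed

lemma glue_node: "glue v g (dy k) = v 0 + v (Suc k)"
proof -
  have "dy (Suc k) * (1 + 1) = dy k" using dy(3)[of k] by simp
  then show ?thesis using glue_segment[of 1 k] g_out[of 1 k] by simp
qed

lemma piece_small: assumes \<epsilon>: "0 < \<epsilon>" shows "\<exists>n. \<forall>k\<ge>n. \<forall>t. \<bar>piece v g k t\<bar> \<le> \<epsilon>"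
proof -
  obtain n where n: "\<forall>k\<ge>n. \<bar>v k\<bar> \<le> \<epsilon> / 2" using v[of "\<epsilon> / 2"] \<epsilon> by auto
  obtain m where m: "\<forall>k\<ge>m. \<forall>u. \<bar>g k u\<bar> \<le> \<epsilon> / 2" using g[of "\<epsilon> / 2"] \<epsilon> by auto
  have "\<bar>piece v g k t\<bar> \<le> \<epsilon>" if "max n m \<le> k" for k t
  proof -
    have "\<bar>v (Suc k) * hat k t\<bar> \<le> \<bar>v (Suc k)\<bar> * 1"
      unfolding abs_mult using hat_bounds[of k t] by (intro mult_left_mono) auto
    moreover have "\<bar>v (Suc k)\<bar> \<le> \<epsilon> / 2" "\<bar>g k (t / dy (Suc k) - 1)\<bar> \<le> \<epsilon> / 2" using n m that by auto
    ultimately show ?thesis unfolding piece_def by linarith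
  qed
  then show ?thesis by blast
qed

text \<open>The sup norms of the pieces need not be summable. Convergence is uniform because at most
  two pieces are nonzero at each point, and the late ones are small.\<close>

lemma glue_in: "glue v g \<in> C01_space"
proof -
  have "uniform_limit {0..1} (\<lambda>n t. v 0 + (\<Sum>k<n. piece v g k t)) (glue v g) sequentially"
  proof (rule uniform_limitI)
    fix \<epsilon> :: real assume \<epsilon>: "0 < \<epsilon>"
    obtain n0 where n0: "\<forall>k\<ge>n0. \<forall>t. \<bar>piece v g k t\<bar> \<le> \<epsilon> / 3" using piece_small[of "\<epsilon> / 3"] \<epsilon> by auto
    have "dist (v 0 + (\<Sum>k<n. piece v g k t)) (glue v g t) < \<epsilon>" if n: "n0 \<le> n" and t: "t \<in> {0..1}" for n t
    proof (cases "t = 0")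
      case True
      have "piece v g k 0 = 0" for k using dy(1)[of "Suc k"] by (intro piece_zero) simp
      then show ?thesis using glue_0 True \<epsilon> by simp
    next
      case False
      then obtain k where k: "dy (Suc k) < t" "t \<le> dy k" using dyadic_interval[of t] t by auto
      have "(\<Sum>l<n. piece v g l t) = (\<Sum>l\<in>{..<n} \<inter> {k, Suc k}. piece v g l t)"
        using piece_sum[OF k] by (intro sum.mono_neutral_right) auto
      also have "\<dots> = (if k < n then piece v g k t else 0) + (if Suc k < n then piece v g (Suc k) t else 0)"
      proof -
        have "{..<n} \<inter> {k, Suc k} = (if Suc k < n then {k, Suc k} else if k < n then {k} else {})" by auto
        then show ?thesis by auto
      qed
      finally have s: "(\<Sum>l<n. piece v g l t) = \<dots>" .
      have small: "\<bar>piece v g l t\<bar> \<le> \<epsilon> / 3" if "\<not> l < n" for l using n0 n that by auto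
      show ?thesis
        unfolding s glue_at[OF k] dist_real_def
        using small[of k] small[of "Suc k"] \<epsilon> by (auto split: if_splits)
    qed
    then show "\<forall>\<^sub>F n in sequentially. \<forall>t\<in>{0..1}. dist (v 0 + (\<Sum>k<n. piece v g k t)) (glue v g t) < \<epsilon>"
      unfolding eventually_sequentially by blast
  qed
  moreover have "continuous_on {0..1} (\<lambda>t. v 0 + (\<Sum>k<n. piece v g k t))" for n
  proof -
    have "continuous_on {0..1} (piece v g k)" for k
      unfolding piece_def hat_def using dy(1)[of k] dy(1)[of "Suc k"]
      by (intro continuous_intros continuous_on_compose2[OF g_cont]) auto
    then show ?thesis by (intro continuous_intros)
  qed
  ultimately have "continuous_on {0..1} (glue v g)"
    by (intro uniform_limit_theorem[where F = sequentially]) auto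
  then show ?thesis by (simp add: C01_space_def glue_def)
qed

lemma \<theta>C_glue: "\<theta>C k 0 (glue v g) = v k" "\<theta>C k (Suc j) (glue v g) = g k (dseq j)"
proof -
  show "\<theta>C k 0 (glue v g) = v k" by (simp add: \<theta>C_def glue_0 glue_node split: nat.split)
  have "seg (glue v g) k u = g k u" if "0 < u" "u \<le> 1" for u
    unfolding seg_def glue_segment[OF that] glue_node by (simp add: algebra_simps)
  then show "\<theta>C k (Suc j) (glue v g) = g k (dseq j)" using dseq[of j] by (simp add: \<theta>C_def)
qed

end

definition cC :: "nat \<Rightarrow> nat \<Rightarrow> real" where
  "cC i j = (case i of 0 \<Rightarrow> (case j of 0 \<Rightarrow> 1 | Suc _ \<Rightarrow> 0) | Suc i' \<Rightarrow> (case j of 0 \<Rightarrow> 0 | Suc j' \<Rightarrow> bump j' (dseq i')))"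

text \<open>On the unit interval: the constant 1 or the tent \<open>hat (k - 1)\<close> if
  \<open>i = 0\<close>, and a bump inside the k-th dyadic interval otherwise.\<close>

definition zC :: "nat \<Rightarrow> nat \<Rightarrow> real \<Rightarrow> real" where
  "zC k i = glue (\<lambda>l. if l = k \<and> i = 0 then 1 else 0) (\<lambda>l u. if l = k \<and> i \<noteq> 0 then bump (i - 1) u else 0)"

lemma zC_data: "glue_data (\<lambda>l. if l = k \<and> i = 0 then 1 else 0) (\<lambda>l u. if l = k \<and> i \<noteq> 0 then bump (i - 1) u else 0)"
proof
  fix \<epsilon> :: real assume "0 < \<epsilon>"
  then show "\<exists>n. \<forall>l\<ge>n. \<bar>if l = k \<and> i = 0 then 1 else 0\<bar> \<le> \<epsilon>"
    "\<exists>n. \<forall>l\<ge>n. \<forall>u. \<bar>if l = k \<and> i \<noteq> 0 then bump (i - 1) u else 0\<bar> \<le> \<epsilon>"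
    by (intro exI[of _ "Suc k"]; simp)+
next
  show "continuous_on UNIV (\<lambda>u. if l = k \<and> i \<noteq> 0 then bump (i - 1) u else 0)" for l
    by (cases "l = k \<and> i \<noteq> 0") (auto intro: bump_continuous)
qed (auto simp: bump_outside)

lemma \<theta>C_zC: "\<theta>C l j (zC k i) = (if l = k then cC j i else 0)"
proof -
  interpret gd: glue_data "\<lambda>l. if l = k \<and> i = 0 then 1 else 0" "\<lambda>l u. if l = k \<and> i \<noteq> 0 then bump (i - 1) u else 0"
    by (rule zC_data)
  have "\<theta>C l j (zC k i) = (case j of 0 \<Rightarrow> if l = k \<and> i = 0 then 1 else 0
      | Suc j' \<Rightarrow> if l = k \<and> i \<noteq> 0 then bump (i - 1) (dseq j') else 0)"
    unfolding zC_def by (cases j) (simp_all only: gd.\<theta>C_glue nat.case)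
  then show ?thesis by (auto simp: cC_def split: nat.splits)
qed

text \<open>The dyadic intervals shrink to 0, where \<open>f\<close> is continuous.\<close>

lemma C01_null:
  assumes f: "f \<in> C01_space" and \<epsilon>: "0 < \<epsilon>"
  shows "\<exists>n. \<forall>k\<ge>n. \<bar>\<theta>C k 0 f\<bar> \<le> \<epsilon> \<and> (\<forall>u\<in>{0..1}. \<bar>seg f k u\<bar> \<le> \<epsilon>)"
proof -
  have "continuous_on {0..1} f" using f by (simp add: C01_space_def)
  then obtain d where d: "0 < d" "\<And>t. t \<in> {0..1} \<Longrightarrow> dist t 0 < d \<Longrightarrow> dist (f t) (f 0) < \<epsilon> / 2"
    unfolding continuous_on_iff using \<epsilon> by (metis atLeastAtMost_iff half_gt_zero order_refl zero_le_one)
  obtain n where n: "\<forall>k\<ge>n. dy k < d" using dy_null[OF d(1)] by blast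
  have near: "\<bar>f t - f 0\<bar> \<le> \<epsilon> / 2" if "n \<le> k" "0 \<le> t" "t \<le> dy k" for k t
    using d(2)[of t] n that dy(2)[of k] by (force simp: dist_real_def)
  have seg: "\<bar>seg f k u\<bar> \<le> \<epsilon>" if k: "n \<le> k" and u: "u \<in> {0..1}" for k u
  proof -
    have "\<bar>f (dy (Suc k) * (1 + u)) - f 0\<bar> \<le> \<epsilon> / 2" using u dy_arg[of u k] by (intro near[OF k]) auto
    moreover have ends: "\<bar>f (dy (Suc k)) - f 0\<bar> \<le> \<epsilon> / 2" "\<bar>f (dy k) - f 0\<bar> \<le> \<epsilon> / 2"
      using dy(1)[of k] dy(3)[of k] by (intro near[OF k]; simp)+
    have "\<bar>(1 - u) * (f (dy (Suc k)) - f 0) + u * (f (dy k) - f 0)\<bar> \<le> \<epsilon> / 2"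
      using u by (intro convex_abs_le ends) auto
    moreover have "seg f k u = (f (dy (Suc k) * (1 + u)) - f 0) - ((1 - u) * (f (dy (Suc k)) - f 0) + u * (f (dy k) - f 0))"
      by (simp add: seg_def algebra_simps)
    ultimately show ?thesis by linarith
  qed
  have "\<bar>\<theta>C k 0 f\<bar> \<le> \<epsilon>" if k: "Suc n \<le> k" for k
  proof -
    obtain k' where k': "k = Suc k'" "n \<le> k'" using k by (cases k) auto
    have "\<bar>f (dy k') - f 0\<bar> \<le> \<epsilon> / 2" using dy(1)[of k'] by (intro near[OF k'(2)]) auto
    then show ?thesis using \<epsilon> k' by (simp add: \<theta>C_def)
  qed
  then show ?thesis using seg by (intro exI[of _ "Suc n"]) auto
qed

text \<open>Bounding \<sigma> by 1 covers the signed permutations and, with values 0 and 1, the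
  truncations to a tail.\<close>

lemma C01_multiplier:
  assumes x: "x \<in> C01_space" and \<pi>: "bij \<pi>" and \<sigma>: "\<And>k::nat. \<bar>\<sigma> k\<bar> \<le> 1"
  shows "\<exists>y\<in>C01_space. \<forall>k i. \<theta>C k i y = \<sigma> k * \<theta>C (\<pi> k) i x"
proof -
  let ?v = "\<lambda>k. \<sigma> k * \<theta>C (\<pi> k) 0 x"
  let ?g = "\<lambda>k u. if u \<in> {0..1} then \<sigma> k * seg x (\<pi> k) u else 0"
  \<comment> \<open>Subtracting the interpolation makes both end values vanish, so the extension by
    zero is continuous.\<close>
  have ends: "seg x k 0 = 0" "seg x k 1 = 0" for k
    using dy(3)[of k] by (simp_all add: seg_def)
  interpret gd: glue_data ?v ?g
  proof
    fix \<epsilon> :: real assume \<epsilon>: "0 < \<epsilon>"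
    obtain n where n: "\<forall>k\<ge>n. \<bar>\<theta>C k 0 x\<bar> \<le> \<epsilon> \<and> (\<forall>u\<in>{0..1}. \<bar>seg x k u\<bar> \<le> \<epsilon>)" using C01_null[OF x \<epsilon>] by blast
    have "finite (\<pi> -` {..<n})" using \<pi> by (intro finite_vimageI) (auto simp: bij_def)
    then obtain m where m: "\<forall>k\<in>\<pi> -` {..<n}. k < m" unfolding finite_nat_set_iff_bounded ..
    have \<pi>n: "n \<le> \<pi> k" if "m \<le> k" for k using m that by (metis lessThan_iff not_le vimageI)
    have le: "\<bar>\<sigma> k * a\<bar> \<le> \<epsilon>" if "\<bar>a\<bar> \<le> \<epsilon>" for k a
      using mult_mono[OF \<sigma> that] by (simp add: abs_mult)
    show "\<exists>n. \<forall>k\<ge>n. \<bar>?v k\<bar> \<le> \<epsilon>" using n \<pi>n by (intro exI[of _ m] allI impI le) simp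
    have "\<bar>?g k u\<bar> \<le> \<epsilon>" if "m \<le> k" for k u
      using n \<pi>n[OF that] \<epsilon> by (cases "u \<in> {0..1}") (simp_all add: le)
    then show "\<exists>n. \<forall>k\<ge>n. \<forall>u. \<bar>?g k u\<bar> \<le> \<epsilon>" by blast
  next
    fix k
    have "continuous_on ({0..1} \<union> ({..0} \<union> {1..})) (?g k)"
      using ends by (intro continuous_on_If continuous_intros continuous_seg x) auto
    moreover have "{0..1} \<union> ({..0} \<union> {1..}) = (UNIV :: real set)" by auto
    ultimately show "continuous_on UNIV (?g k)" by simp
  next
    show "?g k u = 0" if "u \<notin> {0<..<1}" for k u using that ends[of "\<pi> k"] by (cases "u = 0"; cases "u = 1") auto
  qed
  have y: "glue ?v ?g \<in> C01_space" by (rule gd.glue_in)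
  have \<theta>y: "\<theta>C k i (glue ?v ?g) = \<sigma> k * \<theta>C (\<pi> k) i x" for k i
  proof (cases i)
    case (Suc j)
    have "\<theta>C k (Suc j) (glue ?v ?g) = ?g k (dseq j)" by (rule gd.\<theta>C_glue)
    then show ?thesis using Suc dseq[of j] by (simp add: \<theta>C_def less_imp_le)
  next
    case 0
    show ?thesis unfolding 0 by (rule gd.\<theta>C_glue)
  qed
  then show ?thesis using y by blast
qed

lemma C01_triangular: "triangular_space C01_space C01_norm NC \<theta>C zC cC 1"
proof
  show "subspace C01_space" "norm_on C01_space C01_norm" "equivalent_norm C01_space C01_norm NC"
    by (rule subspace_C01 norm_C01 equivalent_NC)+
  show "cC i i = 1" for i by (cases i) (simp_all add: cC_def bump_diag)
  show "i < j \<Longrightarrow> cC i j = 0" for i j by (cases i; cases j) (simp_all add: cC_def bump_lower)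
  show "\<theta>C k i (x + y) = \<theta>C k i x + \<theta>C k i y" "\<theta>C k i (a *\<^sub>R x) = a * \<theta>C k i x" for k i x y a
    by (rule \<theta>C_add \<theta>C_scale)+
  show "x \<in> C01_space \<Longrightarrow> \<bar>\<theta>C k i x\<bar> \<le> NC x" for k i x by (rule \<theta>C_le_NC)
  show z: "zC k i \<in> C01_space" for k i unfolding zC_def by (rule glue_data.glue_in[OF zC_data])
  show "\<theta>C l j (zC k i) = (if l = k then cC j i else 0)" for l j k i by (rule \<theta>C_zC)
  show "NC (zC k 0) \<le> 1" for k
    by (rule NC_least) (auto simp: \<theta>C_zC cC_def split: nat.split)
  fix x assume x: "x \<in> C01_space"
  show "x = y" if y: "y \<in> C01_space" and eq: "\<And>k i. \<theta>C k i x = \<theta>C k i y" for y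
  proof -
    have d: "x - y \<in> C01_space" using subspace_diff[OF subspace_C01 x y] .
    have "\<bar>\<theta>C k i (x - y)\<bar> \<le> 0" for k i
      using \<theta>C_add[of k i x "(-1) *\<^sub>R y"] \<theta>C_scale[of k i "-1" y] eq by simp
    then have "NC (x - y) \<le> 0" by (rule NC_least)
    then have "NC (x - y) = 0" using \<theta>C_le_NC[OF d, of 0 0] by linarith
    then have "x - y = 0" using equivalent_NC d by (simp add: equivalent_norm_def norm_on_def)
    then show ?thesis by simp
  qed
  show "\<exists>y\<in>C01_space. (\<forall>k i. \<theta>C k i y = \<sigma> k * \<theta>C (\<pi> k) i x) \<and> NC y = NC x"
    if \<pi>: "bij \<pi>" and \<sigma>: "\<And>k. \<bar>\<sigma> k\<bar> = 1" for \<pi> \<sigma>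
  proof -
    obtain y' where y': "y' \<in> C01_space" "\<And>k i. \<theta>C k i y' = \<sigma> k * \<theta>C (\<pi> k) i x"
      using C01_multiplier[OF x \<pi>, of \<sigma>] \<sigma> by auto
    have "NC y' \<le> NC x" using \<theta>C_le_NC[OF x] \<sigma> by (intro NC_least) (simp add: y'(2) abs_mult)
    moreover have "NC x \<le> NC y'"
    proof (rule NC_least)
      fix k i
      obtain l where "k = \<pi> l" using \<pi> by (metis bij_pointE)
      then show "\<bar>\<theta>C k i x\<bar> \<le> NC y'" using \<theta>C_le_NC[OF y'(1), of l i] \<sigma> by (simp add: y'(2) abs_mult)
    qed
    ultimately show ?thesis using y' by (intro bexI[of _ y']) auto
  qed
  fix \<epsilon> :: real assume \<epsilon>: "0 < \<epsilon>"
  then obtain n where n: "\<forall>k\<ge>n. \<bar>\<theta>C k 0 x\<bar> \<le> \<epsilon> / 2 \<and> (\<forall>u\<in>{0..1}. \<bar>seg x k u\<bar> \<le> \<epsilon> / 2)"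
    using C01_null[OF x, of "\<epsilon> / 2"] by auto
  have small: "\<bar>\<theta>C k i x\<bar> \<le> \<epsilon> / 2" if "n \<le> k" for k i
    using n that dseq[of "i - 1"] by (cases i) (auto simp: \<theta>C_def less_imp_le)
  have "\<exists>y\<in>C01_space. \<forall>k i. \<theta>C k i y = (if k < n then 0 else 1) * \<theta>C (id k) i x"
    by (rule C01_multiplier[OF x bij_id]) simp
  then obtain x' where x': "x' \<in> C01_space" "\<And>k i. \<theta>C k i x' = (if k < n then 0 else 1) * \<theta>C (id k) i x"
    by blast
  have "NC x' \<le> \<epsilon> / 2" using small \<epsilon> by (intro NC_least) (simp add: x'(2))
  then show "\<exists>n. \<exists>x'\<in>C01_space. (\<forall>k i. \<theta>C k i x' = (if k < n then 0 else \<theta>C k i x)) \<and> NC x' < \<epsilon>"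
    using x' \<epsilon> by (intro exI[of _ n] bexI[OF _ x'(1)]) auto
qed

section \<open>Integrable functions\<close>

lemma lebesgue01_AE_iff: "(AE t in lebesgue01. Q t) \<longleftrightarrow> (AE t in lborel. t \<in> {0..1} \<longrightarrow> Q t)"
  by (subst AE_restrict_space_iff) (auto simp: AE_completion_iff)

lemma borel_ae_eq01:
  assumes "f \<in> borel_measurable borel" shows "ae_eq01 f f"
proof -
  have "f \<in> borel_measurable lebesgue" using assms by (intro measurable_completion) simp
  then show ?thesis by (simp add: ae_eq01_def measurable_restrict_space1)
qed

text \<open>A function measurable for the completed measure has a Borel version. Restricting it to
  \<open>{0<..1}\<close> discards only a null set of the unit interval and leaves the union of the
  dyadic intervals.\<close>

lemma ex_borel_rep:
  "\<exists>f. f \<in> borel_measurable borel \<and> (\<forall>t. t \<notin> {0<..1} \<longrightarrow> f t = 0) \<and> abs_L0 f = F"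
proof -
  let ?r = "rep_L0 F"
  have rr: "ae_eq01 ?r ?r" by (rule Quotient_rep_reflp[OF Quotient_L0])
  then have "?r \<in> borel_measurable lebesgue01" by (simp add: ae_eq01_def)
  then have "(\<lambda>t. indicator {0..1} t *\<^sub>R ?r t) \<in> borel_measurable lebesgue"
    by (subst (asm) borel_measurable_restrict_space_iff) auto
  then obtain h where h: "h \<in> borel_measurable lborel" "AE t in lborel. indicator {0..1} t *\<^sub>R ?r t = h t"
    using completion_ex_borel_measurable_real by blast
  define f where "f t = indicator {0<..1} t * h t" for t
  have fm: "f \<in> borel_measurable borel" using h(1) unfolding f_def by simp
  have "AE t in lborel. t \<in> {0..1} \<longrightarrow> f t = ?r t"
    using h(2) AE_lborel_singleton[of 0] by eventually_elim (auto simp: f_def indicator_def)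
  then have "ae_eq01 f ?r"
    using rr borel_ae_eq01[OF fm] unfolding ae_eq01_def lebesgue01_AE_iff by simp
  then have "abs_L0 f = abs_L0 ?r" by (rule Quotient_rel_abs[OF Quotient_L0])
  also have "\<dots> = F" by (rule Quotient_abs_rep[OF Quotient_L0])
  finally have "abs_L0 f = F" .
  moreover have "\<forall>t. t \<notin> {0<..1} \<longrightarrow> f t = 0" by (simp add: f_def)
  ultimately show ?thesis using fm by blast
qed

definition rp :: "L0 \<Rightarrow> real \<Rightarrow> real" where
  "rp F = (SOME f. f \<in> borel_measurable borel \<and> (\<forall>t. t \<notin> {0<..1} \<longrightarrow> f t = 0) \<and> abs_L0 f = F)"

lemma rp_borel[measurable]: "rp F \<in> borel_measurable borel"
  and rp_supp: "t \<notin> {0<..1} \<Longrightarrow> rp F t = 0"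
  and abs_rp: "abs_L0 (rp F) = F"
  using someI_ex[OF ex_borel_rep[of F]] unfolding rp_def by auto

lemma abs_L0_eq_iff:
  assumes [measurable]: "f \<in> borel_measurable borel" "h \<in> borel_measurable borel"
    and s: "\<And>t. t \<notin> {0<..1} \<Longrightarrow> f t = 0" "\<And>t. t \<notin> {0<..1} \<Longrightarrow> h t = 0"
  shows "abs_L0 f = abs_L0 h \<longleftrightarrow> (AE t in lborel. f t = h t)"
proof -
  have "abs_L0 f = abs_L0 h \<longleftrightarrow> ae_eq01 f h"
    using Quotient_rel[OF Quotient_L0, of f h] borel_ae_eq01[OF assms(1)] borel_ae_eq01[OF assms(2)] by blast
  also have "\<dots> \<longleftrightarrow> (AE t in lborel. t \<in> {0..1} \<longrightarrow> f t = h t)"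
    using borel_ae_eq01[OF assms(1)] borel_ae_eq01[OF assms(2)] unfolding ae_eq01_def lebesgue01_AE_iff by simp
  also have "\<dots> \<longleftrightarrow> (AE t in lborel. f t = h t)"
  proof (rule AE_cong)
    show "(t \<in> {0..1} \<longrightarrow> f t = h t) \<longleftrightarrow> f t = h t" for t
      using s[of t] by (cases "t \<in> {0<..1}") auto
  qed
  finally show ?thesis .
qed

lemma rp_abs:
  assumes "f \<in> borel_measurable borel" "\<And>t. t \<notin> {0<..1} \<Longrightarrow> f t = 0"
  shows "AE t in lborel. rp (abs_L0 f) t = f t"
  using abs_L0_eq_iff[OF rp_borel assms(1) rp_supp assms(2)] abs_rp by blast

lemma rp_eqI: "AE t in lborel. rp F t = rp G t \<Longrightarrow> F = G"
  using abs_L0_eq_iff[OF rp_borel rp_borel rp_supp rp_supp, of F G] abs_rp by simp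

lemma rp_add: "AE t in lborel. rp (F + G) t = rp F t + rp G t"
proof -
  have "F + G = abs_L0 (\<lambda>t. rp F t + rp G t)"
    using plus_L0.abs_eq[OF borel_ae_eq01[OF rp_borel] borel_ae_eq01[OF rp_borel], of F G] abs_rp by simp
  then show ?thesis using rp_abs[of "\<lambda>t. rp F t + rp G t"] by (simp add: rp_supp)
qed

lemma rp_scale: "AE t in lborel. rp (c *\<^sub>R F) t = c * rp F t"
proof -
  have "c *\<^sub>R F = abs_L0 (\<lambda>t. c * rp F t)"
    using scaleR_L0.abs_eq[OF borel_ae_eq01[OF rp_borel], of c F] abs_rp by simp
  then show ?thesis using rp_abs[of "\<lambda>t. c * rp F t"] by (simp add: rp_supp)
qed

lemma rp_0: "AE t in lborel. rp 0 t = 0"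
  using rp_scale[of 0 0] by simp

lemma restrict_integrable:
  assumes [measurable]: "h \<in> borel_measurable borel" and s: "\<And>t. t \<notin> {0<..1} \<Longrightarrow> h t = (0::real)"
  shows "integrable lebesgue01 h \<longleftrightarrow> integrable lborel h" "integral\<^sup>L lebesgue01 h = integral\<^sup>L lborel h"
proof -
  have e: "(\<lambda>t. indicator {0..1} t * h t) = h"
  proof
    show "indicator {0..1} t * h t = h t" for t
      using s[of t] by (cases "t \<in> {0<..1}") (auto simp: indicator_def)
  qed
  show "integrable lebesgue01 h \<longleftrightarrow> integrable lborel h"
    by (subst integrable_restrict_space) (simp_all add: e integrable_completion)
  show "integral\<^sup>L lebesgue01 h = integral\<^sup>L lborel h"
    by (subst integral_restrict_space) (simp_all add: e integral_completion)
qed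

lemma Lp_member_rp: "Lp_member p F \<longleftrightarrow> integrable lborel (\<lambda>t. \<bar>rp F t\<bar> powr p)"
proof -
  have "Lp_member p F \<longleftrightarrow> integrable lebesgue01 (\<lambda>t. \<bar>rp F t\<bar> powr p)"
    using Lp_member.abs_eq[OF borel_ae_eq01[OF rp_borel], of p F] abs_rp by simp
  then show ?thesis by (subst (asm) restrict_integrable) (simp_all add: rp_supp)
qed

lemma Lp_norm_rp: "Lp_norm p F = (LINT t|lborel. \<bar>rp F t\<bar> powr p) powr (1 / p)"
proof -
  have "Lp_norm p F = integral\<^sup>L lebesgue01 (\<lambda>t. \<bar>rp F t\<bar> powr p) powr (1 / p)"
    using Lp_norm.abs_eq[OF borel_ae_eq01[OF rp_borel], of p F] abs_rp by simp
  then show ?thesis by (subst (asm) restrict_integrable) (simp_all add: rp_supp)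
qed

text \<open>An initial part of the k-th dyadic interval; integrals over it are increments of a
  primitive, the analogue of point values.\<close>

definition seg_set :: "nat \<Rightarrow> nat \<Rightarrow> real set" where
  "seg_set k j = {dy (Suc k)<..dy (Suc k) * (1 + dseq j)}"

text \<open>The positive and the negative part of \<open>f\<close> are densities of two measures
  that agree on all rays, hence everywhere.\<close>

lemma AE_zero_if_tail_integrals_zero:
  fixes f :: "real \<Rightarrow> real"
  assumes f: "integrable lborel f" and 0: "\<And>x. (LINT t|lborel. indicator {x<..} t * f t) = 0"
  shows "AE t in lborel. f t = 0"
proof -
  have [measurable]: "f \<in> borel_measurable borel" using borel_measurable_integrable[OF f] by simp
  let ?P = "\<lambda>t. max 0 (f t)" and ?Q = "\<lambda>t. max 0 (- f t)"
  have intP: "integrable lborel (\<lambda>t. indicator {x<..} t * ?P t)" and intQ: "integrable lborel (\<lambda>t. indicator {x<..} t * ?Q t)" for x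
    using f by (auto intro!: Bochner_Integration.integrable_bound[OF f] AE_I2 simp: indicator_def)
  have eq: "(LINT t|lborel. indicator {x<..} t * ?P t) = (LINT t|lborel. indicator {x<..} t * ?Q t)" for x
  proof -
    have "(LINT t|lborel. indicator {x<..} t * ?P t) - (LINT t|lborel. indicator {x<..} t * ?Q t)
        = (LINT t|lborel. indicator {x<..} t * ?P t - indicator {x<..} t * ?Q t)"
      by (rule Bochner_Integration.integral_diff[symmetric, OF intP intQ])
    also have "\<dots> = (LINT t|lborel. indicator {x<..} t * f t)"
      by (rule Bochner_Integration.integral_cong) (auto simp: indicator_def)
    finally show ?thesis using 0 by simp
  qed
  have em: "emeasure (density lborel (\<lambda>t. ennreal (h t))) {x<..} = ennreal (LINT t|lborel. indicator {x<..} t * h t)"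
    if "h \<in> borel_measurable borel" "\<And>t. 0 \<le> h t" "integrable lborel (\<lambda>t. indicator {x<..} t * h t)" for h :: "real \<Rightarrow> real" and x
  proof -
    have "emeasure (density lborel (\<lambda>t. ennreal (h t))) {x<..} = (\<integral>\<^sup>+t. ennreal (h t) * indicator {x<..} t \<partial>lborel)"
      using that(1) by (subst emeasure_density) auto
    also have "\<dots> = (\<integral>\<^sup>+t. ennreal (indicator {x<..} t * h t) \<partial>lborel)"
      by (rule nn_integral_cong) (simp add: indicator_def)
    also have "\<dots> = ennreal (LINT t|lborel. indicator {x<..} t * h t)"
      using that by (intro nn_integral_eq_integral) auto
    finally show ?thesis .
  qed
  have "density lborel (\<lambda>t. ennreal (?P t)) = density lborel (\<lambda>t. ennreal (?Q t))"
    by (rule measure_eqI_lessThan) (simp_all add: em intP intQ eq)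
  then have "AE t in lborel. ennreal (?P t) = ennreal (?Q t)"
    by (subst (asm) sigma_finite_measure.density_unique_iff[OF sigma_finite_lborel]) auto
  then show ?thesis by eventually_elim (auto simp: max_def split: if_splits)
qed

text \<open>The primitive of \<open>f\<close> is continuous and agrees with its value at \<open>dy (Suc k)\<close> on a dense subset of
  the \<open>k\<close>-th dyadic interval.\<close>

lemma AE_zero_if_seg_integrals_zero:
  fixes f :: "real \<Rightarrow> real"
  assumes f: "integrable lborel f" and supp: "\<And>t. t \<notin> {0<..1} \<Longrightarrow> f t = 0"
    and 0: "\<And>k j. (LINT t|lborel. indicator (seg_set k j) t * f t) = 0"
  shows "AE t in lborel. f t = 0"
proof -
  have [measurable]: "f \<in> borel_measurable borel" using borel_measurable_integrable[OF f] by simp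
  define P where "P x = (LINT t|lborel. indicator {x<..} t * f t)" for x
  have int: "integrable lborel (\<lambda>t. indicator A t * f t)" if "A \<in> sets borel" for A
    using that by (intro Bochner_Integration.integrable_bound[OF f] AE_I2) (auto simp: indicator_def)
  have cont: "continuous_on UNIV P"
    unfolding continuous_on_sequentially
  proof (intro allI ballI impI)
    fix x :: "nat \<Rightarrow> real" and a :: real assume "(\<forall>n. x n \<in> UNIV) \<and> x \<longlonglongrightarrow> a"
    then have "x \<longlonglongrightarrow> a" by simp
    show "(P \<circ> x) \<longlonglongrightarrow> P a"
      unfolding P_def o_def
    proof (rule integral_dominated_convergence[where w = "\<lambda>t. \<bar>f t\<bar>"])
      show "AE t in lborel. (\<lambda>n. indicator {x n<..} t * f t) \<longlonglongrightarrow> indicator {a<..} t * f t"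
        using AE_lborel_singleton[of a]
      proof eventually_elim
        fix t assume "t \<noteq> a"
        then have "\<forall>\<^sub>F n in sequentially. indicator {x n<..} t * f t = indicator {a<..} t * f t"
        proof (cases "a < t")
          case True
          then have "\<forall>\<^sub>F n in sequentially. x n < t" using \<open>x \<longlonglongrightarrow> a\<close> by (intro order_tendstoD(2))
          then show ?thesis by (rule eventually_mono) (use True in simp)
        next
          case False
          then have "\<forall>\<^sub>F n in sequentially. t < x n" using \<open>x \<longlonglongrightarrow> a\<close> \<open>t \<noteq> a\<close> by (intro order_tendstoD(1)) auto
          then show ?thesis by (rule eventually_mono) (use False in simp)
        qed
        then show "(\<lambda>n. indicator {x n<..} t * f t) \<longlonglongrightarrow> indicator {a<..} t * f t" by (rule tendsto_eventually)
      qed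
    qed (use f in \<open>auto simp: indicator_def intro!: AE_I2\<close>)
  qed
  have seg: "P (dy (Suc k) * (1 + u)) = P (dy (Suc k))" if u: "u \<in> {0..1}" for k u
  proof -
    have "P (dy (Suc k) * (1 + v)) = P (dy (Suc k))" if "v \<in> range dseq" for v
    proof -
      obtain j where v: "v = dseq j" using \<open>v \<in> range dseq\<close> by blast
      have d: "dy (Suc k) < dy (Suc k) * (1 + v)" using dseq[of j] dy(1)[of "Suc k"] v by simp
      have "P (dy (Suc k)) - P (dy (Suc k) * (1 + v)) =
          (LINT t|lborel. indicator {dy (Suc k)<..} t * f t - indicator {dy (Suc k) * (1 + v)<..} t * f t)"
        unfolding P_def by (rule Bochner_Integration.integral_diff[symmetric]) (simp_all add: int)
      also have "\<dots> = (LINT t|lborel. indicator (seg_set k j) t * f t)"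
        using d by (intro Bochner_Integration.integral_cong) (auto simp: seg_set_def v indicator_def)
      finally show ?thesis using 0 by simp
    qed
    moreover have "continuous_on (closure (range dseq)) (\<lambda>u. P (dy (Suc k) * (1 + u)))"
      by (intro continuous_on_compose2[OF cont] continuous_intros) auto
    ultimately show ?thesis
      using continuous_constant_on_closure[of "range dseq" "\<lambda>u. P (dy (Suc k) * (1 + u))" "P (dy (Suc k))" u]
        closure_dseq u by blast
  qed
  \<comment> \<open>Starts from P 1 = 0; \<open>seg\<close> with u = 1 passes from one end of a
    dyadic interval to the other.\<close>
  have dyP: "P (dy k) = 0" for k
  proof (induction k)
    case 0
    have "P 1 = integral\<^sup>L lborel (\<lambda>t::real. 0)"
      unfolding P_def by (rule Bochner_Integration.integral_cong) (auto simp: indicator_def supp)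
    then show ?case using dy(4) by simp
  next
    case (Suc k)
    have e: "dy (Suc k) * (1 + 1) = dy k" using dy(3)[of k] by simp
    show ?case using seg[of 1 k] Suc unfolding e by simp
  qed
  have pos: "P x = 0" if x: "0 < x" "x \<le> 1" for x
  proof -
    obtain k where k: "dy (Suc k) < x" "x \<le> dy k" using dyadic_interval[OF x] by blast
    define u where "u = x / dy (Suc k) - 1"
    have "u \<in> {0..1}" "dy (Suc k) * (1 + u) = x"
      using k dy(1)[of "Suc k"] dy(3)[of k] by (simp_all add: u_def field_simps)
    then show ?thesis using seg[of u k] dyP by simp
  qed
  have "dy \<longlonglongrightarrow> 0" unfolding dy_def by (intro LIMSEQ_power_zero) simp
  then have "(\<lambda>k. P (dy k)) \<longlonglongrightarrow> P 0"
    using cont by (intro isCont_tendsto_compose[where g = P]) (simp_all add: continuous_on_eq_continuous_at)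
  then have P0: "P 0 = 0" using dyP by (simp add: LIMSEQ_const_iff)
  have "P x = 0" for x
  proof -
    consider "x \<le> 0" | "0 < x" "x \<le> 1" | "1 < x" by linarith
    then show ?thesis
    proof cases
      case 1
      have "P x = P 0"
        unfolding P_def using 1 by (intro Bochner_Integration.integral_cong) (auto simp: indicator_def supp)
      then show ?thesis using P0 by simp
    next
      case 3
      have "P x = integral\<^sup>L lborel (\<lambda>t::real. 0)"
        unfolding P_def using 3 by (intro Bochner_Integration.integral_cong) (auto simp: indicator_def supp)
      then show ?thesis by simp
    qed (rule pos)
  qed
  then show ?thesis unfolding P_def by (rule AE_zero_if_tail_integrals_zero[OF f])
qed

section \<open>Decomposition of the unit interval into dyadic intervals\<close>

definition dseg :: "nat \<Rightarrow> real set" where "dseg k = {dy (Suc k)<..dy k}"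

lemma dseg_borel[measurable]: "dseg k \<in> sets borel" and seg_set_borel[measurable]: "seg_set k j \<in> sets borel"
  by (simp_all add: dseg_def seg_set_def)

lemma dseg_disjoint: assumes "k \<noteq> l" shows "dseg k \<inter> dseg l = {}"
proof -
  have "dseg k \<inter> dseg l = {}" if "k < l" for k l
    using dy_mono[of "Suc k" l] that by (auto simp: dseg_def)
  then show ?thesis using assms by (cases k l rule: linorder_cases) auto
qed

lemma dseg_cover: "t \<in> {0<..1} \<Longrightarrow> \<exists>k. t \<in> dseg k"
  using dyadic_interval[of t] by (auto simp: dseg_def)

lemma dseg_unit: "dseg k \<subseteq> {0<..1}"
  using dy(1)[of "Suc k"] dy(2)[of k] by (auto simp: dseg_def)

lemma seg_set_dseg: "seg_set k j \<subseteq> dseg k"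
proof -
  have "dy (Suc k) * (1 + dseq j) \<le> dy k" using dy_arg[of "dseq j" k] dseq[of j] by simp
  then show ?thesis by (auto simp: dseg_def seg_set_def)
qed

lemma suminf_dseg: assumes "t \<in> dseg k" shows "(\<Sum>l. indicator (dseg l) t * h l) = (h k :: real)"
proof -
  have "indicator (dseg l) t * h l = (if l = k then h l else 0)" for l
    using assms dseg_disjoint[of l k] by (auto simp: indicator_def)
  then show ?thesis using sums_single[of k h] by (simp add: sums_iff)
qed

lemma suminf_dseg_out: assumes "t \<notin> {0<..1}" shows "(\<Sum>l. indicator (dseg l) t * h l) = (0 :: real)"
proof -
  have "indicator (dseg l) t = (0::real)" for l using assms dseg_unit[of l] by (auto simp: indicator_def)
  then show ?thesis by simp
qed

lemma nn_integral_dseg_decomp: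
  assumes [measurable]: "h \<in> borel_measurable borel" and s: "\<And>t. t \<notin> {0<..1} \<Longrightarrow> h t = (0::real)" and nn: "\<And>t. 0 \<le> h t"
  shows "(\<integral>\<^sup>+t. ennreal (h t) \<partial>lborel) = (\<Sum>k. \<integral>\<^sup>+t. ennreal (indicator (dseg k) t * h t) \<partial>lborel)"
proof -
  have "(\<Sum>k. ennreal (indicator (dseg k) t * h t)) = ennreal (h t)" for t
  proof (cases "t \<in> {0<..1}")
    case True
    then obtain k where k: "t \<in> dseg k" using dseg_cover by blast
    have "(\<Sum>l. ennreal (indicator (dseg l) t * h t)) = (\<Sum>l\<in>{k}. ennreal (indicator (dseg l) t * h t))"
      using k dseg_disjoint by (intro suminf_finite) (auto simp: indicator_def)
    then show ?thesis using k by simp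
  qed (simp add: s)
  then have "(\<integral>\<^sup>+t. ennreal (h t) \<partial>lborel) = (\<integral>\<^sup>+t. (\<Sum>k. ennreal (indicator (dseg k) t * h t)) \<partial>lborel)"
    by simp
  also have "\<dots> = (\<Sum>k. \<integral>\<^sup>+t. ennreal (indicator (dseg k) t * h t) \<partial>lborel)"
    by (rule nn_integral_suminf) measurable
  finally show ?thesis .
qed

lemma bij_suminf_ennreal:
  fixes f :: "nat \<Rightarrow> ennreal"
  assumes "bij \<pi>" shows "(\<Sum>k. f (\<pi> k)) = (\<Sum>k. f k)"
  using nn_integral_bij_count_space[of \<pi> UNIV UNIV f] assms by (simp add: nn_integral_count_space_nat)

text \<open>The scaling that carries the k-th dyadic interval onto the one with index
  \<open>\<pi> k\<close>.\<close>

definition quot :: "(nat \<Rightarrow> nat) \<Rightarrow> nat \<Rightarrow> real" where "quot \<pi> k = dy (\<pi> k) / dy k"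

lemma quot_pos: "0 < quot \<pi> k"
  using dy(1) by (simp add: quot_def)

lemma quot_dy: "quot \<pi> k * dy k = dy (\<pi> k)" "quot \<pi> k * dy (Suc k) = dy (Suc (\<pi> k))"
  using dy(1)[of k] unfolding quot_def dy(3) by simp_all

lemma dseg_quot: "quot \<pi> k * t \<in> dseg (\<pi> k) \<longleftrightarrow> t \<in> dseg k"
proof -
  have "dseg (\<pi> k) = {quot \<pi> k * dy (Suc k)<..quot \<pi> k * dy k}" by (simp only: dseg_def quot_dy)
  then show ?thesis using quot_pos[of \<pi> k] by (simp add: dseg_def)
qed

lemma seg_set_quot: "quot \<pi> k * t \<in> seg_set (\<pi> k) j \<longleftrightarrow> t \<in> seg_set k j"
proof -
  have "seg_set (\<pi> k) j = {quot \<pi> k * dy (Suc k)<..quot \<pi> k * (dy (Suc k) * (1 + dseq j))}"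
    by (simp only: seg_set_def quot_dy mult.assoc[symmetric])
  then show ?thesis using quot_pos[of \<pi> k] by (simp add: seg_set_def)
qed

section \<open>Coordinates on the function space for exponent p\<close>

locale Lp_exponent =
  fixes p :: real
  assumes p: "1 \<le> p"
begin

definition md :: "L0 \<Rightarrow> real" where "md F = (LINT t|lborel. \<bar>rp F t\<bar> powr p)"

lemma Lp_int: "F \<in> Lp_space p \<Longrightarrow> integrable lborel (\<lambda>t. \<bar>rp F t\<bar> powr p)"
  by (simp add: Lp_space_def Lp_member_rp)

lemma Lp_norm_md: "Lp_norm p F = md F powr (1 / p)"
  by (simp add: Lp_norm_rp md_def)

lemma subspace_Lp: "subspace (Lp_space p)"
  unfolding subspace_def
proof (intro conjI ballI allI)
  have "integrable lborel (\<lambda>t. \<bar>rp 0 t\<bar> powr p) \<longleftrightarrow> integrable lborel (\<lambda>t::real. 0::real)"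
    using rp_0 by (intro Bochner_Integration.integrable_cong_AE) (auto elim: eventually_mono)
  then show "0 \<in> Lp_space p" by (simp add: Lp_space_def Lp_member_rp)
  fix F assume F: "F \<in> Lp_space p"
  show "c *\<^sub>R F \<in> Lp_space p" for c
  proof -
    have "integrable lborel (\<lambda>t. \<bar>rp (c *\<^sub>R F) t\<bar> powr p) \<longleftrightarrow> integrable lborel (\<lambda>t. \<bar>c\<bar> powr p * \<bar>rp F t\<bar> powr p)"
      using rp_scale[of c F] by (intro Bochner_Integration.integrable_cong_AE) (auto elim!: eventually_mono simp: abs_mult powr_mult)
    then show ?thesis using Lp_int[OF F] by (simp add: Lp_space_def Lp_member_rp)
  qed
  fix G assume G: "G \<in> Lp_space p"
  have "integrable lborel (\<lambda>t. \<bar>rp (F + G) t\<bar> powr p)"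
  proof (rule Bochner_Integration.integrable_bound)
    show "integrable lborel (\<lambda>t. 2 powr p * (\<bar>rp F t\<bar> powr p + \<bar>rp G t\<bar> powr p))"
      using Lp_int F G by simp
    show "AE t in lborel. norm (\<bar>rp (F + G) t\<bar> powr p) \<le> norm (2 powr p * (\<bar>rp F t\<bar> powr p + \<bar>rp G t\<bar> powr p))"
      using rp_add[of F G]
    proof eventually_elim
      fix t assume "rp (F + G) t = rp F t + rp G t"
      then show "norm (\<bar>rp (F + G) t\<bar> powr p) \<le> norm (2 powr p * (\<bar>rp F t\<bar> powr p + \<bar>rp G t\<bar> powr p))"
        using abs_powr_add[OF p, of "rp F t" "rp G t"] by simp
    qed
  qed simp
  then show "F + G \<in> Lp_space p" by (simp add: Lp_space_def Lp_member_rp)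
qed

lemma norm_Lp: "norm_on (Lp_space p) (Lp_norm p)"
proof -
  have "norm_on (Lp_space p) (\<lambda>F. md F powr (1 / p))"
  proof (rule modular_norm[OF subspace_Lp p])
    fix F assume F: "F \<in> Lp_space p"
    show "0 \<le> md F" by (simp add: md_def)
    show "md F = 0 \<longleftrightarrow> F = 0"
    proof -
      have "md F = 0 \<longleftrightarrow> (AE t in lborel. \<bar>rp F t\<bar> powr p = 0)"
        unfolding md_def by (rule integral_nonneg_eq_0_iff_AE[OF Lp_int[OF F]]) simp
      also have "\<dots> \<longleftrightarrow> (AE t in lborel. rp F t = 0)" by simp
      also have "\<dots> \<longleftrightarrow> F = 0"
      proof
        assume "AE t in lborel. rp F t = 0"
        then have "AE t in lborel. rp F t = rp 0 t" using rp_0 by eventually_elim simp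
        then show "F = 0" by (rule rp_eqI)
      qed (use rp_0 in simp)
      finally show ?thesis .
    qed
    show "md (c *\<^sub>R F) = \<bar>c\<bar> powr p * md F" for c
    proof -
      have "md (c *\<^sub>R F) = (LINT t|lborel. \<bar>c\<bar> powr p * \<bar>rp F t\<bar> powr p)"
        unfolding md_def using rp_scale[of c F]
        by (intro integral_cong_AE) (auto elim!: eventually_mono simp: abs_mult powr_mult)
      then show ?thesis by (simp add: md_def)
    qed
    fix G t assume G: "G \<in> Lp_space p" and t: "0 \<le> t" "t \<le> (1::real)"
    have "md ((1 - t) *\<^sub>R F + t *\<^sub>R G) \<le> (LINT u|lborel. (1 - t) * \<bar>rp F u\<bar> powr p + t * \<bar>rp G u\<bar> powr p)"
      unfolding md_def
    proof (rule integral_mono_AE)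
      have "(1 - t) *\<^sub>R F + t *\<^sub>R G \<in> Lp_space p"
        using subspace_Lp F G by (intro subspace_add subspace_scale)
      then show "integrable lborel (\<lambda>u. \<bar>rp ((1 - t) *\<^sub>R F + t *\<^sub>R G) u\<bar> powr p)" by (rule Lp_int)
      show "integrable lborel (\<lambda>u. (1 - t) * \<bar>rp F u\<bar> powr p + t * \<bar>rp G u\<bar> powr p)"
        using Lp_int F G by simp
      show "AE u in lborel. \<bar>rp ((1 - t) *\<^sub>R F + t *\<^sub>R G) u\<bar> powr p \<le> (1 - t) * \<bar>rp F u\<bar> powr p + t * \<bar>rp G u\<bar> powr p"
        using rp_add[of "(1 - t) *\<^sub>R F" "t *\<^sub>R G"] rp_scale[of "1 - t" F] rp_scale[of t G]
      proof eventually_elim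
        case (elim u)
        show ?case unfolding elim by (rule abs_powr_convex[OF p t])
      qed
    qed
    also have "\<dots> = (1 - t) * md F + t * md G"
      using Lp_int F G by (simp add: md_def)
    finally show "md ((1 - t) *\<^sub>R F + t *\<^sub>R G) \<le> (1 - t) * md F + t * md G" .
  qed
  then show ?thesis unfolding Lp_norm_md[abs_def] .
qed

lemma abs_le_1_powr: "\<bar>a\<bar> \<le> 1 + \<bar>a\<bar> powr p" for a :: real
proof (cases "\<bar>a\<bar> \<le> 1")
  case False
  then show ?thesis using powr_mono[of 1 p "\<bar>a\<bar>"] p by simp
next
  case True
  then show ?thesis using powr_ge_zero[of "\<bar>a\<bar>" p] by linarith
qed

text \<open>The representative lives on a set of finite measure, where \<open>abs_le_1_powr\<close>
  gives an integrable bound.\<close>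

lemma rp_integrable: assumes F: "F \<in> Lp_space p" shows "integrable lborel (rp F)"
proof (rule Bochner_Integration.integrable_bound)
  show "integrable lborel (\<lambda>t. indicator {0<..1} t + \<bar>rp F t\<bar> powr p)"
    using Lp_int[OF F] by (intro Bochner_Integration.integrable_add) auto
  show "AE t in lborel. norm (rp F t) \<le> norm (indicator {0<..1} t + \<bar>rp F t\<bar> powr p)"
  proof (rule AE_I2)
    fix t show "norm (rp F t) \<le> norm (indicator {0<..1} t + \<bar>rp F t\<bar> powr p)"
      using abs_le_1_powr[of "rp F t"] rp_supp[of t F] by (cases "t \<in> {0<..1}") auto
  qed
qed simp

lemma int_ind: "integrable lborel h \<Longrightarrow> A \<in> sets borel \<Longrightarrow> integrable lborel (\<lambda>t. indicator A t * (h t :: real))"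
  using integrable_real_mult_indicator[of A lborel h] by (simp add: mult.commute)

text \<open>The interval has length \<open>dy (Suc k)\<close>; the exponent is that of Hoelder's
  inequality and fits the rescaling of intervals. The factor 1/2 absorbs the 2 in
  \<open>X \<le> 2 * (d * c)\<close>.\<close>

definition \<kappa> :: "nat \<Rightarrow> real" where "\<kappa> k = 1 / 2 * dy (Suc k) powr (1 / p - 1)"

definition \<theta>L :: "nat \<Rightarrow> nat \<Rightarrow> L0 \<Rightarrow> real" where
  "\<theta>L k j F = \<kappa> k * (LINT t|lborel. indicator (seg_set k j) t * rp F t)"

lemma \<kappa>_pos: "0 < \<kappa> k"
  using dy(1)[of "Suc k"] by (simp add: \<kappa>_def)

lemma \<theta>L_add: assumes "F \<in> Lp_space p" "G \<in> Lp_space p" shows "\<theta>L k j (F + G) = \<theta>L k j F + \<theta>L k j G"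
proof -
  have "(LINT t|lborel. indicator (seg_set k j) t * rp (F + G) t)
      = (LINT t|lborel. indicator (seg_set k j) t * rp F t + indicator (seg_set k j) t * rp G t)"
    using rp_add[of F G] by (intro integral_cong_AE) (auto elim!: eventually_mono simp: algebra_simps)
  also have "\<dots> = (LINT t|lborel. indicator (seg_set k j) t * rp F t) + (LINT t|lborel. indicator (seg_set k j) t * rp G t)"
    using assms by (intro Bochner_Integration.integral_add int_ind rp_integrable) auto
  finally show ?thesis by (simp add: \<theta>L_def algebra_simps)
qed

lemma \<theta>L_scale: "\<theta>L k j (c *\<^sub>R F) = c * \<theta>L k j F"
proof -
  have "(LINT t|lborel. indicator (seg_set k j) t * rp (c *\<^sub>R F) t)
      = (LINT t|lborel. c * (indicator (seg_set k j) t * rp F t))"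
    using rp_scale[of c F] by (intro integral_cong_AE) (auto elim!: eventually_mono simp: algebra_simps)
  then show ?thesis by (simp add: \<theta>L_def)
qed

definition mseg :: "nat \<Rightarrow> L0 \<Rightarrow> real" where
  "mseg k F = (LINT t|lborel. indicator (dseg k) t * \<bar>rp F t\<bar> powr p)"

text \<open>Integrating \<open>\<bar>a\<bar> \<le> \<lambda> + \<lambda> powr (1 - p) * \<bar>a\<bar> powr p\<close> and optimising over \<open>\<lambda>\<close> replaces
  Hoelder's inequality.\<close>

lemma \<theta>L_le_mseg: assumes F: "F \<in> Lp_space p" shows "\<bar>\<theta>L k j F\<bar> \<le> mseg k F powr (1 / p)"
proof -
  define d where "d = dy (Suc k)"
  define m where "m = mseg k F"
  define X where "X = (LINT t|lborel. indicator (dseg k) t * \<bar>rp F t\<bar>)"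
  have d: "0 < d" by (simp add: d_def dy)
  have m: "0 \<le> m" unfolding m_def mseg_def by (intro integral_nonneg_AE AE_I2) simp
  have lenJ: "(LINT t|lborel. indicator (dseg k) t * c) = d * c" for c
  proof -
    have "measure lborel (dseg k) = d"
      using dy(1)[of "Suc k"] dy(3)[of k] by (simp add: dseg_def d_def)
    then show ?thesis by simp
  qed
  have "\<bar>LINT t|lborel. indicator (seg_set k j) t * rp F t\<bar> \<le> (LINT t|lborel. \<bar>indicator (seg_set k j) t * rp F t\<bar>)"
    by (rule integral_abs_bound)
  also have "\<dots> \<le> X"
    unfolding X_def
  proof (rule integral_mono)
    show "integrable lborel (\<lambda>t. \<bar>indicator (seg_set k j) t * rp F t\<bar>)"
      by (intro Bochner_Integration.integrable_abs int_ind rp_integrable F) simp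
    show "integrable lborel (\<lambda>t. indicator (dseg k) t * \<bar>rp F t\<bar>)"
      by (intro int_ind Bochner_Integration.integrable_abs rp_integrable F) simp
    show "\<bar>indicator (seg_set k j) t * rp F t\<bar> \<le> indicator (dseg k) t * \<bar>rp F t\<bar>" for t
      using seg_set_dseg[of k j] by (auto simp: indicator_def)
  qed
  finally have le1: "\<bar>\<theta>L k j F\<bar> \<le> \<kappa> k * X" unfolding \<theta>L_def abs_mult using \<kappa>_pos[of k] by simp
  have Xle: "X \<le> d * c + c powr (1 - p) * m" if c: "0 < c" for c
  proof -
    have i1: "integrable lborel (\<lambda>t. indicator (dseg k) t * c)"
    proof -
      have "integrable lborel (indicat_real (dseg k))"
        using dy_mono[of k "Suc k"] by (intro integrable_real_indicator) (simp_all add: dseg_def)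
      then show ?thesis by simp
    qed
    have i2: "integrable lborel (\<lambda>t. c powr (1 - p) * (indicator (dseg k) t * \<bar>rp F t\<bar> powr p))"
      by (intro integrable_mult_right int_ind Lp_int F) simp
    have "X \<le> (LINT t|lborel. indicator (dseg k) t * c + c powr (1 - p) * (indicator (dseg k) t * \<bar>rp F t\<bar> powr p))"
      unfolding X_def
    proof (rule integral_mono)
      show "integrable lborel (\<lambda>t. indicator (dseg k) t * \<bar>rp F t\<bar>)"
        by (intro int_ind Bochner_Integration.integrable_abs rp_integrable F) simp
      show "integrable lborel (\<lambda>t. indicator (dseg k) t * c + c powr (1 - p) * (indicator (dseg k) t * \<bar>rp F t\<bar> powr p))"
        using i1 i2 by (rule Bochner_Integration.integrable_add)
      fix t
      have "\<bar>rp F t\<bar> = c * \<bar>rp F t / c\<bar>" using c by simp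
      also have "\<dots> \<le> c * (1 + \<bar>rp F t / c\<bar> powr p)"
        using abs_le_1_powr[of "rp F t / c"] c by (intro mult_left_mono) auto
      also have "\<dots> = c + c powr (1 - p) * \<bar>rp F t\<bar> powr p"
        using c by (simp add: powr_divide powr_diff field_simps)
      finally show "indicator (dseg k) t * \<bar>rp F t\<bar> \<le> indicator (dseg k) t * c + c powr (1 - p) * (indicator (dseg k) t * \<bar>rp F t\<bar> powr p)"
        by (simp add: indicator_def)
    qed
    also have "\<dots> = d * c + c powr (1 - p) * m"
      using Bochner_Integration.integral_add[OF i1 i2] by (simp only: lenJ m_def mseg_def integral_mult_right_zero)
    finally show ?thesis .
  qed
  have "\<kappa> k * X \<le> m powr (1 / p)"
  proof (cases "m = 0")
    case True
    have "X \<le> 0"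
    proof (rule field_le_epsilon)
      fix \<epsilon> :: real assume "0 < \<epsilon>"
      then show "X \<le> 0 + \<epsilon>" using Xle[of "\<epsilon> / d"] d True by simp
    qed
    then show ?thesis using \<kappa>_pos[of k] True by (simp add: mult_nonneg_nonpos)
  next
    case False
    then have m0: "0 < m" using m by simp
    \<comment> \<open>Balances the two terms of \<open>Xle\<close>: both become d * c.\<close>
    define c where "c = (m / d) powr (1 / p)"
    have c: "0 < c" using m0 d by (simp add: c_def)
    have "c powr (1 - p) * m = c * (m / c powr p)" using c by (simp add: powr_diff)
    also have "c powr p = m / d" using m0 d p by (simp add: c_def powr_powr)
    finally have "X \<le> 2 * (d * c)" using Xle[OF c] m0 by (simp add: mult.commute)
    then have "\<kappa> k * X \<le> \<kappa> k * (2 * (d * c))" using \<kappa>_pos[of k] by (intro mult_left_mono) auto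
    also have "\<dots> = d powr (1 / p - 1) * d powr 1 * c" using d by (simp add: \<kappa>_def d_def)
    also have "\<dots> = d powr (1 / p) * c" by (simp only: powr_add[symmetric]) simp
    also have "\<dots> = m powr (1 / p)" using m0 d by (simp add: c_def powr_divide)
    finally show ?thesis .
  qed
  then show ?thesis using le1 by (simp add: m_def)
qed

definition mtail :: "nat \<Rightarrow> L0 \<Rightarrow> real" where
  "mtail n F = (LINT t|lborel. indicator {..dy n} t * \<bar>rp F t\<bar> powr p)"

lemma mtail_null: assumes F: "F \<in> Lp_space p" shows "(\<lambda>n. mtail n F) \<longlonglongrightarrow> 0"
proof -
  have "(\<lambda>n. mtail n F) \<longlonglongrightarrow> (LINT t|lborel. 0 * \<bar>rp F t\<bar>)"
    unfolding mtail_def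
  proof (rule integral_dominated_convergence[where w = "\<lambda>t. \<bar>rp F t\<bar> powr p"])
    show "AE t in lborel. (\<lambda>n. indicator {..dy n} t * \<bar>rp F t\<bar> powr p) \<longlonglongrightarrow> 0 * \<bar>rp F t\<bar>"
    proof (rule AE_I2, rule tendsto_eventually)
      fix t
      show "\<forall>\<^sub>F n in sequentially. indicator {..dy n} t * \<bar>rp F t\<bar> powr p = 0 * \<bar>rp F t\<bar>"
      proof (cases "0 < t")
        case True
        then obtain n where "\<forall>k\<ge>n. dy k < t" using dy_null by blast
        then show ?thesis unfolding eventually_sequentially by (intro exI[of _ n]) auto
      next
        case False
        then show ?thesis by (simp add: rp_supp)
      qed
    qed
    show "AE t in lborel. norm (indicator {..dy n} t * \<bar>rp F t\<bar> powr p) \<le> \<bar>rp F t\<bar> powr p" for n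
      by (rule AE_I2) (simp add: indicator_def)
  qed (use Lp_int[OF F] in auto)
  then show ?thesis by simp
qed

lemma mseg_le: assumes F: "F \<in> Lp_space p" shows "mseg k F \<le> md F"
  unfolding mseg_def md_def
  by (intro integral_mono int_ind Lp_int F) (auto simp: indicator_def)

lemma mseg_nonneg: "0 \<le> mseg k F"
  unfolding mseg_def by (intro integral_nonneg_AE AE_I2) simp

lemma \<theta>L_le: assumes F: "F \<in> Lp_space p" shows "\<bar>\<theta>L k j F\<bar> \<le> Lp_norm p F"
proof -
  have "mseg k F powr (1 / p) \<le> md F powr (1 / p)"
    using p by (intro powr_mono2 mseg_le F mseg_nonneg) auto
  then show ?thesis using \<theta>L_le_mseg[OF F, of k j] by (simp add: Lp_norm_md)
qed

lemma powr_null: assumes F: "F \<in> Lp_space p" and \<epsilon>: "0 < \<epsilon>" shows "\<exists>n. mtail n F powr (1 / p) < \<epsilon>"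
proof -
  have nn: "0 \<le> mtail n F" for n unfolding mtail_def by (intro integral_nonneg_AE AE_I2) simp
  have "0 < \<epsilon> powr p" using \<epsilon> by simp
  then have "\<forall>\<^sub>F n in sequentially. mtail n F < \<epsilon> powr p" by (rule order_tendstoD(2)[OF mtail_null[OF F]])
  then obtain n where n: "mtail n F < \<epsilon> powr p" by (auto simp: eventually_sequentially)
  have "mtail n F powr (1 / p) < (\<epsilon> powr p) powr (1 / p)"
    using p n nn by (intro powr_less_mono2) auto
  then show ?thesis using p \<epsilon> by (intro exI[of _ n]) (simp add: powr_powr)
qed

lemma \<theta>L_sep:
  assumes F: "F \<in> Lp_space p" and G: "G \<in> Lp_space p" and eq: "\<And>k j. \<theta>L k j F = \<theta>L k j G"
  shows "F = G"
proof -
  have "AE t in lborel. rp F t - rp G t = 0"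
  proof (rule AE_zero_if_seg_integrals_zero)
    show "integrable lborel (\<lambda>t. rp F t - rp G t)" using rp_integrable F G by simp
    show "(LINT t|lborel. indicator (seg_set k j) t * (rp F t - rp G t)) = 0" for k j
    proof -
      have "(LINT t|lborel. indicator (seg_set k j) t * rp F t) = (LINT t|lborel. indicator (seg_set k j) t * rp G t)"
        using eq[of k j] \<kappa>_pos[of k] by (simp add: \<theta>L_def)
      moreover have "(LINT t|lborel. indicator (seg_set k j) t * rp F t - indicator (seg_set k j) t * rp G t)
          = (LINT t|lborel. indicator (seg_set k j) t * rp F t) - (LINT t|lborel. indicator (seg_set k j) t * rp G t)"
        using F G by (intro Bochner_Integration.integral_diff int_ind rp_integrable) auto
      ultimately show ?thesis by (simp add: right_diff_distrib)
    qed
  qed (simp add: rp_supp)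
  then have "AE t in lborel. rp F t = rp G t" by eventually_elim simp
  then show ?thesis by (rule rp_eqI)
qed

text \<open>The function \<open>haar k j\<close> is, up to scaling, the derivative of \<open>bump j\<close> transported to \<open>dseg k\<close>.\<close>

definition haar :: "nat \<Rightarrow> nat \<Rightarrow> real \<Rightarrow> real" where
  "haar k j t = inverse (\<kappa> k * dy (Suc k) * gap j) *
     (indicator {dy (Suc k) * (1 + (dseq j - gap j))<..dy (Suc k) * (1 + dseq j)} t
      - indicator {dy (Suc k) * (1 + dseq j)<..dy (Suc k) * (1 + (dseq j + gap j))} t)"

lemma haar_borel[measurable]: "haar k j \<in> borel_measurable borel"
  unfolding haar_def[abs_def] by measurable

lemma haar_supp: assumes "t \<notin> dseg k" shows "haar k j t = 0"
proof -
  let ?d = "dy (Suc k)"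
  have d: "0 < ?d" by (rule dy)
  have "?d \<le> ?d * (1 + (dseq j - gap j))" using gap(2)[of j] d by simp
  moreover have "?d * (1 + (dseq j + gap j)) \<le> ?d * 2" using gap(3)[of j] d by (intro mult_left_mono) auto
  moreover have "?d * (1 + (dseq j - gap j)) \<le> ?d * (1 + dseq j)" "?d * (1 + dseq j) \<le> ?d * (1 + (dseq j + gap j))"
    using gap(1)[of j] d by (auto intro!: mult_left_mono)
  moreover have "?d * 2 = dy k" using dy(3)[of k] by simp
  moreover have "t \<le> ?d \<or> dy k < t" using assms by (auto simp: dseg_def)
  ultimately have "t \<notin> {?d * (1 + (dseq j - gap j))<..?d * (1 + dseq j)}" "t \<notin> {?d * (1 + dseq j)<..?d * (1 + (dseq j + gap j))}"
    by auto
  then show ?thesis by (simp add: haar_def)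
qed

lemma haar_supp': "t \<notin> {0<..1} \<Longrightarrow> haar k j t = 0"
  using dseg_unit[of k] by (intro haar_supp) blast

definition zL :: "nat \<Rightarrow> nat \<Rightarrow> L0" where "zL k j = abs_L0 (haar k j)"

lemma rp_zL: "AE t in lborel. rp (zL k j) t = haar k j t"
  unfolding zL_def by (rule rp_abs[OF haar_borel haar_supp'])

lemma measure_Ioc: "measure lborel {a<..b} = max 0 (b - a :: real)"
  by (cases "a \<le> b") auto

lemma haar_abs_powr:
  "\<bar>haar k j t\<bar> powr p = inverse (\<kappa> k * dy (Suc k) * gap j) powr p *
     indicator {dy (Suc k) * (1 + (dseq j - gap j))<..dy (Suc k) * (1 + (dseq j + gap j))} t"
proof -
  let ?d = "dy (Suc k)"
  let ?a = "?d * (1 + (dseq j - gap j))" and ?b = "?d * (1 + dseq j)" and ?c = "?d * (1 + (dseq j + gap j))"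
  have "0 < ?d" by (rule dy)
  then have "?a < ?b" "?b < ?c" using gap(1)[of j] by simp_all
  then have "\<bar>indicator {?a<..?b} t - indicator {?b<..?c} t\<bar> = (indicator {?a<..?c} t :: real)"
    by (auto simp: indicator_def)
  moreover have "0 \<le> inverse (\<kappa> k * ?d * gap j)"
    using \<kappa>_pos[of k] dy(1)[of "Suc k"] gap(1)[of j] by simp
  ultimately have "\<bar>haar k j t\<bar> = inverse (\<kappa> k * ?d * gap j) * indicator {?a<..?c} t"
    unfolding haar_def abs_mult by simp
  then show ?thesis using p by (simp add: powr_mult indicator_def)
qed

text \<open>The factor \<kappa> cancels the length of the interval, so the norm does not depend on
  \<open>k\<close>; the uniform bound on the vectors of level 0 rests on this.\<close>

lemma zL_norm: "zL k j \<in> Lp_space p" "md (zL k j) = 2 powr p * 2 * gap j powr (1 - p)"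
proof -
  let ?d = "dy (Suc k)"
  let ?I = "{?d * (1 + (dseq j - gap j))<..?d * (1 + (dseq j + gap j))}"
  have d: "0 < ?d" by (rule dy)
  have le: "?d * (1 + (dseq j - gap j)) \<le> ?d * (1 + (dseq j + gap j))"
    using d gap(1)[of j] by (intro mult_left_mono) auto
  have mI: "measure lborel ?I = ?d * (2 * gap j)"
    using le unfolding measure_Ioc by (simp add: algebra_simps)
  have ae: "AE t in lborel. \<bar>rp (zL k j) t\<bar> powr p = inverse (\<kappa> k * ?d * gap j) powr p * indicator ?I t"
    using rp_zL[of k j] by eventually_elim (simp add: haar_abs_powr)
  have "integrable lborel (indicat_real ?I)"
    using le by (intro integrable_real_indicator) auto
  then have i: "integrable lborel (\<lambda>t. inverse (\<kappa> k * ?d * gap j) powr p * indicator ?I t)" by simp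
  have "integrable lborel (\<lambda>t. \<bar>rp (zL k j) t\<bar> powr p)"
    by (subst Bochner_Integration.integrable_cong_AE[OF _ _ ae]) (use i in auto)
  then show "zL k j \<in> Lp_space p" by (simp add: Lp_space_def Lp_member_rp)
  have "md (zL k j) = (LINT t|lborel. inverse (\<kappa> k * ?d * gap j) powr p * indicator ?I t)"
    unfolding md_def by (rule integral_cong_AE[OF _ _ ae]) auto
  also have "\<dots> = inverse (\<kappa> k * ?d * gap j) powr p * (?d * (2 * gap j))" using mI by simp
  also have "\<kappa> k * ?d * gap j = 1 / 2 * ?d powr (1 / p) * gap j"
  proof -
    have "?d powr (1 / p - 1) * ?d powr 1 = ?d powr (1 / p)" by (simp only: powr_add[symmetric]) simp
    then show ?thesis using d by (simp add: \<kappa>_def)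
  qed
  also have "inverse (1 / 2 * ?d powr (1 / p) * gap j) powr p = 2 powr p / (?d * gap j powr p)"
    using d gap(1)[of j] p by (simp add: inverse_eq_divide powr_divide powr_mult powr_powr)
  also have "\<dots> * (?d * (2 * gap j)) = 2 powr p * 2 * (gap j / gap j powr p)" using d by simp
  also have "gap j / gap j powr p = gap j powr (1 - p)" using gap(1)[of j] by (simp add: powr_diff)
  finally show "md (zL k j) = 2 powr p * 2 * gap j powr (1 - p)" .
qed

text \<open>Integrating \<open>haar k j\<close> from the left end of its interval gives the tent
  \<open>bump j\<close> again; different intervals are disjoint.\<close>

lemma \<theta>L_zL: "\<theta>L l i (zL k j) = (if l = k then bump j (dseq i) else 0)"
proof -
  have eq: "(LINT t|lborel. indicator (seg_set l i) t * rp (zL k j) t) = (LINT t|lborel. indicator (seg_set l i) t * haar k j t)"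
    using rp_zL[of k j] by (intro integral_cong_AE) (auto elim!: eventually_mono)
  show ?thesis
  proof (cases "l = k")
    case False
    have "indicator (seg_set l i) t * haar k j t = 0" for t
      using seg_set_dseg[of l i] dseg_disjoint[OF False] haar_supp[of t k j] by (auto simp: indicator_def)
    then have "(LINT t|lborel. indicator (seg_set l i) t * haar k j t) = integral\<^sup>L lborel (\<lambda>t::real. 0)"
      by (intro Bochner_Integration.integral_cong) auto
    then show ?thesis using False by (simp add: \<theta>L_def eq)
  next
    case True
    let ?d = "dy (Suc k)" and ?r = "dseq j" and ?g = "gap j" and ?u = "dseq i"
    have d: "0 < ?d" by (rule dy)
    have g: "0 < ?g" "?g \<le> ?r" "0 < ?u" using gap dseq by auto
    have int: "integrable lborel (indicat_real {a<..b})" for a b :: real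
      by (cases "a \<le> b") (auto intro: integrable_real_indicator)
    have inter: "indicator {a<..b} t * indicator {a'<..b'} t = (indicator {max a a'<..min b b'} t :: real)" for a b a' b' t :: real
      by (auto simp: indicator_def)
    have mono: "max (?d * a) (?d * b) = ?d * max a b" "min (?d * a) (?d * b) = ?d * min a b" for a b
      using d by (simp_all add: max_mult_distrib_left min_mult_distrib_left)
    have len: "(LINT t|lborel. indicat_real {?d * a<..?d * b} t) = ?d * max 0 (b - a)" for a b
      using d by (simp add: measure_Ioc max_mult_distrib_left right_diff_distrib)
    let ?c = "inverse (\<kappa> k * ?d * ?g)"
    \<comment> \<open>Overlap with the positive half minus overlap with the negative half, as the
      upper limit passes the peak.\<close>
    have val: "max 0 (min (1 + ?u) (1 + ?r) - max 1 (1 + (?r - ?g))) - max 0 (min (1 + ?u) (1 + (?r + ?g)) - max 1 (1 + ?r))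
        = max 0 (?g - \<bar>?u - ?r\<bar>)"
      using g dseq(1)[of j] by (auto simp: max_def min_def abs_if)
    have "(LINT t|lborel. indicator (seg_set k i) t * haar k j t) = (LINT t|lborel. ?c *
        (indicator {?d * max 1 (1 + (?r - ?g))<..?d * min (1 + ?u) (1 + ?r)} t
         - indicator {?d * max 1 (1 + ?r)<..?d * min (1 + ?u) (1 + (?r + ?g))} t))"
    proof (rule Bochner_Integration.integral_cong[OF refl])
      fix t
      have "indicator (seg_set k i) t * haar k j t = ?c *
        (indicator {?d * 1<..?d * (1 + ?u)} t * indicator {?d * (1 + (?r - ?g))<..?d * (1 + ?r)} t
         - indicator {?d * 1<..?d * (1 + ?u)} t * indicator {?d * (1 + ?r)<..?d * (1 + (?r + ?g))} t)"
        by (simp add: seg_set_def haar_def right_diff_distrib mult.left_commute)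
      then show "indicator (seg_set k i) t * haar k j t = ?c *
        (indicator {?d * max 1 (1 + (?r - ?g))<..?d * min (1 + ?u) (1 + ?r)} t
         - indicator {?d * max 1 (1 + ?r)<..?d * min (1 + ?u) (1 + (?r + ?g))} t)"
        unfolding inter mono .
    qed
    also have "\<dots> = ?c * (?d * max 0 (min (1 + ?u) (1 + ?r) - max 1 (1 + (?r - ?g)))
        - ?d * max 0 (min (1 + ?u) (1 + (?r + ?g)) - max 1 (1 + ?r)))"
      unfolding integral_mult_right_zero Bochner_Integration.integral_diff[OF int int] len ..
    also have "\<dots> = ?c * (?d * max 0 (?g - \<bar>?u - ?r\<bar>))"
      unfolding right_diff_distrib[symmetric] val ..
    finally have "\<theta>L l i (zL k j) = \<kappa> k * (?c * (?d * max 0 (?g - \<bar>?u - ?r\<bar>)))"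
      unfolding \<theta>L_def eq by (simp only: True)
    also have "\<dots> = max 0 (?g - \<bar>?u - ?r\<bar>) / ?g" using \<kappa>_pos[of k] d by (simp add: field_simps)
    also have "\<dots> = bump j ?u" using g(1) by (simp add: bump_def max_def field_simps)
    finally show ?thesis using True by simp
  qed
qed

text \<open>Moves the part on the interval \<open>\<pi> k\<close> to the interval \<open>k\<close>;
  the power of \<open>quot\<close> makes this preserve the norm.\<close>

definition sperm :: "(nat \<Rightarrow> nat) \<Rightarrow> (nat \<Rightarrow> real) \<Rightarrow> L0 \<Rightarrow> real \<Rightarrow> real" where
  "sperm \<pi> \<sigma> F t = (\<Sum>k. indicator (dseg k) t * (\<sigma> k * quot \<pi> k powr (1 / p) * rp F (quot \<pi> k * t)))"

lemma sperm_borel[measurable]: "sperm \<pi> \<sigma> F \<in> borel_measurable borel"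
  unfolding sperm_def[abs_def] by measurable

lemma sperm_at: "t \<in> dseg k \<Longrightarrow> sperm \<pi> \<sigma> F t = \<sigma> k * quot \<pi> k powr (1 / p) * rp F (quot \<pi> k * t)"
  unfolding sperm_def by (rule suminf_dseg)

lemma sperm_supp: "t \<notin> {0<..1} \<Longrightarrow> sperm \<pi> \<sigma> F t = 0"
  unfolding sperm_def by (rule suminf_dseg_out)

lemma rp_sperm: "AE t in lborel. rp (abs_L0 (sperm \<pi> \<sigma> F)) t = sperm \<pi> \<sigma> F t"
  by (rule rp_abs[OF sperm_borel sperm_supp])

text \<open>The p-th power of the factor in \<open>sperm\<close> is the Jacobian of the substitution
  on each interval, and \<pi> only reorders the sum. Nonnegative integrals avoid presupposing that
  \<open>sperm\<close> is integrable.\<close>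

lemma nn_integral_sperm:
  assumes \<pi>: "bij \<pi>" and \<sigma>: "\<And>k. \<bar>\<sigma> k\<bar> = 1"
  shows "(\<integral>\<^sup>+t. ennreal (\<bar>sperm \<pi> \<sigma> F t\<bar> powr p) \<partial>lborel) = (\<integral>\<^sup>+t. ennreal (\<bar>rp F t\<bar> powr p) \<partial>lborel)"
proof -
  let ?h = "\<lambda>k t. indicator (dseg k) t * \<bar>rp F t\<bar> powr p"
  have seg: "(\<integral>\<^sup>+t. ennreal (indicator (dseg k) t * \<bar>sperm \<pi> \<sigma> F t\<bar> powr p) \<partial>lborel) = (\<integral>\<^sup>+t. ennreal (?h (\<pi> k) t) \<partial>lborel)" for k
  proof -
    have q: "0 < quot \<pi> k" by (rule quot_pos)
    have "indicator (dseg k) t * \<bar>sperm \<pi> \<sigma> F t\<bar> powr p = quot \<pi> k * ?h (\<pi> k) (0 + quot \<pi> k * t)" for t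
    proof (cases "t \<in> dseg k")
      case True
      then have "\<bar>sperm \<pi> \<sigma> F t\<bar> = quot \<pi> k powr (1 / p) * \<bar>rp F (quot \<pi> k * t)\<bar>"
        using \<sigma>[of k] by (simp add: sperm_at abs_mult)
      then show ?thesis using True p q by (simp add: dseg_quot powr_mult powr_powr)
    qed (simp add: dseg_quot)
    then have "(\<integral>\<^sup>+t. ennreal (indicator (dseg k) t * \<bar>sperm \<pi> \<sigma> F t\<bar> powr p) \<partial>lborel)
        = (\<integral>\<^sup>+t. ennreal (quot \<pi> k) * ennreal (?h (\<pi> k) (0 + quot \<pi> k * t)) \<partial>lborel)"
      using q by (simp add: ennreal_mult')
    also have "\<dots> = ennreal \<bar>quot \<pi> k\<bar> * (\<integral>\<^sup>+t. ennreal (?h (\<pi> k) (0 + quot \<pi> k * t)) \<partial>lborel)"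
      using q by (subst nn_integral_cmult) auto
    also have "\<dots> = (\<integral>\<^sup>+t. ennreal (?h (\<pi> k) t) \<partial>lborel)"
      using q by (intro nn_integral_real_affine[symmetric]) auto
    finally show ?thesis .
  qed
  have "(\<integral>\<^sup>+t. ennreal (\<bar>sperm \<pi> \<sigma> F t\<bar> powr p) \<partial>lborel)
      = (\<Sum>k. \<integral>\<^sup>+t. ennreal (indicator (dseg k) t * \<bar>sperm \<pi> \<sigma> F t\<bar> powr p) \<partial>lborel)"
    by (rule nn_integral_dseg_decomp) (simp_all add: sperm_supp)
  also have "\<dots> = (\<Sum>k. \<integral>\<^sup>+t. ennreal (?h (\<pi> k) t) \<partial>lborel)" unfolding seg ..
  also have "\<dots> = (\<Sum>k. \<integral>\<^sup>+t. ennreal (?h k t) \<partial>lborel)" by (rule bij_suminf_ennreal[OF \<pi>])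
  also have "\<dots> = (\<integral>\<^sup>+t. ennreal (\<bar>rp F t\<bar> powr p) \<partial>lborel)"
    by (rule nn_integral_dseg_decomp[symmetric]) (simp_all add: rp_supp)
  finally show ?thesis .
qed

lemma sperm_norm:
  assumes F: "F \<in> Lp_space p" and \<pi>: "bij \<pi>" and \<sigma>: "\<And>k. \<bar>\<sigma> k\<bar> = 1"
  shows "abs_L0 (sperm \<pi> \<sigma> F) \<in> Lp_space p" "Lp_norm p (abs_L0 (sperm \<pi> \<sigma> F)) = Lp_norm p F"
proof -
  have "(\<integral>\<^sup>+t. ennreal (\<bar>rp (abs_L0 (sperm \<pi> \<sigma> F)) t\<bar> powr p) \<partial>lborel)
      = (\<integral>\<^sup>+t. ennreal (\<bar>sperm \<pi> \<sigma> F t\<bar> powr p) \<partial>lborel)"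
    using rp_sperm[of \<pi> \<sigma> F] by (intro nn_integral_cong_AE) (auto elim!: eventually_mono)
  also have "\<dots> = (\<integral>\<^sup>+t. ennreal (\<bar>rp F t\<bar> powr p) \<partial>lborel)"
    by (rule nn_integral_sperm[OF \<pi> \<sigma>])
  finally have nn: "(\<integral>\<^sup>+t. ennreal (\<bar>rp (abs_L0 (sperm \<pi> \<sigma> F)) t\<bar> powr p) \<partial>lborel)
      = (\<integral>\<^sup>+t. ennreal (\<bar>rp F t\<bar> powr p) \<partial>lborel)" .
  have "(\<integral>\<^sup>+t. ennreal (\<bar>rp F t\<bar> powr p) \<partial>lborel) < \<infinity>"
    using Lp_int[OF F] by (simp add: integrable_iff_bounded)
  then have "integrable lborel (\<lambda>t. \<bar>rp (abs_L0 (sperm \<pi> \<sigma> F)) t\<bar> powr p)"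
    using nn by (simp add: integrable_iff_bounded)
  then show "abs_L0 (sperm \<pi> \<sigma> F) \<in> Lp_space p" by (simp add: Lp_space_def Lp_member_rp)
  have "md (abs_L0 (sperm \<pi> \<sigma> F)) = md F"
    unfolding md_def using nn by (subst (1 2) integral_eq_nn_integral) auto
  then show "Lp_norm p (abs_L0 (sperm \<pi> \<sigma> F)) = Lp_norm p F" by (simp add: Lp_norm_md)
qed

text \<open>The factor of \<open>sperm\<close> and the inverse Jacobian together turn one
  normalisation into the other.\<close>

lemma \<kappa>_quot: "\<kappa> k * quot \<pi> k powr (1 / p) * inverse (quot \<pi> k) = \<kappa> (\<pi> k)"
proof -
  have q: "0 < quot \<pi> k" and d: "0 < dy (Suc k)" by (rule quot_pos dy)+
  have "\<kappa> (\<pi> k) = 1 / 2 * (quot \<pi> k * dy (Suc k)) powr (1 / p - 1)" unfolding \<kappa>_def quot_dy ..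
  also have "\<dots> = 1 / 2 * (quot \<pi> k powr (1 / p - 1) * dy (Suc k) powr (1 / p - 1))"
    by (simp only: powr_mult)
  also have "quot \<pi> k powr (1 / p - 1) = quot \<pi> k powr (1 / p) * inverse (quot \<pi> k)"
    using q by (simp add: powr_diff divide_inverse)
  finally show ?thesis unfolding \<kappa>_def by (simp only: mult_ac)
qed

lemma \<theta>L_sperm: "\<theta>L k j (abs_L0 (sperm \<pi> \<sigma> F)) = \<sigma> k * \<theta>L (\<pi> k) j F"
proof -
  let ?c = "\<sigma> k * quot \<pi> k powr (1 / p)"
  let ?h = "\<lambda>t. indicator (seg_set (\<pi> k) j) t * rp F t"
  have q: "0 < quot \<pi> k" by (rule quot_pos)
  have "(LINT t|lborel. indicator (seg_set k j) t * rp (abs_L0 (sperm \<pi> \<sigma> F)) t)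
      = (LINT t|lborel. ?c * ?h (0 + quot \<pi> k * t))"
  proof (rule integral_cong_AE)
    show "AE t in lborel. indicator (seg_set k j) t * rp (abs_L0 (sperm \<pi> \<sigma> F)) t = ?c * ?h (0 + quot \<pi> k * t)"
      using rp_sperm[of \<pi> \<sigma> F]
    proof eventually_elim
      case (elim t)
      show ?case
      proof (cases "t \<in> seg_set k j")
        case True
        then have "t \<in> dseg k" using seg_set_dseg by blast
        then show ?thesis using True by (simp add: elim sperm_at seg_set_quot)
      qed (simp add: seg_set_quot)
    qed
  qed auto
  also have "\<dots> = ?c * (LINT t|lborel. ?h (0 + quot \<pi> k * t))" by (rule integral_mult_right_zero)
  also have "(LINT t|lborel. ?h (0 + quot \<pi> k * t)) = inverse (quot \<pi> k) * (LINT t|lborel. ?h t)"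
    using lborel_integral_real_affine[of "quot \<pi> k" ?h 0] q by simp
  finally show ?thesis unfolding \<theta>L_def \<kappa>_quot[of k \<pi>, symmetric] by simp
qed

definition cut :: "nat \<Rightarrow> L0 \<Rightarrow> L0" where "cut n F = abs_L0 (\<lambda>t. indicator {..dy n} t * rp F t)"

lemma rp_cut: "AE t in lborel. rp (cut n F) t = indicator {..dy n} t * rp F t"
  unfolding cut_def by (rule rp_abs) (simp_all add: rp_supp)

lemma cut_norm: assumes F: "F \<in> Lp_space p"
  shows "cut n F \<in> Lp_space p" "Lp_norm p (cut n F) = mtail n F powr (1 / p)"
proof -
  have ae: "AE t in lborel. \<bar>rp (cut n F) t\<bar> powr p = indicator {..dy n} t * \<bar>rp F t\<bar> powr p"
    using rp_cut[of n F] by eventually_elim (simp add: indicator_def)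
  have "integrable lborel (\<lambda>t. \<bar>rp (cut n F) t\<bar> powr p)"
    by (subst Bochner_Integration.integrable_cong_AE[OF _ _ ae]) (use int_ind[OF Lp_int[OF F]] in auto)
  then show "cut n F \<in> Lp_space p" by (simp add: Lp_space_def Lp_member_rp)
  have "md (cut n F) = mtail n F" unfolding md_def mtail_def by (rule integral_cong_AE[OF _ _ ae]) auto
  then show "Lp_norm p (cut n F) = mtail n F powr (1 / p)" by (simp add: Lp_norm_md)
qed

lemma \<theta>L_cut: "\<theta>L k j (cut n F) = (if k < n then 0 else \<theta>L k j F)"
proof -
  have "(LINT t|lborel. indicator (seg_set k j) t * rp (cut n F) t)
      = (LINT t|lborel. indicator (seg_set k j) t * (if k < n then 0 else rp F t))"
  proof (rule integral_cong_AE)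
    show "AE t in lborel. indicator (seg_set k j) t * rp (cut n F) t = indicator (seg_set k j) t * (if k < n then 0 else rp F t)"
      using rp_cut[of n F]
    proof eventually_elim
      case (elim t)
      show ?case
      proof (cases "t \<in> seg_set k j")
        case True
        then have t: "t \<in> dseg k" using seg_set_dseg by blast
        show ?thesis
          using t dy_mono[of "Suc k" n] dy_mono[of n k] by (auto simp: elim dseg_def indicator_def)
      qed simp
    qed
  qed auto
  then show ?thesis by (simp add: \<theta>L_def)
qed

text \<open>This norm is itself invariant under \<open>sperm\<close>, so it serves both as the given
  and as the invariant norm.\<close>

lemma Lp_triangular:
  "triangular_space (Lp_space p) (Lp_norm p) (Lp_norm p) \<theta>L zL (\<lambda>i j. bump j (dseq i))
     ((2 powr p * 2 * gap 0 powr (1 - p)) powr (1 / p))"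
proof
  show "subspace (Lp_space p)" "norm_on (Lp_space p) (Lp_norm p)" by (rule subspace_Lp norm_Lp)+
  show "equivalent_norm (Lp_space p) (Lp_norm p) (Lp_norm p)" by (rule equivalent_norm_refl[OF norm_Lp])
  show "bump i (dseq i) = 1" for i by (rule bump_diag)
  show "i < j \<Longrightarrow> bump j (dseq i) = 0" for i j by (rule bump_lower)
  show "zL k i \<in> Lp_space p" for k i by (rule zL_norm)
  show "\<theta>L l j (zL k i) = (if l = k then bump i (dseq j) else 0)" for l j k i by (rule \<theta>L_zL)
  show "Lp_norm p (zL k 0) \<le> (2 powr p * 2 * gap 0 powr (1 - p)) powr (1 / p)" for k
    by (simp add: Lp_norm_md zL_norm)
  show "\<theta>L k i (a *\<^sub>R F) = a * \<theta>L k i F" for k i a F by (rule \<theta>L_scale)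
  fix F assume F: "F \<in> Lp_space p"
  show "\<theta>L k i (F + G) = \<theta>L k i F + \<theta>L k i G" if "G \<in> Lp_space p" for k i G by (rule \<theta>L_add[OF F that])
  show "\<bar>\<theta>L k i F\<bar> \<le> Lp_norm p F" for k i by (rule \<theta>L_le[OF F])
  show "F = G" if "G \<in> Lp_space p" "\<And>k i. \<theta>L k i F = \<theta>L k i G" for G by (rule \<theta>L_sep[OF F that])
  show "\<exists>y\<in>Lp_space p. (\<forall>k i. \<theta>L k i y = \<sigma> k * \<theta>L (\<pi> k) i F) \<and> Lp_norm p y = Lp_norm p F"
    if "bij \<pi>" "\<And>k. \<bar>\<sigma> k\<bar> = 1" for \<pi> \<sigma>
    using sperm_norm[OF F that] \<theta>L_sperm by (intro bexI[of _ "abs_L0 (sperm \<pi> \<sigma> F)"]) auto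
  fix \<epsilon> :: real assume \<epsilon>: "0 < \<epsilon>"
  obtain n where n: "mtail n F powr (1 / p) < \<epsilon>" using powr_null[OF F \<epsilon>] by blast
  show "\<exists>n. \<exists>x'\<in>Lp_space p. (\<forall>k i. \<theta>L k i x' = (if k < n then 0 else \<theta>L k i F)) \<and> Lp_norm p x' < \<epsilon>"
    using cut_norm[OF F, of n] n \<theta>L_cut by (intro exI[of _ n] bexI[of _ "cut n F"]) auto
qed

end

theorem theorem22:
  fixes H :: "(nat \<Rightarrow> nat) set"
    and s :: "nat \<Rightarrow> nat"
    and G :: "(nat \<Rightarrow> nat) monoid"
    and \<tau> :: "(nat \<Rightarrow> nat) topology"
  assumes "subgroup H Sinf"
    and "closedin Sinf_topology H"
    and G: "G = Sinf\<lparr>carrier := H\<rparr>"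
    and \<tau>: "\<tau> = subtopology Sinf_topology H"
    and "s \<in> carrier G"
    and "s \<noteq> \<one>\<^bsub>G\<^esub>"
    and "\<forall>g\<in>carrier G. s \<otimes>\<^bsub>G\<^esub> g = g \<otimes>\<^bsub>G\<^esub> s"
    and "s \<otimes>\<^bsub>G\<^esub> s = \<one>\<^bsub>G\<^esub>"
  shows "displayable G \<tau> c0_space c0_norm
       \<and> displayable G \<tau> C01_space C01_norm
       \<and> (\<forall>p::real. 1 \<le> p \<longrightarrow> displayable G \<tau> (lp_space p) (lp_norm p))
       \<and> (\<forall>p::real. 1 \<le> p \<longrightarrow> displayable G \<tau> (Lp_space p) (Lp_norm p))"
proof -
  have m: "s \<in> H" using assms(5) G by simp
  have bij: "carrier G = H" "\<And>g h. g \<in> H \<Longrightarrow> h \<in> H \<Longrightarrow> g \<otimes>\<^bsub>G\<^esub> h = g \<circ> h" "\<one>\<^bsub>G\<^esub> = id"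
    using mult_Sinf subgroup.mem_carrier[OF assms(1)] one_Sinf G by auto
  have H: "involution_group H s"
  proof (rule involution_group.intro)
    show "subgroup H Sinf" "closedin Sinf_topology H" "s \<in> H" by (rule assms m)+
    show "s \<noteq> id" using assms(6) bij by simp
    show "s \<circ> g = g \<circ> s" if "g \<in> H" for g using assms(7) bij m that by simp
    show "s \<circ> s = id" using assms(8) bij m by simp
  qed
  have sym: "displayable G \<tau> V N0" if "symmetric_space V N0 N I \<phi> z K"
    for V :: "'v::real_vector set" and N0 N I \<phi> z K
    unfolding G \<tau> by (rule symmetric_display.displayable[OF symmetric_display.intro[OF that H]])
  have tri: "displayable G \<tau> V N0" if "triangular_space V N0 N \<theta> z c K"
    for V :: "'v::real_vector set" and N0 N \<theta> z c K
  proof -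
    interpret triangular_space V N0 N \<theta> z c K by (rule that)
    show ?thesis by (rule sym[OF symmetric_space_axioms])
  qed
  show ?thesis
    using sym[OF c0_symmetric] tri[OF C01_triangular] sym[OF lp_symmetric] tri[OF Lp_exponent.Lp_triangular]
    by (simp add: Lp_exponent_def)
qed

end
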